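(* Let $F$ be the Dirichlet$(1/2,\dots,1/2)$ distribution on $\triangle_d$, let $W_n(\lambda):=\prod_{i=1}^n\lambda^\top\mathbf E_i$ (with $W_0(\lambda)=1$), and let $$\lambda_n^{\mathrm{UP}}:=\frac{\int_{\triangle_d}\lambda\,W_{n-1}(\lambda)\,\mathrm dF(\lambda)}{\int_{\triangle_d}W_{n-1}(\lambda)\,\mathrm dF(\lambda)},\qquad n\ge1,$$ be the outputs of the universal portfolio algorithm. Then: (1) $W_n^{\mathrm{UP}}:=\prod_{i=1}^n(\lambda_i^{\mathrm{UP}})^\top\mathbf E_i$ is a test $\mathcal P$-supermartingale with logarithmic portfolio regret. (2) $W_n^{\mathrm{CO96}}:=\exp\left\{\max_{\lambda\in\triangle_d}\log W_n(\lambda)-\frac{d\log(n+1)}2-\log 2\right\}$ is a $\mathcal P$-$e$-process with logarithmic portfolio regret. (3) If $d=1$, let $\lambda_n^{\max}\in[0,1]$ be a maximizer over $\lambda\in[0,1]$ of $\sum_{i=1}^n\log\big((1-\lambda)E_i^{(0)}+\lambda E_i^{(1)}\big)$. Then $$W_n^{\mathrm{OJ23}}:=\exp\left\{\sum_{i=1}^n\log\big((1-\lambda_n^{\max})E_i^{(0)}+\lambda_n^{\max}E_i^{(1)}\big)-\max_{j=0,1,\dots,n}\log\left(\frac{\pi(\lambda_n^{\max})^j(1-\lambda_n^{\max})^{n-j}\Gamma(n+1)}{\Gamma(j+1/2)\Gamma(n-j+1/2)}\right)\right\}$$ is a $\mathcal P$-$e$-process with logarithmic portfolio regret. Consequently,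 each of $W^{\mathrm{UP}}$, $W^{\mathrm{CO96}}$ and (when $d=1$) $W^{\mathrm{OJ23}}$ is a $\mathcal P$-$e$-process with a sublinear portfolio regret bound and is hence, for any collection $\mathcal Q$ of alternative distributions, $\mathcal Q$-instance-log-optimal in the class of all $\mathcal P$-$e$-processes: denoting any of them by $W$, for every $Q\in\mathcal Q$ and every $\mathcal P$-$e$-process $W'$, $\liminf_{n\to\infty}\frac1n(\log W_n-\log W_n')\ge0$ $Q$-almost surely.
   Context: Fix $d\in\mathbb N$ and let $\triangle_d=\{\lambda\in[0,1]^{d+1}:\sum_{j=0}^d\lambda^{(j)}=1\}$. Work on a measurable space with a discrete-time filtration $(\mathcal F_n)_{n\ge0}$, $\mathcal F_0$ trivial (for concreteness, one can think of $\mathcal F_n$ as the sigma-algebra generated by the random objects observed up to time $n$). Let $(\mathbf E_n)_{n=1}^\infty$, $\mathbf E_n=(E_n^{(0)},\dots,E_n^{(d)})$, be random vectors with values in $[0,\infty)^{d+1}$ such that $E_n^{(0)}=1$ deterministically; the coordinates of $\mathbf E_n$ may be arbitrarily dependent. Under every distribution considered, $(\mathbf E_n)$ is i.i.d. Null hypothesis: $\mathcal P$ is the set of all distributions $P$ with $E_1^{(0)}=1$ and $\mathbb E_P[E_1^{(j)}]\le 1$ for each $j\in\{1,\dots,d\}$. An alternative distribution is a distribution $Q$ under which $(\mathbf E_n)$ is i.i.d. A test $P$-supermartingale is a nonnegative process $(M_n)$ adapted to $(\mathcal F_n)$ with $\mathbb E_P[M_n\mid\mathcal F_{n-1}]\le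 M_{n-1}$ $P$-a.s. for $n\ge2$ and $\mathbb E_P[M_1]\le1$; a test $\mathcal P$-supermartingale is a test $P$-supermartingale for every $P\in\mathcal P$. A $\mathcal P$-$e$-process is a nonnegative adapted process $(W_n)$ such that for each $P\in\mathcal P$ there is a test $P$-supermartingale $(M_n^{(P)})$ with $W_n\le M_n^{(P)}$ for all $n$, $P$-a.s. The portfolio regret of $W_n$ is $\mathcal R_n=\max_{\lambda\in\triangle_d}\sum_{i=1}^n\log(\lambda^\top\mathbf E_i)-\log(W_n)$. "Logarithmic portfolio regret" means that there is a deterministic sequence $r_n=O(\log n)$ (as $n\to\infty$) with $\mathcal R_n\le r_n$ for all $n$ and every outcome; a sublinear bound is one with $r_n=o(n)$. Convention: $0^0=1$.
   Formalization: I.i.d. includes E_n independent of F_{n-1}; optimality assumes the measurable space realizes every law on {1}×[0,∞)^d, by a P sharing with Q the conditional probabilities of F_n given E_1..E_n. Else false: on a one-point space with E=(1,2) the null is empty. λ^max is chosen measurably. *)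

theory Defs
  imports "HOL-Probability.Probability" "HOL-Library.Landau_Symbols"
begin

text \<open>Vectors indexed by \<open>0, \<dots>, d\<close> are extensional functions on \<open>{..d}\<close>.\<close>

definition vec_algebra :: "nat \<Rightarrow> (nat \<Rightarrow> real) measure" where
  "vec_algebra d = Pi\<^sub>M {..d} (\<lambda>_. borel)"

definition prob_simplex :: "nat \<Rightarrow> (nat \<Rightarrow> real) set" where
  "prob_simplex d = {l \<in> {..d} \<rightarrow>\<^sub>E {0..1}. (\<Sum>j\<le>d. l j) = 1}"

definition payoff :: "nat \<Rightarrow> (nat \<Rightarrow> real) \<Rightarrow> (nat \<Rightarrow> real) \<Rightarrow> real" where
  "payoff d l x = (\<Sum>j\<le>d. l j * x j)"

text \<open>Extended logarithm on \<open>[0, \<infinity>)\<close>, with \<open>log 0 = -\<infinity>\<close>; the library's real \<^const>\<open>ln\<close> has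
  \<open>ln 0 = 0\<close>.\<close>

definition elog :: "real \<Rightarrow> ereal" where
  "elog x = (if x = 0 then - \<infinity> else ereal (ln x))"


section \<open>Setting and distributions\<close>

definition evalue_setting ::
    "nat \<Rightarrow> 'a measure \<Rightarrow> (nat \<Rightarrow> 'a measure) \<Rightarrow> (nat \<Rightarrow> 'a \<Rightarrow> nat \<Rightarrow> real) \<Rightarrow> bool" where
  "evalue_setting d \<Omega> F E \<longleftrightarrow>
     filtration (space \<Omega>) F \<and> (\<forall>n. subalgebra \<Omega> (F n)) \<and>
     sets (F 0) = {{}, space \<Omega>} \<and>
     (\<forall>n\<ge>1. E n \<in> measurable (F n) (vec_algebra d)) \<and>
     (\<forall>n\<ge>1. \<forall>\<omega>\<in>space \<Omega>. E n \<omega> 0 = 1 \<and> (\<forall>j\<le>d. 0 \<le> E n \<omega> j))"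

text \<open>A distribution is a probability measure on the measurable space underlying \<open>\<Omega>\<close>.
  ``I.i.d.'' is understood relative to the filtration: \<open>E n\<close> is moreover independent of
  \<open>F (n - 1)\<close>. For the filtration generated by the \<open>E n\<close> this is automatic; for a filtration
  that looks into the future of \<open>(E n)\<close> no supermartingale statement could hold.\<close>

definition iid_distributions ::
    "nat \<Rightarrow> 'a measure \<Rightarrow> (nat \<Rightarrow> 'a measure) \<Rightarrow> (nat \<Rightarrow> 'a \<Rightarrow> nat \<Rightarrow> real) \<Rightarrow> 'a measure set" where
  "iid_distributions d \<Omega> F E =
     {P. prob_space P \<and> sets P = sets \<Omega> \<and>
         prob_space.indep_vars P (\<lambda>_. vec_algebra d) E {1..} \<and>
         (\<forall>n\<ge>1. distr P (vec_algebra d) (E n) = distr P (vec_algebra d) (E 1)) \<and>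
         (\<forall>n\<ge>1. prob_space.indep_set P (sets (F (n - 1)))
                   {E n -` B \<inter> space P |B. B \<in> sets (vec_algebra d)})}"

text \<open>The requirement \<open>E 1 \<omega> 0 = 1\<close> is part of the setting.\<close>

definition null_hypothesis ::
    "nat \<Rightarrow> 'a measure \<Rightarrow> (nat \<Rightarrow> 'a measure) \<Rightarrow> (nat \<Rightarrow> 'a \<Rightarrow> nat \<Rightarrow> real) \<Rightarrow> 'a measure set" where
  "null_hypothesis d \<Omega> F E =
     {P \<in> iid_distributions d \<Omega> F E. \<forall>j\<in>{1..d}. (\<integral>\<^sup>+ \<omega>. ennreal (E 1 \<omega> j) \<partial>P) \<le> 1}"


section \<open>Test supermartingales and e-processes\<close>

text \<open>Processes are indexed by \<open>n \<ge> 1\<close>; values at index 0 are irrelevant.\<close>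

definition nonneg_adapted :: "'a measure \<Rightarrow> (nat \<Rightarrow> 'a measure) \<Rightarrow> (nat \<Rightarrow> 'a \<Rightarrow> real) \<Rightarrow> bool" where
  "nonneg_adapted \<Omega> F W \<longleftrightarrow>
     (\<forall>n\<ge>1. W n \<in> borel_measurable (F n) \<and> (\<forall>\<omega>\<in>space \<Omega>. 0 \<le> W n \<omega>))"

definition test_supermartingale ::
    "'a measure \<Rightarrow> (nat \<Rightarrow> 'a measure) \<Rightarrow> 'a measure \<Rightarrow> (nat \<Rightarrow> 'a \<Rightarrow> real) \<Rightarrow> bool" where
  "test_supermartingale \<Omega> F P M \<longleftrightarrow>
     nonneg_adapted \<Omega> F M \<and>
     (\<integral>\<^sup>+ \<omega>. ennreal (M 1 \<omega>) \<partial>P) \<le> 1 \<and>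
     (\<forall>n\<ge>2. AE \<omega> in P.
        nn_cond_exp P (F (n - 1)) (\<lambda>\<omega>. ennreal (M n \<omega>)) \<omega> \<le> ennreal (M (n - 1) \<omega>))"

definition test_supermartingale_for ::
    "'a measure \<Rightarrow> (nat \<Rightarrow> 'a measure) \<Rightarrow> 'a measure set \<Rightarrow> (nat \<Rightarrow> 'a \<Rightarrow> real) \<Rightarrow> bool" where
  "test_supermartingale_for \<Omega> F \<P> M \<longleftrightarrow>
     nonneg_adapted \<Omega> F M \<and> (\<forall>P\<in>\<P>. test_supermartingale \<Omega> F P M)"

definition e_process ::
    "'a measure \<Rightarrow> (nat \<Rightarrow> 'a measure) \<Rightarrow> 'a measure set \<Rightarrow> (nat \<Rightarrow> 'a \<Rightarrow> real) \<Rightarrow> bool" where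
  "e_process \<Omega> F \<P> W \<longleftrightarrow>
     nonneg_adapted \<Omega> F W \<and>
     (\<forall>P\<in>\<P>. \<exists>M. test_supermartingale \<Omega> F P M \<and> (AE \<omega> in P. \<forall>n\<ge>1. W n \<omega> \<le> M n \<omega>))"


section \<open>Portfolio regret\<close>

text \<open>The supremum is attained: the objective is upper semicontinuous on a compact set. It is a
  real number, since it is at least 0 (portfolio \<open>(1, 0, \<dots>, 0)\<close>) and less than \<open>\<infinity>\<close>.\<close>

definition max_log_wealth :: "nat \<Rightarrow> (nat \<Rightarrow> 'a \<Rightarrow> nat \<Rightarrow> real) \<Rightarrow> nat \<Rightarrow> 'a \<Rightarrow> ereal" where
  "max_log_wealth d E n \<omega> = (SUP l\<in>prob_simplex d. \<Sum>i=1..n. elog (payoff d l (E i \<omega>)))"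

definition portfolio_regret ::
    "nat \<Rightarrow> (nat \<Rightarrow> 'a \<Rightarrow> nat \<Rightarrow> real) \<Rightarrow> (nat \<Rightarrow> 'a \<Rightarrow> real) \<Rightarrow> nat \<Rightarrow> 'a \<Rightarrow> ereal" where
  "portfolio_regret d E W n \<omega> = max_log_wealth d E n \<omega> - elog (W n \<omega>)"

definition logarithmic_regret ::
    "nat \<Rightarrow> 'a measure \<Rightarrow> (nat \<Rightarrow> 'a \<Rightarrow> nat \<Rightarrow> real) \<Rightarrow> (nat \<Rightarrow> 'a \<Rightarrow> real) \<Rightarrow> bool" where
  "logarithmic_regret d \<Omega> E W \<longleftrightarrow>
     (\<exists>r :: nat \<Rightarrow> real. r \<in> O(\<lambda>n. ln (real n)) \<and>
        (\<forall>n\<ge>1. \<forall>\<omega>\<in>space \<Omega>. portfolio_regret d E W n \<omega> \<le> ereal (r n)))"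

definition sublinear_regret ::
    "nat \<Rightarrow> 'a measure \<Rightarrow> (nat \<Rightarrow> 'a \<Rightarrow> nat \<Rightarrow> real) \<Rightarrow> (nat \<Rightarrow> 'a \<Rightarrow> real) \<Rightarrow> bool" where
  "sublinear_regret d \<Omega> E W \<longleftrightarrow>
     (\<exists>r :: nat \<Rightarrow> real. r \<in> o(\<lambda>n. real n) \<and>
        (\<forall>n\<ge>1. \<forall>\<omega>\<in>space \<Omega>. portfolio_regret d E W n \<omega> \<le> ereal (r n)))"


section \<open>Instance log-optimality\<close>

definition instance_log_optimal ::
    "'a measure \<Rightarrow> (nat \<Rightarrow> 'a measure) \<Rightarrow> 'a measure set \<Rightarrow> 'a measure set \<Rightarrow>
     (nat \<Rightarrow> 'a \<Rightarrow> real) \<Rightarrow> bool" where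
  "instance_log_optimal \<Omega> F \<P> \<Q> W \<longleftrightarrow>
     e_process \<Omega> F \<P> W \<and>
     (\<forall>Q\<in>\<Q>. \<forall>W'. e_process \<Omega> F \<P> W' \<longrightarrow>
        (AE \<omega> in Q. 0 \<le> liminf (\<lambda>n. ereal (1 / real n) * (elog (W n \<omega>) - elog (W' n \<omega>)))))"

definition observed_algebra ::
    "nat \<Rightarrow> 'a measure \<Rightarrow> (nat \<Rightarrow> 'a \<Rightarrow> nat \<Rightarrow> real) \<Rightarrow> nat \<Rightarrow> 'a measure" where
  "observed_algebra d \<Omega> E n =
     sigma (space \<Omega>) (\<Union>i\<in>{1..n}. {E i -` B \<inter> space \<Omega> |B. B \<in> sets (vec_algebra d)})"

text \<open>Optimality within the class of all e-processes for the null hypothesis requires the null to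
  consist of \<^emph>\<open>all\<close> admissible distributions. On an abstract sample space this has to be demanded:
  if, say, \<open>\<Omega>\<close> is a single point at which every \<open>E n \<omega> 1\<close> equals 2, then the null is empty, every
  nonnegative adapted process is an e-process, and none is optimal.

  The sample space is called rich if every law \<open>\<nu>\<close> on \<open>{1} \<times> [0, \<infinity>)\<^sup>d\<close> is the law of \<open>E 1\<close> under
  some distribution \<open>P\<close>, and, given an alternative \<open>Q\<close>, \<open>P\<close> can be chosen so that it differs from
  \<open>Q\<close> only through the law of \<open>(E n)\<close>: for each \<open>n\<close>, \<open>(E 1, \<dots>, E n)\<close> is sufficient for
  \<open>{P, Q}\<close> on \<open>F n\<close>, i.e. the conditional probabilities of events in \<open>F n\<close> given
  \<open>(E 1, \<dots>, E n)\<close> have a version common to \<open>P\<close> and \<open>Q\<close>. The latter is void if \<open>F\<close> is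
  generated by \<open>(E n)\<close>; see the lemma below.\<close>

definition rich_sample_space ::
    "nat \<Rightarrow> 'a measure \<Rightarrow> (nat \<Rightarrow> 'a measure) \<Rightarrow> (nat \<Rightarrow> 'a \<Rightarrow> nat \<Rightarrow> real) \<Rightarrow> bool" where
  "rich_sample_space d \<Omega> F E \<longleftrightarrow>
     (\<forall>Q\<in>iid_distributions d \<Omega> F E. \<forall>\<nu>.
        prob_space \<nu> \<and> sets \<nu> = sets (vec_algebra d) \<and>
        (AE x in \<nu>. x 0 = 1 \<and> (\<forall>j\<le>d. 0 \<le> x j)) \<longrightarrow>
        (\<exists>P\<in>iid_distributions d \<Omega> F E. distr P (vec_algebra d) (E 1) = \<nu> \<and>
           (\<forall>n. \<forall>A\<in>sets (F n). \<exists>K\<in>borel_measurable (observed_algebra d \<Omega> E n). \<forall>D\<in>{P, Q}.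
              AE \<omega> in D. real_cond_exp D (observed_algebra d \<Omega> E n) (indicator A) \<omega> = K \<omega>)))"

lemma rich_sample_space_generated:
  assumes setting: "evalue_setting d \<Omega> F E"
    and generated: "\<And>n. sets (F n) = sets (observed_algebra d \<Omega> E n)"
    and realized: "\<And>\<nu>. \<lbrakk>prob_space \<nu>; sets \<nu> = sets (vec_algebra d);
        AE x in \<nu>. x 0 = 1 \<and> (\<forall>j\<le>d. 0 \<le> x j)\<rbrakk> \<Longrightarrow>
        \<exists>P\<in>iid_distributions d \<Omega> F E. distr P (vec_algebra d) (E 1) = \<nu>"
  shows "rich_sample_space d \<Omega> F E"
proof -
  have ind: "AE \<omega> in D. real_cond_exp D (observed_algebra d \<Omega> E n) (indicator A) \<omega> = indicator A \<omega>"
    and meas: "indicator A \<in> borel_measurable (observed_algebra d \<Omega> E n)"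
    if D: "D \<in> iid_distributions d \<Omega> F E" and A: "A \<in> sets (F n)" for D n and A :: "'a set"
  proof -
    let ?G = "observed_algebra d \<Omega> E n"
    interpret D: prob_space D using D by (simp add: iid_distributions_def)
    have sub: "subalgebra \<Omega> (F n)" using setting by (simp add: evalue_setting_def)
    have sp: "space ?G = space \<Omega>"
      unfolding observed_algebra_def by (rule space_measure_of) auto
    have setsD: "sets D = sets \<Omega>" using D by (simp add: iid_distributions_def)
    then have "subalgebra D ?G"
      using sub sp generated[of n] sets_eq_imp_space_eq[OF setsD] by (simp add: subalgebra_def)
    then interpret finite_measure_subalgebra D ?G by unfold_locales
    show m: "indicator A \<in> borel_measurable ?G"
      using A generated[of n] by (simp add: borel_measurable_indicator)
    have "A \<in> sets D" using A sub setsD by (auto simp: subalgebra_def)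
    then have "integrable D (indicator A :: 'a \<Rightarrow> real)"
      by (simp add: D.emeasure_finite less_top[symmetric])
    then show "AE \<omega> in D. real_cond_exp D ?G (indicator A) \<omega> = indicator A \<omega>"
      using m by (rule real_cond_exp_F_meas)
  qed
  show ?thesis
    unfolding rich_sample_space_def
  proof (intro ballI allI impI)
    fix Q \<nu>
    assume Q: "Q \<in> iid_distributions d \<Omega> F E"
      and "prob_space \<nu> \<and> sets \<nu> = sets (vec_algebra d) \<and> (AE x in \<nu>. x 0 = 1 \<and> (\<forall>j\<le>d. 0 \<le> x j))"
    then obtain P where "P \<in> iid_distributions d \<Omega> F E" "distr P (vec_algebra d) (E 1) = \<nu>"
      using realized by blast
    then show "\<exists>P\<in>iid_distributions d \<Omega> F E. distr P (vec_algebra d) (E 1) = \<nu> \<and>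
           (\<forall>n. \<forall>A\<in>sets (F n). \<exists>K\<in>borel_measurable (observed_algebra d \<Omega> E n). \<forall>D\<in>{P, Q}.
              AE \<omega> in D. real_cond_exp D (observed_algebra d \<Omega> E n) (indicator A) \<omega> = K \<omega>)"
      using ind meas Q by (intro bexI[of _ P]) blast+
  qed
qed


section \<open>The three processes\<close>

text \<open>The Dirichlet\<open>(\<alpha> 0, \<dots>, \<alpha> d)\<close> distribution: \<open>(l 1, \<dots>, l d)\<close> has the usual density with
  respect to \<open>d\<close>-dimensional Lebesgue measure, and \<open>l 0 = 1 - (l 1 + \<dots> + l d)\<close>.\<close>

definition complete_to_simplex :: "nat \<Rightarrow> (nat \<Rightarrow> real) \<Rightarrow> nat \<Rightarrow> real" where
  "complete_to_simplex d x = (\<lambda>j\<in>{..d}. if j = 0 then 1 - (\<Sum>i=1..d. x i) else x j)"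

definition dirichlet :: "nat \<Rightarrow> (nat \<Rightarrow> real) \<Rightarrow> (nat \<Rightarrow> real) measure" where
  "dirichlet d \<alpha> =
     distr
       (density (Pi\<^sub>M {1..d} (\<lambda>_. lborel))
          (\<lambda>x. if complete_to_simplex d x \<in> prob_simplex d
               then ennreal (Gamma (\<Sum>j\<le>d. \<alpha> j) / (\<Prod>j\<le>d. Gamma (\<alpha> j)) *
                      (\<Prod>j\<le>d. complete_to_simplex d x j powr (\<alpha> j - 1)))
               else 0))
       (vec_algebra d) (complete_to_simplex d)"

definition wealth :: "nat \<Rightarrow> (nat \<Rightarrow> 'a \<Rightarrow> nat \<Rightarrow> real) \<Rightarrow> (nat \<Rightarrow> real) \<Rightarrow> nat \<Rightarrow> 'a \<Rightarrow> real" where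
  "wealth d E l n \<omega> = (\<Prod>i=1..n. payoff d l (E i \<omega>))"

definition UP_portfolio :: "nat \<Rightarrow> (nat \<Rightarrow> 'a \<Rightarrow> nat \<Rightarrow> real) \<Rightarrow> nat \<Rightarrow> 'a \<Rightarrow> nat \<Rightarrow> real" where
  "UP_portfolio d E n \<omega> =
     (\<lambda>j\<in>{..d}. (\<integral>l. l j * wealth d E l (n - 1) \<omega> \<partial>dirichlet d (\<lambda>_. 1 / 2)) /
                 (\<integral>l. wealth d E l (n - 1) \<omega> \<partial>dirichlet d (\<lambda>_. 1 / 2)))"

definition W_UP :: "nat \<Rightarrow> (nat \<Rightarrow> 'a \<Rightarrow> nat \<Rightarrow> real) \<Rightarrow> nat \<Rightarrow> 'a \<Rightarrow> real" where
  "W_UP d E n \<omega> = (\<Prod>i=1..n. payoff d (UP_portfolio d E i \<omega>) (E i \<omega>))"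

definition W_CO96 :: "nat \<Rightarrow> (nat \<Rightarrow> 'a \<Rightarrow> nat \<Rightarrow> real) \<Rightarrow> nat \<Rightarrow> 'a \<Rightarrow> real" where
  "W_CO96 d E n \<omega> =
     exp (real_of_ereal (SUP l\<in>prob_simplex d. elog (wealth d E l n \<omega>))
          - real d * ln (real n + 1) / 2 - ln 2)"

definition log_wealth2 :: "(nat \<Rightarrow> 'a \<Rightarrow> nat \<Rightarrow> real) \<Rightarrow> real \<Rightarrow> nat \<Rightarrow> 'a \<Rightarrow> ereal" where
  "log_wealth2 E l n \<omega> = (\<Sum>i=1..n. elog ((1 - l) * E i \<omega> 0 + l * E i \<omega> 1))"

text \<open>The maximizer is unique unless \<open>E 1 \<omega> 1 = \<dots> = E n \<omega> 1 = 1\<close>. In that case any choice is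
  allowed, but it has to be made measurably, otherwise \<open>W_OJ23\<close> would not be adapted.\<close>

definition is_maximizer ::
    "'a measure \<Rightarrow> (nat \<Rightarrow> 'a measure) \<Rightarrow> (nat \<Rightarrow> 'a \<Rightarrow> nat \<Rightarrow> real) \<Rightarrow>
     (nat \<Rightarrow> 'a \<Rightarrow> real) \<Rightarrow> bool" where
  "is_maximizer \<Omega> F E lmax \<longleftrightarrow>
     (\<forall>n\<ge>1. lmax n \<in> borel_measurable (F n) \<and>
        (\<forall>\<omega>\<in>space \<Omega>. lmax n \<omega> \<in> {0..1} \<and>
           (\<forall>l\<in>{0..1}. log_wealth2 E l n \<omega> \<le> log_wealth2 E (lmax n \<omega>) n \<omega>)))"

text \<open>Both extended reals below are finite: \<open>log_wealth2\<close> at a maximizer is at least its value 0 at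
  \<open>l = 0\<close>, and not all of the expressions under the maximum vanish.\<close>

definition W_OJ23 ::
    "(nat \<Rightarrow> 'a \<Rightarrow> nat \<Rightarrow> real) \<Rightarrow> (nat \<Rightarrow> 'a \<Rightarrow> real) \<Rightarrow> nat \<Rightarrow> 'a \<Rightarrow> real" where
  "W_OJ23 E lmax n \<omega> =
     exp (real_of_ereal
       (log_wealth2 E (lmax n \<omega>) n \<omega>
        - Max ((\<lambda>j. elog (pi * lmax n \<omega> ^ j * (1 - lmax n \<omega>) ^ (n - j) * Gamma (real n + 1) /
                          (Gamma (real j + 1 / 2) * Gamma (real n - real j + 1 / 2)))) ` {0..n})))"

end

theory Submission
  imports Defs
begin

text \<open>Let \<open>V n\<close> be the wealth \<open>\<integral> wealth d E l n dF(l)\<close> of the Dirichlet mixture of all constantly rebalanced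
portfolios. Telescoping shows that the universal portfolio earns exactly \<open>V n\<close>, because
\<open>payoff (UP_portfolio n) (E n) = V n / V (n - 1)\<close>. Everything about the three processes follows from
this identity together with one comparison between a monomial and its Dirichlet moment.

\<^bold>\<open>Validity.\<close> The universal portfolio is predictable and lies in the simplex, and under the null every
component of \<open>E n\<close> has mean at most 1 and is independent of the past. Hence \<open>W_UP\<close> is a test
supermartingale. The other two processes are pointwise bounded by \<open>W_UP\<close>, which makes them e-processes.

\<^bold>\<open>Regret.\<close> Expanding the product of the payoffs, the wealth of a fixed portfolio is a combination,
with nonnegative coefficients, of monomials \<open>\<Prod>j. l j ^ c j\<close> with \<open>\<Sum>j. c j = n\<close>, and \<open>V n\<close> is the
same combination of their Dirichlet(1/2, ..., 1/2) moments. The moments are quotients of Gamma values,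
and each monomial is at most \<open>2 (n + 1)^(d/2)\<close> times its moment (\<open>monomial_le_moment\<close>): the Gibbs
inequality bounds the monomial by its value at the empirical frequencies, and a supermultiplicative
sequence shows that the worst count vector is concentrated on a single coordinate, where the ratio can be
computed. So the best wealth in hindsight is at most \<open>2 (n + 1)^(d/2) W_UP\<close>, which is
simultaneously the regret bound for \<open>W_UP\<close> and the domination of \<open>W_CO96\<close> by \<open>W_UP\<close>.
For \<open>d = 1\<close> the correction term of \<open>W_OJ23\<close> is the exact maximum, over the types \<open>j\<close>, of the ratio
between monomial and moment at the maximizing portfolio. The same termwise comparison therefore gives
\<open>W_OJ23 \<le> W_UP\<close>, and since the correction is at most \<open>2 (n + 1)^(1/2)\<close> the regret bound is inherited.

\<^bold>\<open>Optimality.\<close> Fix an alternative \<open>Q\<close> with law \<open>\<nu>\<close> of \<open>E 1\<close>. A log-optimal portfolio \<open>l\<close> for \<open>\<nu>\<close> is a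
numeraire: \<open>x j / payoff d l x\<close> has \<open>\<nu>\<close>-mean at most 1 for every \<open>j\<close> (\<open>numeraire_exists\<close>). Thus the
measure with \<open>\<nu>\<close>-density \<open>1 / payoff d l\<close>, with its missing mass placed on the vector
\<open>(1, 0, \<dots>, 0)\<close>, is an admissible law under the null. Richness of the sample space
provides a null distribution \<open>P\<close> with this law, and \<open>dQ \<le> wealth l n dP\<close> holds on the sigma-algebra
of the first \<open>n\<close> observations; the common conditional probabilities extend this to \<open>F n\<close>. Every e-process
\<open>W'\<close> then satisfies \<open>E_Q[W' n / wealth l n] \<le> E_P[W' n] \<le> 1\<close>. By the Markov inequality and the
Borel-Cantelli lemma, \<open>W' n\<close> is almost surely eventually below \<open>n\<^sup>2 wealth l n\<close>, hence below \<open>n\<^sup>2\<close> times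
the best wealth in hindsight. A process of sublinear regret stays within \<open>exp (o(n))\<close> of that wealth.\<close>

section \<open>Types, Gamma values and the worst count vector\<close>

text \<open>The right-hand side minus the left-hand side vanishes at 0 and has derivative \<open>t\<^sup>2 /
  ((1 + t) (2 + t)\<^sup>2)\<close>.\<close>

lemma ln_add_one_ge:
  fixes t :: real
  assumes "0 \<le> t"
  shows "2 * t / (2 + t) \<le> ln (1 + t)"
proof -
  have "(\<lambda>t. ln (1 + t) - 2 * t / (2 + t)) 0 \<le> (\<lambda>t. ln (1 + t) - 2 * t / (2 + t)) t"
  proof (rule DERIV_nonneg_imp_nondecreasing[OF assms])
    fix x :: real assume x: "0 \<le> x" "x \<le> t"
    have "((\<lambda>t. ln (1 + t) - 2 * t / (2 + t)) has_real_derivative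
        (1 / (1 + x) - 4 / (2 + x)^2)) (at x)"
      using x by (auto intro!: derivative_eq_intros simp: power2_eq_square)
    moreover have "1 / (1 + x) - 4 / (2 + x)^2 = x^2 / ((1 + x) * (2 + x)^2)"
      using x by (simp add: divide_simps) (simp add: power2_eq_square algebra_simps)
    moreover have "0 \<le> x^2 / ((1 + x) * (2 + x)^2)" using x by simp
    ultimately show "\<exists>y. ((\<lambda>t. ln (1 + t) - 2 * t / (2 + t)) has_real_derivative y) (at x) \<and> 0 \<le> y"
      by auto
  qed
  then show ?thesis by simp
qed

text \<open>Up to a factor that depends only on the total count and the dimension, the product of these
  weights over the coordinates is the ratio between the largest value of a monomial on the simplex
  and its Dirichlet moment. The convention \<open>0 ^ 0 = 1\<close> makes the weight of an absent
  coordinate 1.\<close>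

definition type_weight :: "nat \<Rightarrow> real" where
  "type_weight k = real k ^ k * Gamma (1 / 2) / Gamma (real k + 1 / 2)"

definition weight_growth :: "nat \<Rightarrow> real" where
  "weight_growth k = real (Suc k) ^ Suc k / (real k ^ k * (real k + 1 / 2))"

lemma type_weight_0 [simp]: "type_weight 0 = 1"
  by (simp add: type_weight_def Gamma_one_half_real)

lemma Gamma_add_one_pos: "0 < x \<Longrightarrow> Gamma (x + 1) = x * Gamma (x::real)"
  by (rule Gamma_plus1) (auto simp: nonpos_Ints_def)

lemma Gamma_half_pos: "0 < Gamma (real k + 1 / 2)"
  by (rule Gamma_real_pos) simp

lemma nat_power_self_pos: "0 < real k ^ k"
  by (cases k) auto

lemma type_weight_pos: "0 < type_weight k"
  using Gamma_half_pos[of k] Gamma_half_pos[of 0] nat_power_self_pos[of k]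
  by (simp add: type_weight_def)

lemma type_weight_Suc: "type_weight (Suc k) = weight_growth k * type_weight k"
proof -
  have "Gamma (real (Suc k) + 1 / 2) = (real k + 1 / 2) * Gamma (real k + 1 / 2)"
    using Gamma_add_one_pos[of "real k + 1 / 2"] by (simp add: add_ac)
  then show ?thesis
    using nat_power_self_pos[of k] by (simp add: type_weight_def weight_growth_def)
qed

lemma weight_growth_pos: "0 < weight_growth k"
  using nat_power_self_pos[of k] by (simp add: weight_growth_def)

text \<open>The logarithm of the growth factor extends to a smooth function of \<open>x > 0\<close> with
  derivative \<open>ln (1 + 1 / x) - 1 / (x + 1 / 2)\<close>, which is nonnegative. The value at 0
  has to be compared by hand, since that function is not smooth there.\<close>

lemma weight_growth_Suc_ge: "weight_growth k \<le> weight_growth (Suc k)"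
proof (cases k)
  case 0
  then show ?thesis by (simp add: weight_growth_def)
next
  case (Suc m)
  then have k: "1 \<le> k" by simp
  define H :: "real \<Rightarrow> real" where "H x = (x + 1) * ln (x + 1) - x * ln x - ln (x + 1 / 2)" for x
  have ln_growth: "ln (weight_growth j) = H (real j)" if "1 \<le> j" for j
  proof -
    have "ln (weight_growth j) =
        ln (real (Suc j) ^ Suc j) - (ln (real j ^ j) + ln (real j + 1 / 2))"
      unfolding weight_growth_def using that by (subst ln_div, simp, simp, subst ln_mult) simp_all
    then show ?thesis by (simp add: H_def ln_realpow add_ac del: power_Suc)
  qed
  have "H (real k) \<le> H (real (Suc k))"
  proof (rule DERIV_nonneg_imp_nondecreasing[where f = H])
    fix x :: real assume "real k \<le> x" "x \<le> real (Suc k)"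
    then have x: "0 < x" using k by simp
    have "(H has_real_derivative (ln (x + 1) - ln x - 1 / (x + 1 / 2))) (at x)"
      unfolding H_def using x by (auto intro!: derivative_eq_intros)
    moreover have "1 / (x + 1 / 2) \<le> ln (x + 1) - ln x"
    proof -
      have "1 / (x + 1 / 2) = 2 * (1 / x) / (2 + 1 / x)" using x by (simp add: field_simps)
      also have "\<dots> \<le> ln (1 + 1 / x)" using x by (intro ln_add_one_ge) simp
      also have "\<dots> = ln ((x + 1) / x)" using x by (simp add: add_divide_distrib)
      also have "\<dots> = ln (x + 1) - ln x" using x by (simp add: ln_div)
      finally show ?thesis .
    qed
    ultimately show "\<exists>y. (H has_real_derivative y) (at x) \<and> 0 \<le> y" by force
  qed simp
  then have "ln (weight_growth k) \<le> ln (weight_growth (Suc k))"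
    using k by (simp add: ln_growth del: of_nat_Suc)
  then show ?thesis using weight_growth_pos by simp
qed

text \<open>Increasing growth factors make the product of the factors \<open>a, \<dots>, a + b - 1\<close>
  at least the product of the factors \<open>0, \<dots>, b - 1\<close>.\<close>

lemma type_weight_supermultiplicative: "type_weight a * type_weight b \<le> type_weight (a + b)"
proof (induction b)
  case (Suc b)
  have "weight_growth b \<le> weight_growth (a + b)"
    by (rule lift_Suc_mono_le[of weight_growth]) (simp_all add: weight_growth_Suc_ge)
  then have "weight_growth b * (type_weight a * type_weight b) \<le> weight_growth (a + b) * type_weight (a + b)"
    using Suc weight_growth_pos[of b] type_weight_pos[of a] type_weight_pos[of b]
    by (intro mult_mono) (simp_all add: less_imp_le weight_growth_pos)
  then show ?case by (simp add: type_weight_Suc mult_ac)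
qed simp

text \<open>Merging all counts into one coordinate can only increase the weight: the worst type is a vertex.\<close>

lemma prod_type_weight_le:
  assumes "finite A"
  shows "(\<Prod>j\<in>A. type_weight (c j)) \<le> type_weight (\<Sum>j\<in>A. c j)"
  using assms
proof (induction A)
  case (insert x A)
  then have "type_weight (c x) * (\<Prod>j\<in>A. type_weight (c j)) \<le> type_weight (c x) * type_weight (\<Sum>j\<in>A. c j)"
    by (simp add: type_weight_pos)
  also have "\<dots> \<le> type_weight (c x + (\<Sum>j\<in>A. c j))" by (rule type_weight_supermultiplicative)
  finally show ?case using insert by simp
qed simp

text \<open>Gibbs inequality, from \<open>t \<le> exp (t - 1)\<close> at \<open>t = n l j / c j\<close>:
  multiplying over the coordinates with \<open>c j > 0\<close>, the exponents add up to \<open>n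
  \<Sum>l j - n \<le> 0\<close>. Both sides carry the factor \<open>n ^ n\<close> so that \<open>n
  = 0\<close> is no exception.\<close>

lemma prod_power_le_empirical:
  fixes l :: "'b \<Rightarrow> real" and c :: "'b \<Rightarrow> nat"
  assumes A: "finite A" and l0: "\<And>j. j \<in> A \<Longrightarrow> 0 \<le> l j" and l1: "(\<Sum>j\<in>A. l j) \<le> 1"
  shows "real (\<Sum>j\<in>A. c j) ^ (\<Sum>j\<in>A. c j) * (\<Prod>j\<in>A. l j ^ c j) \<le> (\<Prod>j\<in>A. real (c j) ^ c j)"
proof (cases "\<exists>j\<in>A. l j = 0 \<and> 0 < c j")
  case True
  then have "(\<Prod>j\<in>A. l j ^ c j) = 0" using A by auto
  then show ?thesis by (simp add: prod_nonneg)
next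
  case False
  define n where "n = (\<Sum>j\<in>A. c j)"
  define B where "B = {j \<in> A. 0 < c j}"
  have B: "finite B" "B \<subseteq> A" "\<And>j. j \<in> B \<Longrightarrow> 0 < c j"
    using A by (auto simp: B_def)
  have lB: "0 < l j" if "j \<in> B" for j
    using False l0[of j] that by (force simp: B_def)
  have nB: "n = (\<Sum>j\<in>B. c j)" unfolding n_def B_def by (rule sum.mono_neutral_right) (use A in auto)
  have "(\<Prod>j\<in>B. (real n * l j / real (c j)) ^ c j) \<le> (\<Prod>j\<in>B. exp (real n * l j - real (c j)))"
  proof (rule prod_mono, intro conjI)
    fix j assume j: "j \<in> B"
    then show "0 \<le> (real n * l j / real (c j)) ^ c j" using lB[OF j] by simp
    let ?t = "real n * l j / real (c j)"
    have "?t \<le> exp (?t - 1)" using exp_ge_add_one_self[of "?t - 1"] by simp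
    then have "?t ^ c j \<le> exp (?t - 1) ^ c j"
      using lB[OF j] by (intro power_mono) simp_all
    also have "\<dots> = exp (real n * l j - real (c j))"
      using B(3)[OF j] by (simp add: exp_of_nat_mult[symmetric] field_simps)
    finally show "?t ^ c j \<le> exp (real n * l j - real (c j))" .
  qed
  also have "\<dots> = exp (real n * (\<Sum>j\<in>B. l j) - real n)"
    using B(1) by (simp add: exp_sum[symmetric] sum_subtractf sum_distrib_left nB)
  also have "\<dots> \<le> 1"
  proof -
    have "(\<Sum>j\<in>B. l j) \<le> (\<Sum>j\<in>A. l j)" using l0 by (intro sum_mono2[OF A B(2)]) simp
    then have "(\<Sum>j\<in>B. l j) \<le> 1" using l1 by linarith
    then have "real n * (\<Sum>j\<in>B. l j) \<le> real n * 1" by (intro mult_left_mono) simp_all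
    then show ?thesis by simp
  qed
  finally have "(\<Prod>j\<in>B. (real n * l j / real (c j)) ^ c j) \<le> 1" .
  then have "(\<Prod>j\<in>B. (real n * l j) ^ c j) \<le> (\<Prod>j\<in>B. real (c j) ^ c j)"
    using prod_pos[of B "\<lambda>j. real (c j) ^ c j"] B(3)
    by (simp add: power_divide prod_dividef divide_le_eq)
  moreover have "(\<Prod>j\<in>B. (real n * l j) ^ c j) = real n ^ n * (\<Prod>j\<in>B. l j ^ c j)"
    by (simp add: power_mult_distrib prod.distrib power_sum[symmetric] nB[symmetric])
  moreover have "(\<Prod>j\<in>B. l j ^ c j) = (\<Prod>j\<in>A. l j ^ c j)"
    unfolding B_def by (rule prod.mono_neutral_left) (use A in auto)
  moreover have "(\<Prod>j\<in>B. real (c j) ^ c j) = (\<Prod>j\<in>A. real (c j) ^ c j)"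
    unfolding B_def by (rule prod.mono_neutral_left) (use A in auto)
  ultimately show ?thesis by (simp add: n_def)
qed

text \<open>The ratio between monomial and moment for the count vector \<open>(n, 0, \<dots>, 0)\<close> at
  the portfolio \<open>(1, 0, \<dots>, 0)\<close>.\<close>

definition vertex_ratio :: "nat \<Rightarrow> nat \<Rightarrow> real" where
  "vertex_ratio d n = Gamma (real n + real (Suc d) / 2) * Gamma (1 / 2) /
     (Gamma (real (Suc d) / 2) * Gamma (real n + 1 / 2))"

lemma vertex_ratio_pos: "0 < vertex_ratio d n"
  unfolding vertex_ratio_def by (intro divide_pos_pos mult_pos_pos Gamma_real_pos) (simp_all add: add_nonneg_pos)

lemma vertex_ratio_0: "vertex_ratio 0 n = 1"
proof -
  have "Gamma (1 / 2 :: real) \<noteq> 0" by (simp add: Gamma_one_half_real)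
  moreover have "Gamma (real n + 1 / 2) \<noteq> 0" using Gamma_half_pos[of n] by linarith
  ultimately show ?thesis by (simp add: vertex_ratio_def)
qed

lemma vertex_ratio_1_Suc:
  "vertex_ratio 1 (Suc n) = (real n + 1) / (real n + 1 / 2) * vertex_ratio 1 n"
proof -
  have g1: "Gamma (real (Suc n) + real (Suc 1) / 2) = (real n + 1) * Gamma (real n + real (Suc 1) / 2)"
    using Gamma_add_one_pos[of "real n + 1"] by (simp add: add_ac)
  have g2: "Gamma (real (Suc n) + 1 / 2) = (real n + 1 / 2) * Gamma (real n + 1 / 2)"
    using Gamma_add_one_pos[of "real n + 1 / 2"] by (simp add: add_ac)
  show ?thesis unfolding vertex_ratio_def g1 g2 by simp
qed

text \<open>The offset in \<open>4 n + 1\<close> is the one that lets the induction run: \<open>(n +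
  1)\<^sup>2 (n + c) \<le> (n + 1 / 2)\<^sup>2 (n + 1 + c)\<close> for all \<open>n\<close>
  requires \<open>c \<le> 1 / 4\<close>, and with \<open>c = 1 / 4\<close> the bound is an
  equality at \<open>n = 0\<close>.\<close>

lemma vertex_ratio_1_sq: "(vertex_ratio 1 n)\<^sup>2 \<le> 4 * real n + 1"
proof (induction n)
  case 0
  then show ?case by (simp add: vertex_ratio_def Gamma_one_half_real)
next
  case (Suc n)
  have "(vertex_ratio 1 (Suc n))\<^sup>2 = ((real n + 1) / (real n + 1 / 2))\<^sup>2 * (vertex_ratio 1 n)\<^sup>2"
    unfolding vertex_ratio_1_Suc by (simp add: power_mult_distrib power_divide)
  also have "\<dots> \<le> ((real n + 1) / (real n + 1 / 2))\<^sup>2 * (4 * real n + 1)"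
    by (intro mult_left_mono Suc) simp
  also have "\<dots> \<le> 4 * real (Suc n) + 1"
  proof -
    have "(real n + 1)\<^sup>2 * (4 * real n + 1) \<le> (4 * real (Suc n) + 1) * (real n + 1 / 2)\<^sup>2"
      by (simp add: power2_eq_square algebra_simps)
    then show ?thesis by (simp add: power_divide divide_le_eq)
  qed
  finally show ?case .
qed

text \<open>Raising \<open>d\<close> by 2 shifts the Gamma arguments by 1, so the recursion
  \<open>\<Gamma>(x + 1) = x \<Gamma>(x)\<close> applies. Bounds for \<open>d = 0\<close> and
  \<open>d = 1\<close> therefore suffice.\<close>

lemma vertex_ratio_Suc_Suc:
  "vertex_ratio (Suc (Suc d)) n = (1 + 2 * real n / real (Suc d)) * vertex_ratio d n"
proof -
  have g1: "Gamma (real n + real (Suc (Suc (Suc d))) / 2) =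
      (real n + real (Suc d) / 2) * Gamma (real n + real (Suc d) / 2)"
    using Gamma_add_one_pos[of "real n + real (Suc d) / 2"] by (simp add: add_divide_distrib add_ac)
  have g2: "Gamma (real (Suc (Suc (Suc d))) / 2) = (real (Suc d) / 2) * Gamma (real (Suc d) / 2)"
    using Gamma_add_one_pos[of "real (Suc d) / 2"] by (simp add: add_divide_distrib add_ac)
  have "Gamma (real (Suc d) / 2) > 0" by (rule Gamma_real_pos) simp
  then show ?thesis
    unfolding vertex_ratio_def g1 g2 using Gamma_half_pos[of n]
    by (simp add: divide_simps)
qed

definition regret_factor :: "nat \<Rightarrow> nat \<Rightarrow> real" where
  "regret_factor d n = 2 * (real n + 1) powr (real d / 2)"

lemma regret_factor_pos: "0 < regret_factor d n"
  by (simp add: regret_factor_def)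

lemma ln_regret_factor: "ln (regret_factor d n) = ln 2 + real d * ln (real n + 1) / 2"
  by (simp add: regret_factor_def ln_mult ln_powr)

lemma vertex_ratio_le: "vertex_ratio d n \<le> regret_factor d n"
proof (induction d rule: induct_nat_012)
  case 0
  then show ?case by (simp add: regret_factor_def vertex_ratio_0)
next
  case 1
  have "(vertex_ratio 1 n)\<^sup>2 \<le> (2 * sqrt (real n + 1))\<^sup>2"
    using vertex_ratio_1_sq[of n] by (simp add: power_mult_distrib)
  then have "vertex_ratio 1 n \<le> 2 * sqrt (real n + 1)"
    by (rule power2_le_imp_le) simp
  then show ?case using powr_half_sqrt[of "real n + 1"] by (simp add: regret_factor_def)
next
  case (ge2 d)
  have "vertex_ratio (Suc (Suc d)) n \<le> (real n + 1) * regret_factor d n"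
  proof (cases d)
    case 0
    then show ?thesis unfolding vertex_ratio_Suc_Suc 0 by (simp add: regret_factor_def vertex_ratio_0)
  next
    case (Suc m)
    have "real n * 2 \<le> real n * real (Suc d)"
      using Suc by (intro mult_left_mono) simp_all
    then have "1 + 2 * real n / real (Suc d) \<le> real n + 1"
      by (simp add: divide_le_eq mult_ac)
    then show ?thesis unfolding vertex_ratio_Suc_Suc
      by (rule mult_mono[OF _ ge2(1)]) (simp_all add: less_imp_le vertex_ratio_pos)
  qed
  also have "(real n + 1) * regret_factor d n = regret_factor (Suc (Suc d)) n"
  proof -
    have "real (Suc (Suc d)) / 2 = real d / 2 + 1" by simp
    then show ?thesis by (simp only: regret_factor_def powr_add) simp
  qed
  finally show ?case .
qed

section \<open>The Dirichlet integral\<close>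

text \<open>Multiplying by a factor that vanishes on the negative half-line builds the constraints of the
  simplex into the integrand. At 0 the value is 0 for every exponent because \<open>0 powr a =
  0\<close>; only null sets are affected.\<close>

definition half_line_power :: "real \<Rightarrow> real \<Rightarrow> real" where
  "half_line_power a t = (if 0 \<le> t then t powr (a - 1) else 0)"

lemma half_line_power_nonneg [simp]: "0 \<le> half_line_power a t"
  by (simp add: half_line_power_def)

lemma half_line_power_measurable [measurable]: "half_line_power a \<in> borel_measurable borel"
  unfolding half_line_power_def by measurable

lemma half_line_power_mult_power:
  "half_line_power a t * t ^ c = half_line_power (a + real c) t"
  by (cases "t = 0") (auto simp: half_line_power_def powr_add powr_diff powr_realpow)

text \<open>The substitution \<open>t = s u\<close> reduces this to the Beta integral over the unit
  interval.\<close>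

lemma nn_integral_Beta_convolution:
  assumes a: "0 < a" and b: "0 < b"
  shows "(\<integral>\<^sup>+t. ennreal (half_line_power a t * half_line_power b (s - t)) \<partial>lborel) =
    ennreal (half_line_power (a + b) s * (Gamma a * Gamma b / Gamma (a + b)))"
proof (cases "0 < s")
  case False
  have "half_line_power a t * half_line_power b (s - t) = 0" for t
    using False by (auto simp: half_line_power_def)
  moreover have "half_line_power (a + b) s = 0" using False by (auto simp: half_line_power_def)
  ultimately show ?thesis by (simp only: mult_zero_left ennreal_0 nn_integral_const)
next
  case True
  have unit: "(\<integral>\<^sup>+t. ennreal (half_line_power a t * half_line_power b (1 - t)) \<partial>lborel) = ennreal (Beta a b)"
  proof -
    have "(\<integral>\<^sup>+t. ennreal (half_line_power a t * half_line_power b (1 - t)) \<partial>lborel) =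
      (\<integral>\<^sup>+t. ennreal (if t \<in> {0..1} then t powr (a - 1) * (1 - t) powr (b - 1) else 0) \<partial>lborel)"
      by (intro nn_integral_cong) (auto simp: half_line_power_def)
    also have "\<dots> = ennreal (Beta a b)"
      using has_integral_Beta_real[OF a b]
      by (intro nn_integral_has_integral_lborel) (simp_all only: has_integral_restrict_UNIV, auto)
    finally show ?thesis .
  qed
  have "(\<integral>\<^sup>+t. ennreal (half_line_power a t * half_line_power b (s - t)) \<partial>lborel) =
      ennreal \<bar>s\<bar> * (\<integral>\<^sup>+t. ennreal (half_line_power a (0 + s * t) * half_line_power b (s - (0 + s * t))) \<partial>lborel)"
    using True by (intro nn_integral_real_affine) auto
  also have "(\<integral>\<^sup>+t. ennreal (half_line_power a (0 + s * t) * half_line_power b (s - (0 + s * t))) \<partial>lborel) =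
      (\<integral>\<^sup>+t. ennreal (s powr (a + b - 2)) * ennreal (half_line_power a t * half_line_power b (1 - t)) \<partial>lborel)"
  proof (intro nn_integral_cong)
    fix t
    have *: "s - s * t = s * (1 - t)" by (simp add: algebra_simps)
    have "half_line_power a (s * t) * half_line_power b (s * (1 - t)) =
        s powr (a + b - 2) * (half_line_power a t * half_line_power b (1 - t))"
    proof (cases "0 \<le> t \<and> t \<le> 1")
      case True
      have "s powr (a - 1) * s powr (b - 1) = s powr (a + b - 2)"
        by (simp add: powr_add[symmetric])
      then show ?thesis
        using True \<open>0 < s\<close> by (simp add: half_line_power_def powr_mult mult_ac)
    next
      case False
      then show ?thesis
        using \<open>0 < s\<close> by (auto simp: half_line_power_def zero_le_mult_iff)
    qed
    then show "ennreal (half_line_power a (0 + s * t) * half_line_power b (s - (0 + s * t))) =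
        ennreal (s powr (a + b - 2)) * ennreal (half_line_power a t * half_line_power b (1 - t))"
      by (simp add: * ennreal_mult)
  qed
  also have "\<dots> = ennreal (s powr (a + b - 2)) * ennreal (Beta a b)"
    by (subst nn_integral_cmult) (auto simp: unit)
  also have "ennreal \<bar>s\<bar> * \<dots> = ennreal (s * s powr (a + b - 2) * Beta a b)"
  proof -
    have "0 \<le> Beta a b"
      using Gamma_real_pos[OF a] Gamma_real_pos[OF b] Gamma_real_pos[of "a + b"] a b by (simp add: Beta_def)
    then show ?thesis using True by (simp add: ennreal_mult mult.assoc)
  qed
  also have "s * s powr (a + b - 2) = half_line_power (a + b) s"
    using True powr_add[of s 1 "a + b - 2"] by (simp add: half_line_power_def)
  finally show ?thesis by (simp add: Beta_def)
qed

text \<open>Integrating out one coordinate \<open>y\<close> leaves the same integral over the remaining ones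
  with \<open>s\<close> replaced by \<open>s - y\<close>. By induction this is a power of \<open>s
  - y\<close>, so the last integration is a Beta convolution. This is why the statement is for
  arbitrary \<open>s\<close> rather than for \<open>s = 1\<close>.\<close>

lemma nn_integral_Dirichlet:
  assumes I: "finite I" and \<alpha>: "\<And>i. i \<in> I \<Longrightarrow> 0 < \<alpha> i" and \<beta>: "0 < \<beta>"
  shows "(\<integral>\<^sup>+x. ennreal ((\<Prod>i\<in>I. half_line_power (\<alpha> i) (x i)) * half_line_power \<beta> (s - (\<Sum>i\<in>I. x i)))
        \<partial>Pi\<^sub>M I (\<lambda>_. lborel)) =
    ennreal (half_line_power ((\<Sum>i\<in>I. \<alpha> i) + \<beta>) s *
        ((\<Prod>i\<in>I. Gamma (\<alpha> i)) * Gamma \<beta> / Gamma ((\<Sum>i\<in>I. \<alpha> i) + \<beta>)))"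
  using I \<alpha>
proof (induction I arbitrary: s)
  case empty
  have "Gamma \<beta> \<noteq> 0" using Gamma_real_pos[OF \<beta>] by linarith
  then show ?case by (simp add: PiM_empty nn_integral_count_space_finite)
next
  case (insert i I)
  interpret product_sigma_finite "\<lambda>_. lborel :: real measure" by standard
  define A where "A = (\<Sum>i\<in>I. \<alpha> i) + \<beta>"
  define G where "G = (\<Prod>i\<in>I. Gamma (\<alpha> i)) * Gamma \<beta>"
  have A: "0 < A" unfolding A_def using insert.prems \<beta> by (simp add: add_nonneg_pos sum_nonneg less_imp_le)
  have \<alpha>i: "0 < \<alpha> i" using insert.prems by simp
  have G: "0 \<le> G / Gamma A" unfolding G_def
    using insert.prems \<beta> A by (simp add: prod_nonneg Gamma_real_pos less_imp_le)
  have "(\<integral>\<^sup>+x. ennreal ((\<Prod>j\<in>insert i I. half_line_power (\<alpha> j) (x j)) *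
          half_line_power \<beta> (s - (\<Sum>j\<in>insert i I. x j))) \<partial>Pi\<^sub>M (insert i I) (\<lambda>_. lborel)) =
      (\<integral>\<^sup>+y. (\<integral>\<^sup>+x. ennreal ((\<Prod>j\<in>insert i I. half_line_power (\<alpha> j) ((x(i := y)) j)) *
          half_line_power \<beta> (s - (\<Sum>j\<in>insert i I. (x(i := y)) j))) \<partial>Pi\<^sub>M I (\<lambda>_. lborel)) \<partial>lborel)"
    using insert.hyps by (intro product_nn_integral_insert_rev) auto
  also have "\<dots> = (\<integral>\<^sup>+y. (\<integral>\<^sup>+x. ennreal (half_line_power (\<alpha> i) y) *
      ennreal ((\<Prod>j\<in>I. half_line_power (\<alpha> j) (x j)) * half_line_power \<beta> ((s - y) - (\<Sum>j\<in>I. x j)))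
        \<partial>Pi\<^sub>M I (\<lambda>_. lborel)) \<partial>lborel)"
  proof (intro nn_integral_cong)
    fix x y
    have *: "(\<Prod>j\<in>I. half_line_power (\<alpha> j) ((x(i := y)) j)) = (\<Prod>j\<in>I. half_line_power (\<alpha> j) (x j))"
      "(\<Sum>j\<in>I. (x(i := y)) j) = (\<Sum>j\<in>I. x j)"
      using insert.hyps by (auto intro!: prod.cong sum.cong)
    have "(\<Prod>j\<in>insert i I. half_line_power (\<alpha> j) ((x(i := y)) j)) *
          half_line_power \<beta> (s - (\<Sum>j\<in>insert i I. (x(i := y)) j)) =
        half_line_power (\<alpha> i) y *
          ((\<Prod>j\<in>I. half_line_power (\<alpha> j) (x j)) * half_line_power \<beta> ((s - y) - (\<Sum>j\<in>I. x j)))"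
      unfolding prod.insert[OF insert.hyps] sum.insert[OF insert.hyps] * by (simp add: diff_diff_eq)
    then show "ennreal ((\<Prod>j\<in>insert i I. half_line_power (\<alpha> j) ((x(i := y)) j)) *
          half_line_power \<beta> (s - (\<Sum>j\<in>insert i I. (x(i := y)) j))) =
        ennreal (half_line_power (\<alpha> i) y) *
          ennreal ((\<Prod>j\<in>I. half_line_power (\<alpha> j) (x j)) * half_line_power \<beta> ((s - y) - (\<Sum>j\<in>I. x j)))"
      by (simp add: ennreal_mult prod_nonneg)
  qed
  also have "\<dots> = (\<integral>\<^sup>+y. ennreal (half_line_power (\<alpha> i) y) *
      ennreal (half_line_power A (s - y) * (G / Gamma A)) \<partial>lborel)"
    using insert.IH insert.prems insert.hyps
    by (intro nn_integral_cong, subst nn_integral_cmult) (auto simp: A_def G_def)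
  also have "\<dots> = (\<integral>\<^sup>+y. ennreal (G / Gamma A) *
      ennreal (half_line_power (\<alpha> i) y * half_line_power A (s - y)) \<partial>lborel)"
    using G by (intro nn_integral_cong) (simp add: ennreal_mult'[symmetric] ennreal_mult''[symmetric] mult_ac)
  also have "\<dots> = ennreal (G / Gamma A) *
      ennreal (half_line_power (\<alpha> i + A) s * (Gamma (\<alpha> i) * Gamma A / Gamma (\<alpha> i + A)))"
    by (subst nn_integral_cmult) (simp_all add: nn_integral_Beta_convolution[OF \<alpha>i A])
  also have "\<dots> = ennreal (half_line_power (\<alpha> i + A) s * (Gamma (\<alpha> i) * G / Gamma (\<alpha> i + A)))"
    using G Gamma_real_pos[OF A] by (simp add: ennreal_mult'[symmetric] ennreal_mult''[symmetric] mult_ac)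
  finally show ?case
    using insert.hyps by (simp add: A_def G_def add_ac mult_ac)
qed

lemma prob_simplex_iff:
  "l \<in> prob_simplex d \<longleftrightarrow> l \<in> extensional {..d} \<and> (\<forall>j\<le>d. 0 \<le> l j) \<and> (\<Sum>j\<le>d. l j) = 1"
proof -
  have "l j \<le> 1" if "\<forall>j\<le>d. 0 \<le> l j" "(\<Sum>j\<le>d. l j) = 1" "j \<le> d" for j
    using member_le_sum[of j "{..d}" l] that by simp
  then show ?thesis by (auto simp: prob_simplex_def PiE_def Pi_def)
qed

lemma space_vec_algebra: "space (vec_algebra d) = extensional {..d}"
  by (simp add: vec_algebra_def space_PiM PiE_def)

lemma vec_component_measurable [measurable]:
  "j \<le> d \<Longrightarrow> (\<lambda>x. x j) \<in> borel_measurable (vec_algebra d)"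
  unfolding vec_algebra_def by measurable

lemma vec_sum_measurable [measurable]:
  "(\<lambda>x. \<Sum>j\<le>d. x j) \<in> borel_measurable (vec_algebra d)"
  by (intro borel_measurable_sum vec_component_measurable) simp

lemma lborel_component_measurable [measurable]:
  "i \<in> I \<Longrightarrow> (\<lambda>x. x i) \<in> borel_measurable (Pi\<^sub>M I (\<lambda>_. lborel :: real measure))"
  using measurable_component_singleton[of i I "\<lambda>_. lborel :: real measure"] by simp

lemma lborel_component_sum_measurable [measurable]:
  "(\<lambda>x. \<Sum>i\<in>I. x i) \<in> borel_measurable (Pi\<^sub>M I (\<lambda>_. lborel :: real measure))"
  by (intro borel_measurable_sum vec_component_measurable) simp

lemma prob_simplex_sets [measurable]: "prob_simplex d \<in> sets (vec_algebra d)"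
proof -
  have "{l \<in> space (vec_algebra d). (\<forall>j\<in>{..d}. 0 \<le> l j) \<and> (\<Sum>j\<le>d. l j) = 1} \<in> sets (vec_algebra d)"
    by measurable
  also have "{l \<in> space (vec_algebra d). (\<forall>j\<in>{..d}. 0 \<le> l j) \<and> (\<Sum>j\<le>d. l j) = 1} = prob_simplex d"
    by (auto simp: prob_simplex_iff space_vec_algebra)
  finally show ?thesis .
qed

lemma atMost_eq_insert_0: "{..d} = insert 0 {1..d::nat}"
  by auto

lemma sum_atMost_split_0: "(\<Sum>j\<le>d. f j) = f 0 + (\<Sum>j=1..d. f j)" for f :: "nat \<Rightarrow> real"
  unfolding atMost_eq_insert_0 by (subst sum.insert) auto

lemma prod_atMost_split_0: "(\<Prod>j\<le>d. f j) = f 0 * (\<Prod>j=1..d. f j)" for f :: "nat \<Rightarrow> real"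
  unfolding atMost_eq_insert_0 by (subst prod.insert) auto

lemma complete_to_simplex_measurable:
  "complete_to_simplex d \<in> measurable (Pi\<^sub>M {1..d} (\<lambda>_. lborel)) (vec_algebra d)"
  unfolding vec_algebra_def complete_to_simplex_def
proof (intro measurable_restrict)
  fix j assume "j \<in> {..d}"
  then show "(\<lambda>x. if j = 0 then 1 - (\<Sum>i=1..d. x i) else x j) \<in> measurable (Pi\<^sub>M {1..d} (\<lambda>_. lborel)) borel"
    by (cases "j = 0") simp_all
qed

lemma complete_to_simplex_in_iff:
  "complete_to_simplex d x \<in> prob_simplex d \<longleftrightarrow> (\<forall>i\<in>{1..d}. 0 \<le> x i) \<and> 0 \<le> 1 - (\<Sum>i=1..d. x i)"
proof -
  have "(\<Sum>j\<le>d. complete_to_simplex d x j) = 1"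
    unfolding sum_atMost_split_0 by (simp add: complete_to_simplex_def)
  moreover have "complete_to_simplex d x \<in> extensional {..d}" by (simp add: complete_to_simplex_def)
  moreover have "(\<forall>j\<le>d. 0 \<le> complete_to_simplex d x j) \<longleftrightarrow>
      (\<forall>i\<in>{1..d}. 0 \<le> x i) \<and> 0 \<le> 1 - (\<Sum>i=1..d. x i)"
    unfolding complete_to_simplex_def by (auto simp: Suc_le_eq)
  ultimately show ?thesis unfolding prob_simplex_iff by simp
qed

text \<open>The density with the indicator of the simplex absorbed into the half-line powers, in the form to
  which the Dirichlet integral applies.\<close>

definition dirichlet_density :: "nat \<Rightarrow> (nat \<Rightarrow> real) \<Rightarrow> (nat \<Rightarrow> real) \<Rightarrow> real" where
  "dirichlet_density d \<alpha> x = Gamma (\<Sum>j\<le>d. \<alpha> j) / (\<Prod>j\<le>d. Gamma (\<alpha> j)) *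
     ((\<Prod>i=1..d. half_line_power (\<alpha> i) (x i)) * half_line_power (\<alpha> 0) (1 - (\<Sum>i=1..d. x i)))"

lemma dirichlet_altdef:
  "dirichlet d \<alpha> = distr (density (Pi\<^sub>M {1..d} (\<lambda>_. lborel)) (\<lambda>x. ennreal (dirichlet_density d \<alpha> x)))
     (vec_algebra d) (complete_to_simplex d)"
proof -
  have "(if complete_to_simplex d x \<in> prob_simplex d
        then ennreal (Gamma (\<Sum>j\<le>d. \<alpha> j) / (\<Prod>j\<le>d. Gamma (\<alpha> j)) *
                      (\<Prod>j\<le>d. complete_to_simplex d x j powr (\<alpha> j - 1)))
        else 0) = ennreal (dirichlet_density d \<alpha> x)" for x
  proof (cases "complete_to_simplex d x \<in> prob_simplex d")
    case True
    then show ?thesis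
      unfolding prod_atMost_split_0[of "\<lambda>j. complete_to_simplex d x j powr (\<alpha> j - 1)"] complete_to_simplex_in_iff
      by (simp add: dirichlet_density_def complete_to_simplex_def half_line_power_def mult_ac)
  next
    case False
    then have "dirichlet_density d \<alpha> x = 0"
      unfolding complete_to_simplex_in_iff
      by (force simp: dirichlet_density_def half_line_power_def)
    then show ?thesis using False by simp
  qed
  then show ?thesis unfolding dirichlet_def by simp
qed

lemma dirichlet_density_measurable [measurable]:
  "dirichlet_density d \<alpha> \<in> borel_measurable (Pi\<^sub>M {1..d} (\<lambda>_. lborel))"
  unfolding dirichlet_density_def
  by (intro borel_measurable_times borel_measurable_const borel_measurable_prod
      measurable_compose[OF _ half_line_power_measurable] borel_measurable_diff lborel_component_sum_measurable)
     simp_all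

lemma ennreal_dirichlet_density_measurable [measurable]:
  "(\<lambda>x. ennreal (dirichlet_density d \<alpha> x)) \<in> borel_measurable (Pi\<^sub>M {1..d} (\<lambda>_. lborel))"
  by (intro measurable_compose[OF dirichlet_density_measurable]) simp

lemma sets_dirichlet [simp, measurable_cong]: "sets (dirichlet d \<alpha>) = sets (vec_algebra d)"
  by (simp add: dirichlet_def)

lemma AE_dirichlet_simplex: "AE l in dirichlet d \<alpha>. l \<in> prob_simplex d"
proof -
  have "AE x in density (Pi\<^sub>M {1..d} (\<lambda>_. lborel)) (\<lambda>x. ennreal (dirichlet_density d \<alpha> x)).
      complete_to_simplex d x \<in> prob_simplex d"
    unfolding AE_density[OF ennreal_dirichlet_density_measurable] complete_to_simplex_in_iff
  proof (intro AE_I2 impI)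
    fix x :: "nat \<Rightarrow> real"
    assume "0 < ennreal (dirichlet_density d \<alpha> x)"
    then have "dirichlet_density d \<alpha> x \<noteq> 0" by auto
    then show "(\<forall>i\<in>{1..d}. 0 \<le> x i) \<and> 0 \<le> 1 - (\<Sum>i=1..d. x i)"
      by (force simp: dirichlet_density_def half_line_power_def split: if_splits)
  qed
  then show ?thesis
    unfolding dirichlet_altdef
    using prob_simplex_sets[of d] sets.Int_space_eq2[OF prob_simplex_sets[of d]]
    by (subst AE_distr_iff) (use complete_to_simplex_measurable in \<open>simp_all add: Int_def conj_commute\<close>)
qed

text \<open>Multiplying the density by a monomial only shifts the exponents, so the moment is the quotient
  of two Dirichlet integrals.\<close>

lemma nn_integral_dirichlet_monomial:
  assumes \<alpha>: "\<And>j. j \<le> d \<Longrightarrow> 0 < \<alpha> j"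
  shows "(\<integral>\<^sup>+l. ennreal (\<Prod>j\<le>d. l j ^ c j) \<partial>dirichlet d \<alpha>) =
    ennreal (Gamma (\<Sum>j\<le>d. \<alpha> j) / (\<Prod>j\<le>d. Gamma (\<alpha> j)) *
      ((\<Prod>j\<le>d. Gamma (\<alpha> j + real (c j))) / Gamma ((\<Sum>j\<le>d. \<alpha> j) + real (\<Sum>j\<le>d. c j))))"
proof -
  define C where "C = Gamma (\<Sum>j\<le>d. \<alpha> j) / (\<Prod>j\<le>d. Gamma (\<alpha> j))"
  have "0 < (\<Sum>j\<le>d. \<alpha> j)" using \<alpha> by (intro sum_pos) auto
  then have C: "0 \<le> C" unfolding C_def
    using \<alpha> by (intro divide_nonneg_nonneg prod_nonneg) (auto simp: less_imp_le Gamma_real_pos)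
  have "(\<integral>\<^sup>+l. ennreal (\<Prod>j\<le>d. l j ^ c j) \<partial>dirichlet d \<alpha>) =
      (\<integral>\<^sup>+x. ennreal (dirichlet_density d \<alpha> x) * ennreal (\<Prod>j\<le>d. complete_to_simplex d x j ^ c j)
        \<partial>Pi\<^sub>M {1..d} (\<lambda>_. lborel))"
  proof -
    have m: "(\<lambda>l. ennreal (\<Prod>j\<le>d. l j ^ c j)) \<in> borel_measurable (vec_algebra d)" by measurable
    show ?thesis
      unfolding dirichlet_altdef
      using complete_to_simplex_measurable[of d]
        measurable_compose[OF complete_to_simplex_measurable m]
        m
      by (subst nn_integral_distr, simp, simp)
         (subst nn_integral_density[OF ennreal_dirichlet_density_measurable], simp_all)
  qed
  also have "\<dots> = (\<integral>\<^sup>+x. ennreal C * ennreal ((\<Prod>i=1..d. half_line_power (\<alpha> i + real (c i)) (x i)) *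
        half_line_power (\<alpha> 0 + real (c 0)) (1 - (\<Sum>i=1..d. x i))) \<partial>Pi\<^sub>M {1..d} (\<lambda>_. lborel))"
  proof (intro nn_integral_cong)
    fix x :: "nat \<Rightarrow> real"
    have eq: "dirichlet_density d \<alpha> x * (\<Prod>j\<le>d. complete_to_simplex d x j ^ c j) =
      C * ((\<Prod>i=1..d. half_line_power (\<alpha> i + real (c i)) (x i)) *
        half_line_power (\<alpha> 0 + real (c 0)) (1 - (\<Sum>i=1..d. x i)))"
      unfolding prod_atMost_split_0[of "\<lambda>j. complete_to_simplex d x j ^ c j"] dirichlet_density_def
        half_line_power_mult_power[symmetric] prod.distrib C_def[symmetric]
      by (simp add: complete_to_simplex_def mult_ac)
    have "0 \<le> dirichlet_density d \<alpha> x" using C by (simp add: dirichlet_density_def prod_nonneg C_def[symmetric])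
    then show "ennreal (dirichlet_density d \<alpha> x) * ennreal (\<Prod>j\<le>d. complete_to_simplex d x j ^ c j) =
      ennreal C * ennreal ((\<Prod>i=1..d. half_line_power (\<alpha> i + real (c i)) (x i)) *
        half_line_power (\<alpha> 0 + real (c 0)) (1 - (\<Sum>i=1..d. x i)))"
      using C eq by (simp only: ennreal_mult'[symmetric])
  qed
  also have "\<dots> = ennreal C * ennreal (((\<Prod>i=1..d. Gamma (\<alpha> i + real (c i))) * Gamma (\<alpha> 0 + real (c 0))) /
        Gamma ((\<Sum>i=1..d. \<alpha> i + real (c i)) + (\<alpha> 0 + real (c 0))))"
  proof -
    have m: "(\<lambda>x. ennreal ((\<Prod>i=1..d. half_line_power (a i) (x i)) *
        half_line_power b (1 - (\<Sum>i=1..d. x i)))) \<in> borel_measurable (Pi\<^sub>M {1..d} (\<lambda>_. lborel))" for a b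
      by (intro measurable_compose[OF _ measurable_ennreal] borel_measurable_times borel_measurable_prod
        measurable_compose[OF _ half_line_power_measurable] borel_measurable_diff
        lborel_component_sum_measurable) simp_all
    have one: "half_line_power a 1 = 1" for a by (simp add: half_line_power_def)
    show ?thesis
      unfolding nn_integral_cmult[OF m]
      by (subst nn_integral_Dirichlet) (use \<alpha> in \<open>simp_all add: add_pos_nonneg one\<close>)
  qed
  also have "\<dots> = ennreal (C * ((\<Prod>j\<le>d. Gamma (\<alpha> j + real (c j))) /
      Gamma ((\<Sum>j\<le>d. \<alpha> j) + real (\<Sum>j\<le>d. c j))))"
    using C unfolding sum_atMost_split_0 of_nat_sum prod_atMost_split_0
    by (simp add: ennreal_mult'[symmetric] sum.distrib add_ac mult_ac)
  finally show ?thesis unfolding C_def .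
qed

lemma prob_space_dirichlet:
  assumes \<alpha>: "\<And>j. j \<le> d \<Longrightarrow> 0 < \<alpha> j"
  shows "prob_space (dirichlet d \<alpha>)"
proof
  have "0 < (\<Sum>j\<le>d. \<alpha> j)" using \<alpha> by (intro sum_pos) auto
  then have "Gamma (\<Sum>j\<le>d. \<alpha> j) \<noteq> 0" using Gamma_real_pos by (metis less_irrefl)
  moreover have "(\<Prod>j\<le>d. Gamma (\<alpha> j)) \<noteq> 0" using \<alpha> Gamma_real_pos by (metis atMost_iff finite_atMost less_irrefl prod_zero_iff)
  ultimately show "emeasure (dirichlet d \<alpha>) (space (dirichlet d \<alpha>)) = 1"
    using nn_integral_dirichlet_monomial[OF \<alpha>, where c = "\<lambda>_. 0"] by simp
qed

section \<open>The universal portfolio as a mixture\<close>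

abbreviation jeffreys :: "nat \<Rightarrow> (nat \<Rightarrow> real) measure" where
  "jeffreys d \<equiv> dirichlet d (\<lambda>_. 1 / 2)"

text \<open>The moment of a monomial under Dirichlet(1/2, ..., 1/2).\<close>

definition moment :: "nat \<Rightarrow> (nat \<Rightarrow> nat) \<Rightarrow> real" where
  "moment d c = Gamma (real (Suc d) / 2) / Gamma (1 / 2) ^ Suc d *
     ((\<Prod>j\<le>d. Gamma (real (c j) + 1 / 2)) / Gamma (real (\<Sum>j\<le>d. c j) + real (Suc d) / 2))"

lemma prob_space_jeffreys: "prob_space (jeffreys d)"
  by (rule prob_space_dirichlet) simp

lemma moment_nonneg: "0 \<le> moment d c"
  unfolding moment_def
  by (intro mult_nonneg_nonneg divide_nonneg_nonneg prod_nonneg)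
     (auto intro!: less_imp_le[OF Gamma_real_pos] simp: add_nonneg_pos simp del: of_nat_sum)

lemma monomial_measurable [measurable]:
  "(\<lambda>l. \<Prod>j\<le>d. l j ^ c j :: real) \<in> borel_measurable (vec_algebra d)"
  by measurable

lemma AE_jeffreys_nonneg: "AE l in jeffreys d. \<forall>j\<le>d. 0 \<le> l j"
  using AE_dirichlet_simplex by eventually_elim (simp add: prob_simplex_iff)

lemma has_bochner_integral_monomial:
  "has_bochner_integral (jeffreys d) (\<lambda>l. \<Prod>j\<le>d. l j ^ c j) (moment d c)"
proof (rule has_bochner_integral_nn_integral)
  show "(\<lambda>l. \<Prod>j\<le>d. l j ^ c j) \<in> borel_measurable (jeffreys d)" by measurable
  show "AE l in jeffreys d. 0 \<le> (\<Prod>j\<le>d. l j ^ c j)"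
    using AE_jeffreys_nonneg by eventually_elim (auto intro!: prod_nonneg)
  show "0 \<le> moment d c" by (rule moment_nonneg)
  show "(\<integral>\<^sup>+l. ennreal (\<Prod>j\<le>d. l j ^ c j) \<partial>jeffreys d) = ennreal (moment d c)"
    by (subst nn_integral_dirichlet_monomial) (simp_all add: moment_def add_ac)
qed

text \<open>The Gibbs inequality bounds the monomial by \<open>\<Prod>j. c j ^ c j / n ^ n\<close>.
  Comparing the product of the weights with the weight of \<open>n\<close> bounds this by the
  moment times the ratio at a vertex.\<close>

lemma monomial_le_moment:
  assumes l: "l \<in> prob_simplex d"
  shows "(\<Prod>j\<le>d. l j ^ c j) \<le> regret_factor d (\<Sum>j\<le>d. c j) * moment d c"
proof -
  define n where "n = (\<Sum>j\<le>d. c j)"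
  define g where "g = Gamma (1 / 2 :: real)"
  define p where "p = (\<Prod>j\<le>d. Gamma (real (c j) + 1 / 2))"
  have g: "0 < g" unfolding g_def by (rule Gamma_real_pos) simp
  have p: "0 < p" unfolding p_def by (intro prod_pos) (simp add: Gamma_half_pos)
  have G: "0 < Gamma (real n + 1 / 2)" by (rule Gamma_half_pos)
  have nn: "0 < real n ^ n" by (rule nat_power_self_pos)
  have "(\<Prod>j\<le>d. type_weight (c j)) = (\<Prod>j\<le>d. real (c j) ^ c j) * g ^ Suc d / p"
    by (simp add: type_weight_def p_def g_def prod_dividef prod.distrib)
  then have "(\<Prod>j\<le>d. real (c j) ^ c j) * g ^ Suc d / p \<le> real n ^ n * g / Gamma (real n + 1 / 2)"
    using prod_type_weight_le[of "{..d}" c] by (simp add: type_weight_def g_def n_def)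
  then have "(\<Prod>j\<le>d. real (c j) ^ c j) \<le> real n ^ n * (g / Gamma (real n + 1 / 2) * (p / g ^ Suc d))"
    using g p by (simp add: field_simps)
  moreover have "real n ^ n * (\<Prod>j\<le>d. l j ^ c j) \<le> (\<Prod>j\<le>d. real (c j) ^ c j)"
    unfolding n_def using l by (intro prod_power_le_empirical) (auto simp: prob_simplex_iff)
  ultimately have "real n ^ n * (\<Prod>j\<le>d. l j ^ c j) \<le> real n ^ n * (g / Gamma (real n + 1 / 2) * (p / g ^ Suc d))"
    by linarith
  then have "(\<Prod>j\<le>d. l j ^ c j) \<le> g / Gamma (real n + 1 / 2) * (p / g ^ Suc d)"
    using nn by (simp only: mult_le_cancel_left_pos)
  also have "\<dots> = vertex_ratio d n * moment d c"
  proof -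
    have "Gamma (real n + real (Suc d) / 2) > 0" by (rule Gamma_real_pos) (simp add: add_nonneg_pos)
    moreover have "Gamma (real (Suc d) / 2) > 0" by (rule Gamma_real_pos) simp
    then have "Gamma (real (Suc d) / 2) \<noteq> 0" by (rule less_imp_neq[symmetric])
    ultimately show ?thesis
      unfolding vertex_ratio_def moment_def n_def[symmetric] p_def[symmetric] g_def[symmetric]
      by (simp del: of_nat_Suc)
  qed
  also have "\<dots> \<le> regret_factor d n * moment d c"
    by (intro mult_right_mono vertex_ratio_le moment_nonneg)
  finally show ?thesis unfolding n_def .
qed

definition counts :: "nat \<Rightarrow> (nat \<Rightarrow> nat) \<Rightarrow> nat \<Rightarrow> nat" where
  "counts n \<phi> j = card {i \<in> {1..n}. \<phi> i = j}"

lemma sum_counts: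
  assumes "\<phi> \<in> {1..n} \<rightarrow>\<^sub>E {..d}"
  shows "(\<Sum>j\<le>d. counts n \<phi> j) = n"
proof -
  have "(\<Sum>j\<le>d. \<Sum>i\<in>{i \<in> {1..n}. \<phi> i = j}. 1) = (\<Sum>i\<in>{1..n}. 1::nat)"
    using assms by (intro sum.group) auto
  then show ?thesis by (simp add: counts_def)
qed

text \<open>Each \<open>\<phi>\<close> chooses one asset per round. Collecting equal assets turns the
  product of the chosen portfolio weights into a monomial whose exponents count the choices.\<close>

lemma wealth_expand:
  "wealth d E l n \<omega> = (\<Sum>\<phi>\<in>{1..n} \<rightarrow>\<^sub>E {..d}. (\<Prod>i=1..n. E i \<omega> (\<phi> i)) * (\<Prod>j\<le>d. l j ^ counts n \<phi> j))"
proof -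
  have "wealth d E l n \<omega> = (\<Sum>\<phi>\<in>{1..n} \<rightarrow>\<^sub>E {..d}. \<Prod>i=1..n. l (\<phi> i) * E i \<omega> (\<phi> i))"
    unfolding wealth_def payoff_def by (intro prod_sum_PiE) auto
  also have "\<dots> = (\<Sum>\<phi>\<in>{1..n} \<rightarrow>\<^sub>E {..d}. (\<Prod>i=1..n. E i \<omega> (\<phi> i)) * (\<Prod>j\<le>d. l j ^ counts n \<phi> j))"
  proof (intro sum.cong refl)
    fix \<phi> :: "nat \<Rightarrow> nat" assume \<phi>: "\<phi> \<in> {1..n} \<rightarrow>\<^sub>E {..d}"
    have "(\<Prod>i=1..n. l (\<phi> i)) = (\<Prod>j\<le>d. \<Prod>i\<in>{i \<in> {1..n}. \<phi> i = j}. l (\<phi> i))"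
      using \<phi> by (intro prod.group[symmetric]) auto
    also have "\<dots> = (\<Prod>j\<le>d. l j ^ counts n \<phi> j)"
      by (intro prod.cong refl) (simp add: counts_def)
    finally show "(\<Prod>i=1..n. l (\<phi> i) * E i \<omega> (\<phi> i)) =
        (\<Prod>i=1..n. E i \<omega> (\<phi> i)) * (\<Prod>j\<le>d. l j ^ counts n \<phi> j)"
      by (simp add: prod.distrib)
  qed
  finally show ?thesis .
qed

definition mixture_wealth :: "nat \<Rightarrow> (nat \<Rightarrow> 'a \<Rightarrow> nat \<Rightarrow> real) \<Rightarrow> nat \<Rightarrow> 'a \<Rightarrow> real" where
  "mixture_wealth d E n \<omega> = (\<integral>l. wealth d E l n \<omega> \<partial>jeffreys d)"

lemma integrable_wealth: "integrable (jeffreys d) (\<lambda>l. wealth d E l n \<omega>)"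
  unfolding wealth_expand
  by (intro Bochner_Integration.integrable_sum integrable_mult_right
      has_bochner_integral_monomial[THEN has_bochner_integral_iff[THEN iffD1], THEN conjunct1])

lemma integrable_component_wealth:
  assumes j: "j \<le> d"
  shows "integrable (jeffreys d) (\<lambda>l. l j * wealth d E l n \<omega>)"
proof (rule Bochner_Integration.integrable_bound[OF integrable_wealth])
  show "(\<lambda>l. l j * wealth d E l n \<omega>) \<in> borel_measurable (jeffreys d)"
    using borel_measurable_integrable[OF integrable_wealth] j by measurable
  show "AE l in jeffreys d. norm (l j * wealth d E l n \<omega>) \<le> norm (wealth d E l n \<omega>)"
    using AE_dirichlet_simplex
  proof eventually_elim
    case (elim l)
    then have "l j \<in> {0..1}" using j by (auto simp: prob_simplex_def)
    then show ?case by (simp add: abs_mult mult_left_le_one_le)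
  qed
qed

lemma mixture_wealth_expand:
  "mixture_wealth d E n \<omega> = (\<Sum>\<phi>\<in>{1..n} \<rightarrow>\<^sub>E {..d}. (\<Prod>i=1..n. E i \<omega> (\<phi> i)) * moment d (counts n \<phi>))"
proof -
  note b = has_bochner_integral_monomial[THEN has_bochner_integral_iff[THEN iffD1]]
  show ?thesis unfolding mixture_wealth_def wealth_expand
    using b by (subst Bochner_Integration.integral_sum) simp_all
qed

text \<open>Wealth and mixture wealth have the same nonnegative coefficients, so any bound of monomials by
  moments carries over. The bound \<open>K\<close> may depend on \<open>l\<close>; this is used
  both with the uniform factor and with the sharper one for two assets.\<close>

lemma wealth_le_mixture:
  assumes E: "\<And>i j. 1 \<le> i \<Longrightarrow> i \<le> n \<Longrightarrow> j \<le> d \<Longrightarrow> 0 \<le> E i \<omega> j"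
    and K: "\<And>c. (\<Sum>j\<le>d. c j) = n \<Longrightarrow> (\<Prod>j\<le>d. l j ^ c j) \<le> K * moment d c"
  shows "wealth d E l n \<omega> \<le> K * mixture_wealth d E n \<omega>"
  unfolding wealth_expand mixture_wealth_expand sum_distrib_left
proof (rule sum_mono)
  fix \<phi> :: "nat \<Rightarrow> nat" assume \<phi>: "\<phi> \<in> {1..n} \<rightarrow>\<^sub>E {..d}"
  have "(\<Prod>j\<le>d. l j ^ counts n \<phi> j) \<le> K * moment d (counts n \<phi>)"
    by (rule K) (rule sum_counts[OF \<phi>])
  moreover have "0 \<le> (\<Prod>i=1..n. E i \<omega> (\<phi> i))" using \<phi> E by (intro prod_nonneg) (auto simp: PiE_iff)
  ultimately show "(\<Prod>i=1..n. E i \<omega> (\<phi> i)) * (\<Prod>j\<le>d. l j ^ counts n \<phi> j) \<le>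
      K * ((\<Prod>i=1..n. E i \<omega> (\<phi> i)) * moment d (counts n \<phi>))"
    by (subst mult.left_commute) (rule mult_left_mono)
qed

lemma wealth_le_regret_factor_mixture:
  assumes E: "\<And>i j. 1 \<le> i \<Longrightarrow> i \<le> n \<Longrightarrow> j \<le> d \<Longrightarrow> 0 \<le> E i \<omega> j" and l: "l \<in> prob_simplex d"
  shows "wealth d E l n \<omega> \<le> regret_factor d n * mixture_wealth d E n \<omega>"
  using E monomial_le_moment[OF l] by (intro wealth_le_mixture) auto

definition vertex :: "nat \<Rightarrow> nat \<Rightarrow> nat \<Rightarrow> real" where
  "vertex d k = (\<lambda>j\<in>{..d}. if j = k then 1 else 0)"

lemma vertex_in_simplex: "k \<le> d \<Longrightarrow> vertex d k \<in> prob_simplex d"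
  by (simp add: prob_simplex_iff vertex_def)

lemma payoff_vertex: "k \<le> d \<Longrightarrow> payoff d (vertex d k) x = x k"
  by (simp add: payoff_def vertex_def if_distrib[where f = "\<lambda>a. a * _"] cong: if_cong)

text \<open>What the setting guarantees about a single outcome.\<close>

definition valid_outcome :: "nat \<Rightarrow> (nat \<Rightarrow> 'a \<Rightarrow> nat \<Rightarrow> real) \<Rightarrow> 'a \<Rightarrow> bool" where
  "valid_outcome d E \<omega> \<longleftrightarrow> (\<forall>i\<ge>1. E i \<omega> 0 = 1 \<and> (\<forall>j\<le>d. 0 \<le> E i \<omega> j))"

lemma wealth_vertex_0: "valid_outcome d E \<omega> \<Longrightarrow> wealth d E (vertex d 0) n \<omega> = 1"
  by (simp add: wealth_def payoff_vertex valid_outcome_def)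

lemma wealth_nonneg:
  assumes "valid_outcome d E \<omega>" "l \<in> prob_simplex d"
  shows "0 \<le> wealth d E l n \<omega>"
  using assms unfolding wealth_def payoff_def
  by (intro prod_nonneg ballI sum_nonneg mult_nonneg_nonneg) (auto simp: prob_simplex_iff valid_outcome_def)

text \<open>The mixture is comparable with the portfolio that holds only asset 0, whose wealth is constantly
  1.\<close>

lemma mixture_wealth_pos:
  assumes "valid_outcome d E \<omega>"
  shows "0 < mixture_wealth d E n \<omega>"
proof -
  have "1 \<le> regret_factor d n * mixture_wealth d E n \<omega>"
    using wealth_le_regret_factor_mixture[of n d E \<omega> "vertex d 0"] wealth_vertex_0[OF assms]
      assms vertex_in_simplex by (auto simp: valid_outcome_def)
  then show ?thesis using regret_factor_pos[of d n] by (smt (verit) zero_less_mult_pos)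
qed

lemma mixture_wealth_0 [simp]: "mixture_wealth d E 0 \<omega> = 1"
  using prob_space.prob_space[OF prob_space_jeffreys] by (simp add: mixture_wealth_def wealth_def)

text \<open>The integral of \<open>l j W(l)\<close> against the payoffs of round \<open>n + 1\<close> is the
  integral of \<open>W(l)\<close> times the payoff of \<open>l\<close>, so the weights of the
  universal portfolio turn the payoff into a quotient of consecutive mixture wealths.\<close>

lemma payoff_UP_portfolio:
  "payoff d (UP_portfolio d E (Suc n) \<omega>) (E (Suc n) \<omega>) =
     mixture_wealth d E (Suc n) \<omega> / mixture_wealth d E n \<omega>"
proof -
  have "payoff d (UP_portfolio d E (Suc n) \<omega>) (E (Suc n) \<omega>) =
      (\<Sum>j\<le>d. \<integral>l. l j * wealth d E l n \<omega> * E (Suc n) \<omega> j \<partial>jeffreys d) / mixture_wealth d E n \<omega>"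
    by (simp add: payoff_def UP_portfolio_def mixture_wealth_def sum_divide_distrib)
  also have "(\<Sum>j\<le>d. \<integral>l. l j * wealth d E l n \<omega> * E (Suc n) \<omega> j \<partial>jeffreys d) =
      (\<integral>l. (\<Sum>j\<le>d. l j * wealth d E l n \<omega> * E (Suc n) \<omega> j) \<partial>jeffreys d)"
    by (intro Bochner_Integration.integral_sum[symmetric] integrable_mult_left integrable_component_wealth) simp
  also have "\<dots> = mixture_wealth d E (Suc n) \<omega>"
    unfolding mixture_wealth_def
  proof (intro Bochner_Integration.integral_cong refl)
    show "(\<Sum>j\<le>d. l j * wealth d E l n \<omega> * E (Suc n) \<omega> j) = wealth d E l (Suc n) \<omega>" for l
      by (simp add: wealth_def payoff_def sum_distrib_left sum_distrib_right mult_ac)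
  qed
  finally show ?thesis .
qed

text \<open>The quotients of consecutive mixture wealths telescope.\<close>

lemma W_UP_eq_mixture:
  assumes "valid_outcome d E \<omega>"
  shows "W_UP d E n \<omega> = mixture_wealth d E n \<omega>"
proof (induction n)
  case (Suc n)
  have "W_UP d E (Suc n) \<omega> = W_UP d E n \<omega> * payoff d (UP_portfolio d E (Suc n) \<omega>) (E (Suc n) \<omega>)"
    by (simp add: W_UP_def)
  then show ?case using Suc mixture_wealth_pos[OF assms, of n] by (simp add: payoff_UP_portfolio)
qed (simp add: W_UP_def)

lemma W_UP_pos: "valid_outcome d E \<omega> \<Longrightarrow> 0 < W_UP d E n \<omega>"
  by (simp add: W_UP_eq_mixture mixture_wealth_pos)

lemma wealth_le_W_UP:
  assumes "valid_outcome d E \<omega>" "l \<in> prob_simplex d"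
  shows "wealth d E l n \<omega> \<le> regret_factor d n * W_UP d E n \<omega>"
  using assms by (subst W_UP_eq_mixture) (auto intro!: wealth_le_regret_factor_mixture simp: valid_outcome_def)

lemma UP_portfolio_in_simplex:
  assumes "valid_outcome d E \<omega>"
  shows "UP_portfolio d E n \<omega> \<in> prob_simplex d"
proof -
  have pos: "0 < mixture_wealth d E (n - 1) \<omega>" by (rule mixture_wealth_pos[OF assms])
  have "(\<Sum>j\<le>d. \<integral>l. l j * wealth d E l (n - 1) \<omega> \<partial>jeffreys d) =
      (\<integral>l. (\<Sum>j\<le>d. l j * wealth d E l (n - 1) \<omega>) \<partial>jeffreys d)"
    by (intro Bochner_Integration.integral_sum[symmetric] integrable_component_wealth) simp
  also have "\<dots> = mixture_wealth d E (n - 1) \<omega>"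
    unfolding mixture_wealth_def
  proof (rule integral_cong_AE)
    show "AE l in jeffreys d. (\<Sum>j\<le>d. l j * wealth d E l (n - 1) \<omega>) = wealth d E l (n - 1) \<omega>"
      using AE_dirichlet_simplex
      by eventually_elim (simp add: sum_distrib_right[symmetric] prob_simplex_iff)
  next
    show "(\<lambda>l. \<Sum>j\<le>d. l j * wealth d E l (n - 1) \<omega>) \<in> borel_measurable (jeffreys d)"
      by (intro borel_measurable_integrable Bochner_Integration.integrable_sum integrable_component_wealth) simp
    show "(\<lambda>l. wealth d E l (n - 1) \<omega>) \<in> borel_measurable (jeffreys d)"
      by (rule borel_measurable_integrable[OF integrable_wealth])
  qed
  finally have "(\<Sum>j\<le>d. UP_portfolio d E n \<omega> j) = 1"
    using pos by (simp add: UP_portfolio_def sum_divide_distrib[symmetric] mixture_wealth_def)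
  moreover have "0 \<le> UP_portfolio d E n \<omega> j" if j: "j \<le> d" for j
  proof -
    have "0 \<le> (\<integral>l. l j * wealth d E l (n - 1) \<omega> \<partial>jeffreys d)"
    proof (rule integral_nonneg_AE)
      show "AE l in jeffreys d. 0 \<le> l j * wealth d E l (n - 1) \<omega>"
        using AE_dirichlet_simplex
        by eventually_elim (use j wealth_nonneg[OF assms] in \<open>auto simp: prob_simplex_iff\<close>)
    qed
    then show ?thesis
      using pos j by (simp add: UP_portfolio_def mixture_wealth_def)
  qed
  moreover have "UP_portfolio d E n \<omega> \<in> extensional {..d}" by (simp add: UP_portfolio_def)
  ultimately show ?thesis by (simp add: prob_simplex_iff)
qed

section \<open>The supermartingale property\<close>

lemma evalue_setting_valid: "evalue_setting d \<Omega> F E \<Longrightarrow> \<omega> \<in> space \<Omega> \<Longrightarrow> valid_outcome d E \<omega>"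
  by (simp add: evalue_setting_def valid_outcome_def)

lemma filtration_measurable_mono:
  assumes S: "evalue_setting d \<Omega> F E" and mn: "m \<le> n" and f: "f \<in> measurable (F m) N"
  shows "f \<in> measurable (F n) N"
proof -
  have "space (F m) = space (F n)" using S by (simp add: evalue_setting_def subalgebra_def)
  moreover have "sets (F m) \<subseteq> sets (F n)"
    using S mn by (simp add: evalue_setting_def filtration_def)
  ultimately show ?thesis using f by (auto simp: measurable_def)
qed

lemma E_measurable:
  assumes S: "evalue_setting d \<Omega> F E" and i: "1 \<le> i" "i \<le> n"
  shows "E i \<in> measurable (F n) (vec_algebra d)"
proof (rule filtration_measurable_mono[OF S i(2)])
  show "E i \<in> measurable (F i) (vec_algebra d)" using S i by (simp add: evalue_setting_def)
qed

lemma E_component_measurable: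
  assumes S: "evalue_setting d \<Omega> F E" and i: "1 \<le> i" "i \<le> n" and j: "j \<le> d"
  shows "(\<lambda>\<omega>. E i \<omega> j) \<in> borel_measurable (F n)"
  using measurable_compose[OF E_measurable[OF S i] vec_component_measurable[OF j]] .

lemma wealth_measurable:
  assumes S: "evalue_setting d \<Omega> F E" and n: "m \<le> n"
  shows "(\<lambda>\<omega>. wealth d E l m \<omega>) \<in> borel_measurable (F n)"
  unfolding wealth_def payoff_def
  by (intro borel_measurable_prod borel_measurable_sum borel_measurable_times E_component_measurable[OF S])
     (use n in auto)

text \<open>The expansion into monomials replaces the integral over portfolios by a polynomial in the
  observations.\<close>

lemma mixture_wealth_measurable:
  assumes S: "evalue_setting d \<Omega> F E"
  shows "mixture_wealth d E n \<in> borel_measurable (F n)"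
proof -
  have "mixture_wealth d E n =
      (\<lambda>\<omega>. \<Sum>\<phi>\<in>{1..n} \<rightarrow>\<^sub>E {..d}. (\<Prod>i=1..n. E i \<omega> (\<phi> i)) * moment d (counts n \<phi>))"
    by (intro ext mixture_wealth_expand)
  also have "\<dots> \<in> borel_measurable (F n)"
    by (intro borel_measurable_sum borel_measurable_times borel_measurable_prod E_component_measurable[OF S]
        borel_measurable_const) (auto simp: PiE_iff)
  finally show ?thesis .
qed

lemma space_F: "evalue_setting d \<Omega> F E \<Longrightarrow> space (F n) = space \<Omega>"
  by (simp add: evalue_setting_def subalgebra_def)

lemma W_UP_measurable:
  assumes S: "evalue_setting d \<Omega> F E"
  shows "W_UP d E n \<in> borel_measurable (F n)"
proof -
  have "W_UP d E n \<in> borel_measurable (F n) \<longleftrightarrow> mixture_wealth d E n \<in> borel_measurable (F n)"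
  proof (rule measurable_cong)
    fix \<omega> assume "\<omega> \<in> space (F n)"
    then have "valid_outcome d E \<omega>" using evalue_setting_valid[OF S] space_F[OF S] by blast
    then show "W_UP d E n \<omega> = mixture_wealth d E n \<omega>" by (rule W_UP_eq_mixture)
  qed
  with mixture_wealth_measurable[OF S] show ?thesis by (rule iffD2[rotated])
qed

lemma UP_portfolio_measurable:
  assumes S: "evalue_setting d \<Omega> F E" and j: "j \<le> d"
  shows "(\<lambda>\<omega>. UP_portfolio d E (Suc n) \<omega> j) \<in> borel_measurable (F n)"
proof -
  have eq: "(\<integral>l. l j * wealth d E l n \<omega> \<partial>jeffreys d) =
      (\<Sum>\<phi>\<in>{1..n} \<rightarrow>\<^sub>E {..d}. (\<Prod>i=1..n. E i \<omega> (\<phi> i)) *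
        (\<integral>l. l j * (\<Prod>k\<le>d. l k ^ counts n \<phi> k) \<partial>jeffreys d))" for \<omega>
  proof -
    have int: "integrable (jeffreys d) (\<lambda>l. l j * (\<Prod>k\<le>d. l k ^ c k))" for c
    proof (rule Bochner_Integration.integrable_bound)
      show "integrable (jeffreys d) (\<lambda>l. \<Prod>k\<le>d. l k ^ c k)"
        using has_bochner_integral_monomial by (rule has_bochner_integral_iff[THEN iffD1, THEN conjunct1])
      show "(\<lambda>l. l j * (\<Prod>k\<le>d. l k ^ c k)) \<in> borel_measurable (jeffreys d)"
        using j by measurable
      show "AE l in jeffreys d. norm (l j * (\<Prod>k\<le>d. l k ^ c k)) \<le> norm (\<Prod>k\<le>d. l k ^ c k)"
        using AE_dirichlet_simplex
      proof eventually_elim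
        case (elim l)
        then have "l j \<in> {0..1}" using j by (auto simp: prob_simplex_def)
        then show ?case by (simp add: abs_mult mult_left_le_one_le)
      qed
    qed
    have "(\<integral>l. l j * wealth d E l n \<omega> \<partial>jeffreys d) =
        (\<integral>l. (\<Sum>\<phi>\<in>{1..n} \<rightarrow>\<^sub>E {..d}. (\<Prod>i=1..n. E i \<omega> (\<phi> i)) * (l j * (\<Prod>k\<le>d. l k ^ counts n \<phi> k))) \<partial>jeffreys d)"
      unfolding wealth_expand sum_distrib_left by (simp only: mult.left_commute)
    also have "\<dots> = (\<Sum>\<phi>\<in>{1..n} \<rightarrow>\<^sub>E {..d}. (\<Prod>i=1..n. E i \<omega> (\<phi> i)) *
        (\<integral>l. l j * (\<Prod>k\<le>d. l k ^ counts n \<phi> k) \<partial>jeffreys d))"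
      by (subst Bochner_Integration.integral_sum) (simp_all add: int)
    finally show ?thesis .
  qed
  have "UP_portfolio d E (Suc n) \<omega> j = (\<integral>l. l j * wealth d E l n \<omega> \<partial>jeffreys d) / mixture_wealth d E n \<omega>" for \<omega>
    using j by (simp add: UP_portfolio_def mixture_wealth_def)
  moreover have "(\<lambda>\<omega>. (\<Sum>\<phi>\<in>{1..n} \<rightarrow>\<^sub>E {..d}. (\<Prod>i=1..n. E i \<omega> (\<phi> i)) *
        (\<integral>l. l j * (\<Prod>k\<le>d. l k ^ counts n \<phi> k) \<partial>jeffreys d)) / mixture_wealth d E n \<omega>) \<in> borel_measurable (F n)"
    by (intro borel_measurable_divide borel_measurable_sum borel_measurable_times borel_measurable_prod
        E_component_measurable[OF S] borel_measurable_const mixture_wealth_measurable[OF S]) (auto simp: PiE_iff)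
  ultimately show ?thesis by (simp only: eq)
qed

text \<open>Independence of \<open>X\<close> and \<open>G\<close> says that restricting \<open>P\<close> to
  an event of \<open>G\<close> only rescales the law of \<open>X\<close>. Consequently the
  conditional expectation of \<open>h (X)\<close> given \<open>G\<close> is constant.\<close>

lemma nn_integral_mult_indep:
  assumes P: "prob_space P" and sub: "subalgebra P G" and X: "X \<in> measurable P V"
    and ind: "prob_space.indep_set P (sets G) {X -` B \<inter> space P |B. B \<in> sets V}"
    and Y: "Y \<in> borel_measurable G" and h: "h \<in> borel_measurable V"
  shows "(\<integral>\<^sup>+\<omega>. Y \<omega> * h (X \<omega>) \<partial>P) = (\<integral>\<^sup>+\<omega>. Y \<omega> \<partial>P) * (\<integral>\<^sup>+\<omega>. h (X \<omega>) \<partial>P)"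
proof -
  interpret P: prob_space P by fact
  interpret S: finite_measure_subalgebra P G by unfold_locales fact
  define c where "c = (\<integral>\<^sup>+\<omega>. h (X \<omega>) \<partial>P)"
  note [measurable] = X h
  have "(\<integral>\<^sup>+\<omega>\<in>A. h (X \<omega>) \<partial>P) = (\<integral>\<^sup>+\<omega>\<in>A. c \<partial>P)" if A: "A \<in> sets G" for A
  proof -
    have [measurable]: "A \<in> sets P" using A sub by (auto simp: subalgebra_def)
    have "distr (density P (indicator A)) V X = scale_measure (emeasure P A) (distr P V X)"
    proof (rule measure_eqI)
      fix B assume B: "B \<in> sets (distr (density P (indicator A)) V X)"
      then have [measurable]: "B \<in> sets V" by simp
      have "emeasure (distr (density P (indicator A)) V X) B = emeasure P (A \<inter> (X -` B \<inter> space P))"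
        by (simp add: emeasure_distr emeasure_density indicator_inter_arith[symmetric])
      also have "\<dots> = emeasure P A * emeasure P (X -` B \<inter> space P)"
      proof -
        have "P.prob (A \<inter> (X -` B \<inter> space P)) = P.prob A * P.prob (X -` B \<inter> space P)"
          using A \<open>B \<in> sets V\<close> by (intro P.indep_setD[OF ind]) auto
        then show ?thesis by (simp add: P.emeasure_eq_measure ennreal_mult)
      qed
      finally show "emeasure (distr (density P (indicator A)) V X) B =
          emeasure (scale_measure (emeasure P A) (distr P V X)) B"
        by (simp add: emeasure_distr)
    qed simp
    then have "(\<integral>\<^sup>+x. h x \<partial>distr (density P (indicator A)) V X) =
        (\<integral>\<^sup>+x. h x \<partial>scale_measure (emeasure P A) (distr P V X))" by simp
    moreover have "(\<integral>\<^sup>+x. h x \<partial>distr (density P (indicator A)) V X) = (\<integral>\<^sup>+\<omega>\<in>A. h (X \<omega>) \<partial>P)"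
      by (simp add: nn_integral_distr nn_integral_density mult.commute)
    moreover have "(\<integral>\<^sup>+x. h x \<partial>scale_measure (emeasure P A) (distr P V X)) = emeasure P A * c"
      by (simp add: nn_integral_scale_measure nn_integral_distr c_def)
    ultimately show ?thesis by (simp add: nn_integral_cmult_indicator mult.commute)
  qed
  then have "AE \<omega> in P. c = nn_cond_exp P G (\<lambda>\<omega>. h (X \<omega>)) \<omega>"
    by (intro S.nn_cond_exp_charact) auto
  then have "(\<integral>\<^sup>+\<omega>. Y \<omega> * nn_cond_exp P G (\<lambda>\<omega>. h (X \<omega>)) \<omega> \<partial>P) = (\<integral>\<^sup>+\<omega>. Y \<omega> * c \<partial>P)"
    by (intro nn_integral_cong_AE) auto
  moreover have "(\<integral>\<^sup>+\<omega>. Y \<omega> * nn_cond_exp P G (\<lambda>\<omega>. h (X \<omega>)) \<omega> \<partial>P) = (\<integral>\<^sup>+\<omega>. Y \<omega> * h (X \<omega>) \<partial>P)"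
    using Y by (intro S.nn_cond_exp_intg) auto
  moreover have "(\<integral>\<^sup>+\<omega>. Y \<omega> * c \<partial>P) = (\<integral>\<^sup>+\<omega>. Y \<omega> \<partial>P) * c"
    using measurable_from_subalg[OF sub Y] by (rule nn_integral_multc)
  ultimately show ?thesis by (simp add: c_def)
qed

lemma subalgebra_iid:
  assumes "evalue_setting d \<Omega> F E" "sets P = sets \<Omega>"
  shows "subalgebra P (F n)"
  using assms sets_eq_imp_space_eq[OF assms(2)] by (simp add: evalue_setting_def subalgebra_def)

lemma iid_distributionsD:
  assumes "P \<in> iid_distributions d \<Omega> F E"
  shows "prob_space P" "sets P = sets \<Omega>" "space P = space \<Omega>"
    "prob_space.indep_vars P (\<lambda>_. vec_algebra d) E {1..}"
    "1 \<le> n \<Longrightarrow> distr P (vec_algebra d) (E n) = distr P (vec_algebra d) (E 1)"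
    "prob_space.indep_set P (sets (F n)) {E (Suc n) -` B \<inter> space P |B. B \<in> sets (vec_algebra d)}"
proof -
  note * = assms[unfolded iid_distributions_def mem_Collect_eq]
  show "prob_space P" "sets P = sets \<Omega>"
    "prob_space.indep_vars P (\<lambda>_. vec_algebra d) E {1..}"
    "1 \<le> n \<Longrightarrow> distr P (vec_algebra d) (E n) = distr P (vec_algebra d) (E 1)"
    using * by blast+
  show "space P = space \<Omega>" by (rule sets_eq_imp_space_eq[OF *[THEN conjunct2, THEN conjunct1]])
  show "prob_space.indep_set P (sets (F n)) {E (Suc n) -` B \<inter> space P |B. B \<in> sets (vec_algebra d)}"
    using *[THEN conjunct2, THEN conjunct2, THEN conjunct2, THEN conjunct2, rule_format, of "Suc n"] by simp
qed

lemma iid_measurable: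
  assumes "evalue_setting d \<Omega> F E" "P \<in> iid_distributions d \<Omega> F E" "1 \<le> n"
  shows "E n \<in> measurable P (vec_algebra d)"
  by (rule measurable_from_subalg[OF subalgebra_iid[OF assms(1) iid_distributionsD(2)[OF assms(2)]]
      E_measurable[OF assms(1,3) order_refl]])

lemma nn_integral_component_le_1:
  assumes S: "evalue_setting d \<Omega> F E" and P: "P \<in> null_hypothesis d \<Omega> F E" and n: "1 \<le> n" and j: "j \<le> d"
  shows "(\<integral>\<^sup>+\<omega>. ennreal (E n \<omega> j) \<partial>P) \<le> 1"
proof -
  have iid: "P \<in> iid_distributions d \<Omega> F E" and mean: "\<And>j. j \<in> {1..d} \<Longrightarrow> (\<integral>\<^sup>+\<omega>. ennreal (E 1 \<omega> j) \<partial>P) \<le> 1"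
    using P[unfolded null_hypothesis_def mem_Collect_eq] by (rule conjunct1, rule conjunct2[THEN bspec])
  interpret P: prob_space P by (rule iid_distributionsD(1)[OF iid])
  have pull: "(\<integral>\<^sup>+x. ennreal (x j) \<partial>distr P (vec_algebra d) (E n)) = (\<integral>\<^sup>+\<omega>. ennreal (E n \<omega> j) \<partial>P)"
    if "1 \<le> n" for n
    by (rule nn_integral_distr[OF iid_measurable[OF S iid that]])
       (simp add: measurable_compose[OF vec_component_measurable[OF j] measurable_ennreal])
  show ?thesis
  proof (cases "j = 0")
    case True
    have "(\<integral>\<^sup>+\<omega>. ennreal (E n \<omega> j) \<partial>P) = (\<integral>\<^sup>+\<omega>. 1 \<partial>P)"
    proof (intro nn_integral_cong)
      fix \<omega> assume "\<omega> \<in> space P"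
      then have "valid_outcome d E \<omega>" using evalue_setting_valid[OF S] iid_distributionsD(3)[OF iid] by blast
      then show "ennreal (E n \<omega> j) = 1" using n True by (simp add: valid_outcome_def)
    qed
    then show ?thesis by (simp add: P.emeasure_space_1)
  next
    case False
    have "(\<integral>\<^sup>+\<omega>. ennreal (E n \<omega> j) \<partial>P) = (\<integral>\<^sup>+\<omega>. ennreal (E 1 \<omega> j) \<partial>P)"
      unfolding pull[OF n, symmetric] pull[OF order_refl, symmetric] iid_distributionsD(5)[OF iid n] ..
    also have "\<dots> \<le> 1" using False j by (intro mean) simp
    finally show ?thesis .
  qed
qed

text \<open>With \<open>a n j = W_UP n * UP_portfolio (n + 1) j\<close>, which is known at time
  \<open>n\<close>, the next value is \<open>\<Sum>j. a n j * E (n + 1) j\<close>. Its conditional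
  expectation replaces each \<open>E (n + 1) j\<close> by its mean, at most 1, and the \<open>a n
  j\<close> sum to \<open>W_UP n\<close>. The first step is the case \<open>n = 0\<close> with the
  trivial sigma-algebra.\<close>

lemma test_supermartingale_W_UP:
  assumes S: "evalue_setting d \<Omega> F E" and P: "P \<in> null_hypothesis d \<Omega> F E"
  shows "test_supermartingale \<Omega> F P (W_UP d E)"
proof -
  have iid: "P \<in> iid_distributions d \<Omega> F E" using P[unfolded null_hypothesis_def mem_Collect_eq] by (rule conjunct1)
  interpret P: prob_space P by (rule iid_distributionsD(1)[OF iid])
  note sets = iid_distributionsD(2)[OF iid] and space = iid_distributionsD(3)[OF iid]
  note meas = iid_measurable[OF S iid]
  have adapted: "nonneg_adapted \<Omega> F (W_UP d E)"
    unfolding nonneg_adapted_def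
    by (intro allI impI conjI ballI W_UP_measurable[OF S] less_imp_le W_UP_pos evalue_setting_valid[OF S])
  have sub: "subalgebra P (F n)" for n by (rule subalgebra_iid[OF S sets])
  define a where "a n \<omega> j = W_UP d E n \<omega> * UP_portfolio d E (Suc n) \<omega> j" for n \<omega> j
  have a_meas: "(\<lambda>\<omega>. ennreal (a n \<omega> j)) \<in> borel_measurable (F n)" if "j \<le> d" for n j
    unfolding a_def
    by (intro measurable_compose[OF _ measurable_ennreal] borel_measurable_times W_UP_measurable[OF S]
        UP_portfolio_measurable[OF S that])
  have a_nonneg: "0 \<le> a n \<omega> j" if "\<omega> \<in> space \<Omega>" "j \<le> d" for n \<omega> j
    unfolding a_def
  proof (rule mult_nonneg_nonneg)
    note valid = evalue_setting_valid[OF S that(1)]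
    show "0 \<le> W_UP d E n \<omega>" by (rule less_imp_le[OF W_UP_pos[OF valid]])
    show "0 \<le> UP_portfolio d E (Suc n) \<omega> j"
      using UP_portfolio_in_simplex[OF valid, of "Suc n"] that(2) by (simp add: prob_simplex_iff)
  qed
  have a_sum: "(\<Sum>j\<le>d. a n \<omega> j) = W_UP d E n \<omega>" if "\<omega> \<in> space \<Omega>" for n \<omega>
    using UP_portfolio_in_simplex[OF evalue_setting_valid[OF S that], of "Suc n"]
    by (simp add: a_def prob_simplex_iff sum_distrib_left[symmetric])
  have W_Suc: "ennreal (W_UP d E (Suc n) \<omega>) = (\<Sum>j\<le>d. ennreal (a n \<omega> j) * ennreal (E (Suc n) \<omega> j))"
    if "\<omega> \<in> space \<Omega>" for n \<omega>
  proof -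
    have "W_UP d E (Suc n) \<omega> = (\<Sum>j\<le>d. a n \<omega> j * E (Suc n) \<omega> j)"
    proof -
      have "W_UP d E (Suc n) \<omega> = W_UP d E n \<omega> * payoff d (UP_portfolio d E (Suc n) \<omega>) (E (Suc n) \<omega>)"
        by (simp add: W_UP_def)
      then show ?thesis by (simp add: payoff_def a_def sum_distrib_left mult.assoc)
    qed
    moreover have "0 \<le> E (Suc n) \<omega> j" if "j \<le> d" for j
      using evalue_setting_valid[OF S \<open>\<omega> \<in> space \<Omega>\<close>] that by (simp add: valid_outcome_def)
    moreover have "(\<Sum>j\<le>d. ennreal (a n \<omega> j) * ennreal (E (Suc n) \<omega> j)) = (\<Sum>j\<le>d. ennreal (a n \<omega> j * E (Suc n) \<omega> j))"
      using calculation(2) a_nonneg[OF that] by (intro sum.cong refl ennreal_mult[symmetric]) simp_all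
    moreover have "\<dots> = ennreal (\<Sum>j\<le>d. a n \<omega> j * E (Suc n) \<omega> j)"
      using calculation(2) a_nonneg[OF that] by (intro sum_ennreal mult_nonneg_nonneg) simp_all
    ultimately show ?thesis by (simp only:)
  qed
  define c where "c n j = (\<integral>\<^sup>+\<omega>. ennreal (E (Suc n) \<omega> j) \<partial>P)" for n j
  have c: "c n j \<le> 1" if "j \<le> d" for n j
    unfolding c_def by (rule nn_integral_component_le_1[OF S P _ that]) simp
  have main: "(\<integral>\<^sup>+\<omega>\<in>A. ennreal (W_UP d E (Suc n) \<omega>) \<partial>P) =
      (\<integral>\<^sup>+\<omega>\<in>A. (\<Sum>j\<le>d. ennreal (a n \<omega> j) * c n j) \<partial>P)" if A: "A \<in> sets (F n)" for n A
  proof -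
    have AP: "A \<in> sets P" using A sub by (auto simp: subalgebra_def)
    have aA: "(\<lambda>\<omega>. ennreal (a n \<omega> j) * indicator A \<omega>) \<in> borel_measurable P" if "j \<le> d" for j
      by (rule borel_measurable_times_ennreal[OF measurable_from_subalg[OF sub a_meas[OF that]] borel_measurable_indicator[OF AP]])
    have EP: "(\<lambda>\<omega>. ennreal (E (Suc n) \<omega> j)) \<in> borel_measurable P" if "j \<le> d" for j
      by (rule measurable_compose[OF meas measurable_compose[OF vec_component_measurable[OF that] measurable_ennreal]]) simp
    have "(\<integral>\<^sup>+\<omega>\<in>A. ennreal (W_UP d E (Suc n) \<omega>) \<partial>P) =
        (\<integral>\<^sup>+\<omega>. (\<Sum>j\<le>d. (ennreal (a n \<omega> j) * indicator A \<omega>) * ennreal (E (Suc n) \<omega> j)) \<partial>P)"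
    proof (intro nn_integral_cong)
      fix \<omega> assume "\<omega> \<in> space P"
      then have "\<omega> \<in> space \<Omega>" by (simp only: space)
      show "ennreal (W_UP d E (Suc n) \<omega>) * indicator A \<omega> =
          (\<Sum>j\<le>d. (ennreal (a n \<omega> j) * indicator A \<omega>) * ennreal (E (Suc n) \<omega> j))"
        unfolding W_Suc[OF \<open>\<omega> \<in> space \<Omega>\<close>] sum_distrib_right by (simp only: mult_ac)
    qed
    also have "\<dots> = (\<Sum>j\<le>d. \<integral>\<^sup>+\<omega>. (ennreal (a n \<omega> j) * indicator A \<omega>) * ennreal (E (Suc n) \<omega> j) \<partial>P)"
    proof (rule nn_integral_sum)
      fix j assume "j \<in> {..d}"
      then have j: "j \<le> d" by simp
      show "(\<lambda>\<omega>. (ennreal (a n \<omega> j) * indicator A \<omega>) * ennreal (E (Suc n) \<omega> j)) \<in> borel_measurable P"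
        by (rule borel_measurable_times_ennreal[OF aA[OF j] EP[OF j]])
    qed
    also have "\<dots> = (\<Sum>j\<le>d. (\<integral>\<^sup>+\<omega>. ennreal (a n \<omega> j) * indicator A \<omega> \<partial>P) * c n j)"
    proof (intro sum.cong refl)
      fix j assume "j \<in> {..d}"
      then have j: "j \<le> d" by simp
      show "(\<integral>\<^sup>+\<omega>. (ennreal (a n \<omega> j) * indicator A \<omega>) * ennreal (E (Suc n) \<omega> j) \<partial>P) =
          (\<integral>\<^sup>+\<omega>. ennreal (a n \<omega> j) * indicator A \<omega> \<partial>P) * c n j"
        unfolding c_def
      proof (rule nn_integral_mult_indep[where V = "vec_algebra d" and G = "F n" and h = "\<lambda>x. ennreal (x j)"])
        show "P.indep_set (sets (F n)) {E (Suc n) -` B \<inter> space P |B. B \<in> sets (vec_algebra d)}"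
          by (rule iid_distributionsD(6)[OF iid])
        show "(\<lambda>\<omega>. ennreal (a n \<omega> j) * indicator A \<omega>) \<in> borel_measurable (F n)"
          by (rule borel_measurable_times_ennreal[OF a_meas[OF j] borel_measurable_indicator[OF A]])
        show "E (Suc n) \<in> measurable P (vec_algebra d)" by (rule meas) simp
        show "(\<lambda>x. ennreal (x j)) \<in> borel_measurable (vec_algebra d)"
          by (rule measurable_compose[OF vec_component_measurable[OF j] measurable_ennreal])
      qed (rule P.prob_space_axioms sub)+
    qed
    also have "\<dots> = (\<integral>\<^sup>+\<omega>. (\<Sum>j\<le>d. (ennreal (a n \<omega> j) * indicator A \<omega>) * c n j) \<partial>P)"
    proof -
      have "(\<integral>\<^sup>+\<omega>. (\<Sum>j\<le>d. (ennreal (a n \<omega> j) * indicator A \<omega>) * c n j) \<partial>P) =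
          (\<Sum>j\<le>d. \<integral>\<^sup>+\<omega>. (ennreal (a n \<omega> j) * indicator A \<omega>) * c n j \<partial>P)"
      proof (rule nn_integral_sum)
        fix j assume "j \<in> {..d}"
        then have j: "j \<le> d" by simp
        show "(\<lambda>\<omega>. (ennreal (a n \<omega> j) * indicator A \<omega>) * c n j) \<in> borel_measurable P"
          by (rule borel_measurable_times_ennreal[OF aA[OF j] borel_measurable_const])
      qed
      also have "\<dots> = (\<Sum>j\<le>d. (\<integral>\<^sup>+\<omega>. ennreal (a n \<omega> j) * indicator A \<omega> \<partial>P) * c n j)"
        by (intro sum.cong refl nn_integral_multc aA) simp
      finally show ?thesis by (rule sym)
    qed
    also have "\<dots> = (\<integral>\<^sup>+\<omega>\<in>A. (\<Sum>j\<le>d. ennreal (a n \<omega> j) * c n j) \<partial>P)"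
      unfolding sum_distrib_right by (simp only: mult_ac)
    finally show ?thesis .
  qed
  have le: "(\<Sum>j\<le>d. ennreal (a n \<omega> j) * c n j) \<le> ennreal (W_UP d E n \<omega>)" if "\<omega> \<in> space \<Omega>" for n \<omega>
  proof -
    have "(\<Sum>j\<le>d. ennreal (a n \<omega> j) * c n j) \<le> (\<Sum>j\<le>d. ennreal (a n \<omega> j) * 1)"
      by (intro sum_mono mult_left_mono c) simp_all
    also have "\<dots> = ennreal (W_UP d E n \<omega>)"
      using sum_ennreal[of "{..d}" "\<lambda>j. a n \<omega> j"] a_sum[OF that, of n] a_nonneg[OF that] by simp
    finally show ?thesis .
  qed
  have "(\<integral>\<^sup>+\<omega>. ennreal (W_UP d E 1 \<omega>) \<partial>P) \<le> 1"
  proof -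
    have top: "space \<Omega> \<in> sets (F 0)" using S by (simp add: evalue_setting_def)
    have "(\<integral>\<^sup>+\<omega>. ennreal (W_UP d E 1 \<omega>) \<partial>P) = (\<integral>\<^sup>+\<omega>\<in>space \<Omega>. ennreal (W_UP d E (Suc 0) \<omega>) \<partial>P)"
      by (intro nn_integral_cong) (simp only: space indicator_simps mult_1_right One_nat_def)
    also have "\<dots> = (\<integral>\<^sup>+\<omega>. (\<Sum>j\<le>d. ennreal (a 0 \<omega> j) * c 0 j) \<partial>P)"
      unfolding main[OF top] by (intro nn_integral_cong) (simp only: space indicator_simps mult_1_right)
    also have "\<dots> \<le> (\<integral>\<^sup>+\<omega>. 1 \<partial>P)"
    proof (intro nn_integral_mono)
      fix \<omega> assume "\<omega> \<in> space P"
      then have "\<omega> \<in> space \<Omega>" by (simp only: space)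
      from le[OF this, of 0] show "(\<Sum>j\<le>d. ennreal (a 0 \<omega> j) * c 0 j) \<le> 1" by (simp add: W_UP_def)
    qed
    finally show ?thesis by (simp add: P.emeasure_space_1)
  qed
  moreover have "AE \<omega> in P. nn_cond_exp P (F (n - 1)) (\<lambda>\<omega>. ennreal (W_UP d E n \<omega>)) \<omega> \<le> ennreal (W_UP d E (n - 1) \<omega>)"
    if "2 \<le> n" for n
  proof -
    obtain m where n: "n = Suc m" using \<open>2 \<le> n\<close> by (cases n) auto
    interpret M: finite_measure_subalgebra P "F m" by unfold_locales (rule sub)
    have "AE \<omega> in P. (\<Sum>j\<le>d. ennreal (a m \<omega> j) * c m j) = nn_cond_exp P (F m) (\<lambda>\<omega>. ennreal (W_UP d E (Suc m) \<omega>)) \<omega>"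
    proof (rule M.nn_cond_exp_charact[OF main])
      show "(\<lambda>\<omega>. ennreal (W_UP d E (Suc m) \<omega>)) \<in> borel_measurable P"
        by (rule measurable_compose[OF measurable_from_subalg[OF sub W_UP_measurable[OF S]] measurable_ennreal])
      show "(\<lambda>\<omega>. \<Sum>j\<le>d. ennreal (a m \<omega> j) * c m j) \<in> borel_measurable (F m)"
        by (rule borel_measurable_sum) (rule borel_measurable_times_ennreal[OF a_meas borel_measurable_const], simp)
    qed
    moreover have "AE \<omega> in P. (\<Sum>j\<le>d. ennreal (a m \<omega> j) * c m j) \<le> ennreal (W_UP d E m \<omega>)"
      by (intro AE_I2 le) (simp only: space)
    ultimately show ?thesis unfolding n by eventually_elim simp
  qed
  ultimately show ?thesis using adapted by (simp add: test_supermartingale_def)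
qed

section \<open>Regret and domination\<close>

lemma elog_mono: "0 \<le> x \<Longrightarrow> x \<le> y \<Longrightarrow> elog x \<le> elog y"
  by (auto simp: elog_def)

lemma elog_pos: "0 < x \<Longrightarrow> elog x = ereal (ln x)"
  by (simp add: elog_def)

lemma elog_less_top: "elog x < \<infinity>"
  by (simp add: elog_def)

lemma elog_mult: "0 \<le> x \<Longrightarrow> 0 \<le> y \<Longrightarrow> elog (x * y) = elog x + elog y"
  by (auto simp: elog_def ln_mult)

lemma sum_elog:
  assumes "finite I" "\<And>i. i \<in> I \<Longrightarrow> 0 \<le> f i"
  shows "(\<Sum>i\<in>I. elog (f i)) = elog (\<Prod>i\<in>I. f i)"
  using assms
proof (induction I)
  case empty
  then show ?case by (simp add: elog_def zero_ereal_def)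
next
  case (insert i I)
  then show ?case by (simp add: elog_mult prod_nonneg)
qed

lemma payoff_nonneg:
  assumes "valid_outcome d E \<omega>" "l \<in> prob_simplex d" "1 \<le> i"
  shows "0 \<le> payoff d l (E i \<omega>)"
  using assms unfolding payoff_def by (intro sum_nonneg mult_nonneg_nonneg) (auto simp: prob_simplex_iff valid_outcome_def)

definition best_log_wealth :: "nat \<Rightarrow> (nat \<Rightarrow> 'a \<Rightarrow> nat \<Rightarrow> real) \<Rightarrow> nat \<Rightarrow> 'a \<Rightarrow> ereal" where
  "best_log_wealth d E n \<omega> = (SUP l\<in>prob_simplex d. elog (wealth d E l n \<omega>))"

lemma max_log_wealth_eq:
  assumes "valid_outcome d E \<omega>"
  shows "max_log_wealth d E n \<omega> = best_log_wealth d E n \<omega>"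
  unfolding max_log_wealth_def best_log_wealth_def wealth_def
  by (intro SUP_cong refl sum_elog) (auto intro: payoff_nonneg[OF assms])

lemma best_log_wealth_le:
  assumes "valid_outcome d E \<omega>"
  shows "best_log_wealth d E n \<omega> \<le> ereal (ln (regret_factor d n * W_UP d E n \<omega>))"
  unfolding best_log_wealth_def
proof (rule SUP_least)
  fix l assume l: "l \<in> prob_simplex d"
  have "elog (wealth d E l n \<omega>) \<le> elog (regret_factor d n * W_UP d E n \<omega>)"
    by (rule elog_mono[OF wealth_nonneg[OF assms l] wealth_le_W_UP[OF assms l]])
  also have "\<dots> = ereal (ln (regret_factor d n * W_UP d E n \<omega>))"
    by (intro elog_pos mult_pos_pos regret_factor_pos W_UP_pos[OF assms])
  finally show "elog (wealth d E l n \<omega>) \<le> ereal (ln (regret_factor d n * W_UP d E n \<omega>))" .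
qed

lemma best_log_wealth_upper:
  "l \<in> prob_simplex d \<Longrightarrow> elog (wealth d E l n \<omega>) \<le> best_log_wealth d E n \<omega>"
  unfolding best_log_wealth_def by (rule SUP_upper)

lemma best_log_wealth_nonneg:
  assumes "valid_outcome d E \<omega>"
  shows "0 \<le> best_log_wealth d E n \<omega>"
proof -
  have "elog 1 \<le> best_log_wealth d E n \<omega>"
    using best_log_wealth_upper[OF vertex_in_simplex[of 0 d], of E n \<omega>] wealth_vertex_0[OF assms] by simp
  then show ?thesis by (simp add: elog_def zero_ereal_def)
qed

text \<open>The lower bound comes from the portfolio that holds only asset 0. Finiteness allows the
  remaining computations to be done with real numbers.\<close>

lemma best_log_wealth_real:
  assumes "valid_outcome d E \<omega>"
  obtains s where "best_log_wealth d E n \<omega> = ereal s" "s \<le> ln (regret_factor d n) + ln (W_UP d E n \<omega>)"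
proof -
  obtain s where s: "best_log_wealth d E n \<omega> = ereal s"
    using best_log_wealth_nonneg[OF assms, of n] best_log_wealth_le[OF assms, of n]
    by (cases "best_log_wealth d E n \<omega>") auto
  have "s \<le> ln (regret_factor d n * W_UP d E n \<omega>)"
    using best_log_wealth_le[OF assms, of n] s by simp
  also have "\<dots> = ln (regret_factor d n) + ln (W_UP d E n \<omega>)"
    using regret_factor_pos[of d n] W_UP_pos[OF assms, of n] by (simp add: ln_mult)
  finally show ?thesis using that s by blast
qed

lemma W_CO96_eq:
  assumes "best_log_wealth d E n \<omega> = ereal s"
  shows "W_CO96 d E n \<omega> = exp (s - ln (regret_factor d n))"
  using assms unfolding W_CO96_def best_log_wealth_def[symmetric] ln_regret_factor by simp

text \<open>The penalty subtracted from the best log-wealth is exactly the regret bound of the universal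
  portfolio.\<close>

lemma W_CO96_le_W_UP:
  assumes "valid_outcome d E \<omega>"
  shows "W_CO96 d E n \<omega> \<le> W_UP d E n \<omega>"
proof -
  obtain s where s: "best_log_wealth d E n \<omega> = ereal s" "s \<le> ln (regret_factor d n) + ln (W_UP d E n \<omega>)"
    using best_log_wealth_real[OF assms] .
  have "exp (s - ln (regret_factor d n)) \<le> exp (ln (W_UP d E n \<omega>))" using s(2) by simp
  then show ?thesis using W_UP_pos[OF assms, of n] by (simp add: W_CO96_eq[OF s(1)])
qed

lemma portfolio_regret_eq:
  assumes "valid_outcome d E \<omega>" "best_log_wealth d E n \<omega> = ereal s" "0 < W n \<omega>"
  shows "portfolio_regret d E W n \<omega> = ereal (s - ln (W n \<omega>))"
  using assms by (simp add: portfolio_regret_def max_log_wealth_eq elog_pos)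

lemma regret_W_UP:
  assumes "valid_outcome d E \<omega>"
  shows "portfolio_regret d E (W_UP d E) n \<omega> \<le> ereal (ln (regret_factor d n))"
proof -
  obtain s where s: "best_log_wealth d E n \<omega> = ereal s" "s \<le> ln (regret_factor d n) + ln (W_UP d E n \<omega>)"
    using best_log_wealth_real[OF assms] .
  then show ?thesis by (simp add: portfolio_regret_eq[where W = "W_UP d E", OF assms s(1) W_UP_pos[OF assms]])
qed

lemma regret_W_CO96:
  assumes "valid_outcome d E \<omega>"
  shows "portfolio_regret d E (W_CO96 d E) n \<omega> \<le> ereal (ln (regret_factor d n))"
proof -
  obtain s where s: "best_log_wealth d E n \<omega> = ereal s" "s \<le> ln (regret_factor d n) + ln (W_UP d E n \<omega>)"
    using best_log_wealth_real[OF assms] .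
  have "0 < W_CO96 d E n \<omega>" by (simp add: W_CO96_def)
  then show ?thesis by (simp add: portfolio_regret_eq[where W = "W_CO96 d E", OF assms s(1)] W_CO96_eq[OF s(1)])
qed

definition two_asset :: "real \<Rightarrow> nat \<Rightarrow> real" where
  "two_asset l = (\<lambda>j\<in>{..1}. if j = 0 then 1 - l else l)"

lemma atMost_1: "{..1::nat} = {0, 1}" by auto

lemma two_asset_in_simplex: "l \<in> {0..1} \<Longrightarrow> two_asset l \<in> prob_simplex 1"
  by (auto simp: prob_simplex_iff two_asset_def atMost_1)

lemma prob_simplex_1: "prob_simplex 1 = two_asset ` {0..1}"
proof (intro equalityI subsetI)
  fix m assume m: "m \<in> prob_simplex 1"
  then have "m = two_asset (m 1)"
    by (intro extensionalityI[of _ "{..1}"]) (auto simp: prob_simplex_iff two_asset_def atMost_1 le_Suc_eq)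
  moreover have "m 1 \<in> {0..1}" using m by (auto simp: prob_simplex_def)
  ultimately show "m \<in> two_asset ` {0..1}" by blast
qed (use two_asset_in_simplex in blast)

lemma log_wealth2_eq:
  assumes "valid_outcome 1 E \<omega>" "l \<in> {0..1}"
  shows "log_wealth2 E l n \<omega> = elog (wealth 1 E (two_asset l) n \<omega>)"
proof -
  have p: "payoff 1 (two_asset l) x = (1 - l) * x 0 + l * x 1" for x
    by (simp add: payoff_def two_asset_def atMost_1)
  show ?thesis
    unfolding log_wealth2_def wealth_def p[symmetric]
    using payoff_nonneg[OF assms(1) two_asset_in_simplex[OF assms(2)]] by (intro sum_elog) auto
qed

text \<open>The expression under the maximum in \<open>W_OJ23\<close>: by the moment formula for two assets
  it is the monomial \<open>l ^ j (1 - l) ^ (n - j)\<close> divided by its moment.\<close>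

definition type_ratio :: "nat \<Rightarrow> real \<Rightarrow> nat \<Rightarrow> real" where
  "type_ratio n l j = pi * l ^ j * (1 - l) ^ (n - j) * Gamma (real n + 1) /
     (Gamma (real j + 1 / 2) * Gamma (real n - real j + 1 / 2))"

lemma moment_1:
  assumes "c 0 + c 1 = n"
  shows "moment 1 c = Gamma (real (c 1) + 1 / 2) * Gamma (real n - real (c 1) + 1 / 2) / (pi * Gamma (real n + 1))"
proof -
  have "real (c 0) = real n - real (c 1)" using assms by linarith
  moreover have "Gamma (1 / 2 :: real) ^ Suc 1 = pi" by (simp add: Gamma_one_half_real)
  ultimately show ?thesis using assms by (simp add: moment_def atMost_1 Gamma_one_half_real mult_ac)
qed

lemma type_ratio_moment:
  assumes "c 0 + c 1 = n" "l \<in> {0..1}"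
  shows "(\<Prod>j\<le>1. two_asset l j ^ c j) = type_ratio n l (c 1) * moment 1 c"
proof -
  have "n - c 1 = c 0" using assms by simp
  moreover have "Gamma (real n - real (c 1) + 1 / 2) \<noteq> 0"
    by (rule less_imp_neq[THEN not_sym], rule Gamma_real_pos) (use assms in simp)
  moreover have "Gamma (real n + 1) \<noteq> 0"
    by (rule less_imp_neq[THEN not_sym], rule Gamma_real_pos) simp
  moreover have "Gamma (real (c 1) + 1 / 2) \<noteq> 0"
    by (rule less_imp_neq[THEN not_sym], rule Gamma_half_pos)
  ultimately show ?thesis
    unfolding moment_1[OF assms(1)] type_ratio_def by (simp add: two_asset_def atMost_1)
qed

lemma type_ratio_nonneg:
  assumes "l \<in> {0..1}" "j \<le> n"
  shows "0 \<le> type_ratio n l j"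
proof -
  have "Gamma (real n - real j + 1 / 2) > 0" using assms by (intro Gamma_real_pos) simp
  moreover have "Gamma (real n + 1) > 0" by (rule Gamma_real_pos) simp
  ultimately show ?thesis using assms Gamma_half_pos[of j]
    unfolding type_ratio_def by (intro divide_nonneg_nonneg mult_nonneg_nonneg zero_le_power) auto
qed

lemma type_ratio_le:
  assumes l: "l \<in> {0..1}" and j: "j \<le> n"
  shows "type_ratio n l j \<le> regret_factor 1 n"
proof -
  define c :: "nat \<Rightarrow> nat" where "c i = (if i = 0 then n - j else j)" for i
  have c: "c 0 + c 1 = n" "c 1 = j" "(\<Sum>i\<le>1. c i) = n" using j by (auto simp: c_def atMost_1)
  have "type_ratio n l j * moment 1 c \<le> regret_factor 1 n * moment 1 c"
    using monomial_le_moment[OF two_asset_in_simplex[OF l], of c] type_ratio_moment[OF c(1) l] c by simp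
  moreover have "0 < moment 1 c"
  proof -
    have "Gamma (real n - real j + 1 / 2) > 0" using j by (intro Gamma_real_pos) simp
    moreover have "Gamma (real n + 1) > 0" by (rule Gamma_real_pos) simp
    ultimately show ?thesis using Gamma_half_pos[of j] unfolding moment_1[OF c(1)] c(2) by simp
  qed
  ultimately show ?thesis by (rule mult_right_le_imp_le)
qed

lemma Max_elog:
  assumes "finite A" "A \<noteq> {}" "\<And>a. a \<in> A \<Longrightarrow> 0 \<le> f a"
  shows "Max ((\<lambda>a. elog (f a)) ` A) = elog (Max (f ` A))"
proof (rule Max_eqI)
  show "finite ((\<lambda>a. elog (f a)) ` A)" using assms by simp
  show "elog (Max (f ` A)) \<in> (\<lambda>a. elog (f a)) ` A"
  proof -
    have "Max (f ` A) \<in> f ` A" using assms by (intro Max_in) simp_all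
    then show ?thesis by auto
  qed
  fix y assume "y \<in> (\<lambda>a. elog (f a)) ` A"
  then show "y \<le> elog (Max (f ` A))" using assms by (auto intro!: elog_mono)
qed

definition max_type_ratio :: "nat \<Rightarrow> real \<Rightarrow> real" where
  "max_type_ratio n l = Max (type_ratio n l ` {0..n})"

text \<open>At \<open>l = 0\<close> the type \<open>j = 0\<close> contributes a positive ratio, since
  \<open>0 ^ 0 = 1\<close>; for \<open>l > 0\<close> the type \<open>j = n\<close> does.\<close>

lemma max_type_ratio_pos:
  assumes "l \<in> {0..1}"
  shows "0 < max_type_ratio n l"
proof -
  define j where "j = (if l = 0 then 0 else n)"
  have "Gamma (real n - real j + 1 / 2) > 0" by (intro Gamma_real_pos) (simp add: j_def)
  moreover have "Gamma (real n + 1) > 0" by (rule Gamma_real_pos) simp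
  moreover have "0 < l ^ j * (1 - l) ^ (n - j)" using assms by (auto simp: j_def)
  ultimately have "0 < type_ratio n l j"
    using Gamma_half_pos[of j] unfolding type_ratio_def by (intro divide_pos_pos mult_pos_pos) (auto simp: zero_less_mult_iff assms)
  also have "\<dots> \<le> max_type_ratio n l" unfolding max_type_ratio_def by (rule Max_ge) (auto simp: j_def)
  finally show ?thesis .
qed

lemma max_type_ratio_le: "l \<in> {0..1} \<Longrightarrow> max_type_ratio n l \<le> regret_factor 1 n"
  unfolding max_type_ratio_def using type_ratio_le by (subst Max_le_iff) fastforce+

lemma wealth_le_max_type_ratio:
  assumes v: "valid_outcome 1 E \<omega>" and l: "l \<in> {0..1}"
  shows "wealth 1 E (two_asset l) n \<omega> \<le> max_type_ratio n l * W_UP 1 E n \<omega>"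
  unfolding W_UP_eq_mixture[OF v]
proof (rule wealth_le_mixture)
  fix c :: "nat \<Rightarrow> nat" assume "(\<Sum>j\<le>1. c j) = n"
  then have c: "c 0 + c 1 = n" by (simp add: atMost_1)
  then have "type_ratio n l (c 1) \<le> max_type_ratio n l"
    unfolding max_type_ratio_def by (intro Max_ge) auto
  then show "(\<Prod>j\<le>1. two_asset l j ^ c j) \<le> max_type_ratio n l * moment 1 c"
    unfolding type_ratio_moment[OF c l] by (intro mult_right_mono moment_nonneg)
qed (use v in \<open>auto simp: valid_outcome_def\<close>)

lemma W_OJ23_eq:
  assumes v: "valid_outcome 1 E \<omega>" and l: "lmax n \<omega> \<in> {0..1}"
    and max: "\<And>l. l \<in> {0..1} \<Longrightarrow> log_wealth2 E l n \<omega> \<le> log_wealth2 E (lmax n \<omega>) n \<omega>"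
  shows "best_log_wealth 1 E n \<omega> = elog (wealth 1 E (two_asset (lmax n \<omega>)) n \<omega>)"
    and "0 < wealth 1 E (two_asset (lmax n \<omega>)) n \<omega>"
    and "W_OJ23 E lmax n \<omega> = wealth 1 E (two_asset (lmax n \<omega>)) n \<omega> / max_type_ratio n (lmax n \<omega>)"
proof -
  define w where "w = wealth 1 E (two_asset (lmax n \<omega>)) n \<omega>"
  define m where "m = max_type_ratio n (lmax n \<omega>)"
  show best: "best_log_wealth 1 E n \<omega> = elog (wealth 1 E (two_asset (lmax n \<omega>)) n \<omega>)"
    unfolding best_log_wealth_def prob_simplex_1 image_image
  proof (rule antisym)
    show "(SUP l\<in>{0..1}. elog (wealth 1 E (two_asset l) n \<omega>)) \<le> elog (wealth 1 E (two_asset (lmax n \<omega>)) n \<omega>)"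
    proof (rule SUP_least)
      fix k :: real assume k: "k \<in> {0..1}"
      show "elog (wealth 1 E (two_asset k) n \<omega>) \<le> elog (wealth 1 E (two_asset (lmax n \<omega>)) n \<omega>)"
        using max[OF k] unfolding log_wealth2_eq[OF v k] log_wealth2_eq[OF v l] .
    qed
    show "elog (wealth 1 E (two_asset (lmax n \<omega>)) n \<omega>) \<le> (SUP l\<in>{0..1}. elog (wealth 1 E (two_asset l) n \<omega>))"
      by (rule SUP_upper[OF l])
  qed
  have "0 \<le> elog w" using best_log_wealth_nonneg[OF v, of n] unfolding best w_def .
  moreover have "0 \<le> w" unfolding w_def by (rule wealth_nonneg[OF v two_asset_in_simplex[OF l]])
  ultimately have w: "0 < w" by (auto simp: elog_def split: if_splits)
  then show "0 < wealth 1 E (two_asset (lmax n \<omega>)) n \<omega>" unfolding w_def .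
  have m: "0 < m" unfolding m_def by (rule max_type_ratio_pos[OF l])
  have "Max ((\<lambda>j. elog (type_ratio n (lmax n \<omega>) j)) ` {0..n}) = elog m"
    unfolding m_def max_type_ratio_def by (rule Max_elog) (auto intro: type_ratio_nonneg[OF l])
  then have "W_OJ23 E lmax n \<omega> = exp (real_of_ereal (elog w - elog m))"
    unfolding W_OJ23_def log_wealth2_eq[OF v l] type_ratio_def[symmetric] w_def by simp
  also have "\<dots> = w / m" using w m by (simp add: elog_pos exp_diff)
  finally show "W_OJ23 E lmax n \<omega> = wealth 1 E (two_asset (lmax n \<omega>)) n \<omega> / max_type_ratio n (lmax n \<omega>)"
    unfolding w_def m_def .
qed

lemma W_OJ23_le_W_UP:
  assumes v: "valid_outcome 1 E \<omega>" and l: "lmax n \<omega> \<in> {0..1}"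
    and max: "\<And>l. l \<in> {0..1} \<Longrightarrow> log_wealth2 E l n \<omega> \<le> log_wealth2 E (lmax n \<omega>) n \<omega>"
  shows "W_OJ23 E lmax n \<omega> \<le> W_UP 1 E n \<omega>"
proof -
  have "wealth 1 E (two_asset (lmax n \<omega>)) n \<omega> / max_type_ratio n (lmax n \<omega>) \<le> W_UP 1 E n \<omega>"
    using wealth_le_max_type_ratio[OF v l, of n] max_type_ratio_pos[OF l, of n]
    by (simp add: divide_le_eq mult.commute)
  then show ?thesis using W_OJ23_eq(3)[where lmax = lmax, OF assms] by (simp only:)
qed

lemma regret_W_OJ23:
  assumes v: "valid_outcome 1 E \<omega>" and l: "lmax n \<omega> \<in> {0..1}"
    and max: "\<And>l. l \<in> {0..1} \<Longrightarrow> log_wealth2 E l n \<omega> \<le> log_wealth2 E (lmax n \<omega>) n \<omega>"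
  shows "portfolio_regret 1 E (W_OJ23 E lmax) n \<omega> \<le> ereal (ln (regret_factor 1 n))"
proof -
  note eq = W_OJ23_eq[where lmax = lmax, OF assms]
  define w where "w = wealth 1 E (two_asset (lmax n \<omega>)) n \<omega>"
  define m where "m = max_type_ratio n (lmax n \<omega>)"
  have w: "0 < w" using eq(2) unfolding w_def .
  have m: "0 < m" "m \<le> regret_factor 1 n"
    unfolding m_def using max_type_ratio_pos[OF l] max_type_ratio_le[OF l] by blast+
  have W: "W_OJ23 E lmax n \<omega> = w / m" using eq(3) unfolding w_def m_def .
  have "portfolio_regret 1 E (W_OJ23 E lmax) n \<omega> = ereal (ln w - ln (w / m))"
    using portfolio_regret_eq[where W = "W_OJ23 E lmax", OF v, of n "ln w"] W w m(1) eq(1)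
    by (simp add: elog_pos w_def)
  also have "\<dots> = ereal (ln m)" using w m(1) by (simp add: ln_div)
  also have "\<dots> \<le> ereal (ln (regret_factor 1 n))" using m by simp
  finally show ?thesis .
qed


lemma elog_measurable [measurable]: "elog \<in> borel_measurable borel"
  unfolding elog_def by measurable

lemma continuous_on_wealth: "continuous_on S (\<lambda>l. wealth d E l n \<omega>)"
  unfolding wealth_def payoff_def
  by (intro continuous_intros continuous_on_subset[OF continuous_on_product_coordinates]) auto

text \<open>The supremum over the simplex runs over uncountably many portfolios. The wealth is continuous in
  the portfolio for the product topology, so a countable dense subset of the simplex has the same
  supremum.\<close>

lemma best_log_wealth_measurable:
  assumes S: "evalue_setting d \<Omega> F E"
  shows "best_log_wealth d E n \<in> borel_measurable (F n)"
proof -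
  obtain T where T: "countable T" "T \<subseteq> prob_simplex d" "prob_simplex d \<subseteq> closure T"
    using separable by blast
  have eq: "best_log_wealth d E n \<omega> = (SUP l\<in>T. elog (wealth d E l n \<omega>))" if v: "valid_outcome d E \<omega>" for \<omega>
    unfolding best_log_wealth_def
  proof (rule antisym[OF SUP_least SUP_subset_mono[OF T(2) order_refl]])
    fix l assume l: "l \<in> prob_simplex d"
    show "elog (wealth d E l n \<omega>) \<le> (SUP l\<in>T. elog (wealth d E l n \<omega>))"
    proof (rule ccontr)
      assume nle: "\<not> ?thesis"
      define G where "G = (SUP l\<in>T. elog (wealth d E l n \<omega>))"
      have less: "G < elog (wealth d E l n \<omega>)" using nle unfolding G_def by (rule not_le_imp_less)
      \<comment> \<open>The real number corresponding to \<open>G\<close> on the scale of wealth; \<open>G = \<infinity>\<close> cannot occur.\<close>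
      define y where "y = (case G of ereal r \<Rightarrow> exp r | _ \<Rightarrow> 0)"
      have y: "G < elog x \<longleftrightarrow> y < x" if "0 \<le> x" for x
      proof (cases G)
        case (real r)
        show ?thesis
        proof (cases "x = 0")
          case False
          then have "r < ln x \<longleftrightarrow> exp r < x" using that by (subst exp_less_cancel_iff[symmetric]) simp
          then show ?thesis using real False by (simp add: y_def elog_def)
        qed (simp add: elog_def y_def real)
      next
        case PInf
        then show ?thesis using less elog_less_top[of "wealth d E l n \<omega>"] by simp
      next
        case MInf
        then show ?thesis using that by (auto simp: y_def elog_def)
      qed
      have "y < wealth d E l n \<omega>" using less y[OF wealth_nonneg[OF v l]] by blast
      then have "{k. y < wealth d E k n \<omega>} \<inter> closure T \<noteq> {}" using l T(3) by blast
      moreover have "open {k. y < wealth d E k n \<omega>}"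
        by (intro open_Collect_less continuous_on_wealth continuous_on_const)
      ultimately have "{k. y < wealth d E k n \<omega>} \<inter> T \<noteq> {}" by (simp only: open_Int_closure_eq_empty not_False_eq_True)
      then obtain k where "k \<in> T" "y < wealth d E k n \<omega>" by blast
      moreover have "k \<in> prob_simplex d" using T(2) \<open>k \<in> T\<close> by blast
      ultimately have "G < elog (wealth d E k n \<omega>)" using y[OF wealth_nonneg[OF v]] by blast
      moreover have "elog (wealth d E k n \<omega>) \<le> G" unfolding G_def by (rule SUP_upper) fact
      ultimately show False by (simp add: leD)
    qed
  qed
  have "best_log_wealth d E n \<in> borel_measurable (F n) \<longleftrightarrow>
      (\<lambda>\<omega>. SUP l\<in>T. elog (wealth d E l n \<omega>)) \<in> borel_measurable (F n)"
  proof (rule measurable_cong)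
    fix \<omega> assume "\<omega> \<in> space (F n)"
    then have "\<omega> \<in> space \<Omega>" using space_F[OF S] by blast
    then show "best_log_wealth d E n \<omega> = (SUP l\<in>T. elog (wealth d E l n \<omega>))"
      by (intro eq evalue_setting_valid[OF S])
  qed
  moreover have "(\<lambda>\<omega>. SUP l\<in>T. elog (wealth d E l n \<omega>)) \<in> borel_measurable (F n)"
    by (intro borel_measurable_SUP T measurable_compose[OF wealth_measurable[OF S order_refl] elog_measurable])
  ultimately show ?thesis by blast
qed

lemma W_CO96_measurable:
  assumes S: "evalue_setting d \<Omega> F E"
  shows "W_CO96 d E n \<in> borel_measurable (F n)"
proof -
  have "W_CO96 d E n = (\<lambda>\<omega>. exp (real_of_ereal (best_log_wealth d E n \<omega>) - ln (regret_factor d n)))"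
    by (simp add: fun_eq_iff W_CO96_def best_log_wealth_def ln_regret_factor diff_diff_eq add.commute)
  also have "\<dots> \<in> borel_measurable (F n)"
    using best_log_wealth_measurable[OF S] by measurable
  finally show ?thesis .
qed


lemma max_type_ratio_measurable:
  assumes l: "l \<in> borel_measurable M"
  shows "(\<lambda>\<omega>. max_type_ratio n (l \<omega>)) \<in> borel_measurable M"
  unfolding max_type_ratio_def
proof (rule borel_measurable_Max)
  fix j assume "j \<in> {0..n}"
  show "(\<lambda>\<omega>. type_ratio n (l \<omega>) j) \<in> borel_measurable M"
    unfolding type_ratio_def using l by measurable
qed simp

lemma is_maximizerD:
  assumes "is_maximizer \<Omega> F E lmax" "1 \<le> n"
  shows "lmax n \<in> borel_measurable (F n)"
    and "\<omega> \<in> space \<Omega> \<Longrightarrow> lmax n \<omega> \<in> {0..1}"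
    and "\<omega> \<in> space \<Omega> \<Longrightarrow> l \<in> {0..1} \<Longrightarrow> log_wealth2 E l n \<omega> \<le> log_wealth2 E (lmax n \<omega>) n \<omega>"
  using assms unfolding is_maximizer_def by blast+

lemma W_OJ23_measurable:
  assumes S: "evalue_setting 1 \<Omega> F E" and lmax: "is_maximizer \<Omega> F E lmax" and n: "1 \<le> n"
  shows "W_OJ23 E lmax n \<in> borel_measurable (F n)"
proof -
  have eq: "W_OJ23 E lmax n \<omega> =
      (\<Prod>i=1..n. (1 - lmax n \<omega>) * E i \<omega> 0 + lmax n \<omega> * E i \<omega> 1) / max_type_ratio n (lmax n \<omega>)"
    if "\<omega> \<in> space (F n)" for \<omega>
  proof -
    have \<omega>: "\<omega> \<in> space \<Omega>" using that space_F[OF S] by blast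
    have "wealth 1 E (two_asset (lmax n \<omega>)) n \<omega> = (\<Prod>i=1..n. (1 - lmax n \<omega>) * E i \<omega> 0 + lmax n \<omega> * E i \<omega> 1)"
      unfolding wealth_def payoff_def by (simp add: two_asset_def atMost_1)
    then show ?thesis
      using W_OJ23_eq(3)[where lmax = lmax and n = n, OF evalue_setting_valid[OF S \<omega>]
          is_maximizerD(2)[OF lmax n \<omega>] is_maximizerD(3)[OF lmax n \<omega>]] by (simp only:)
  qed
  have "(\<lambda>\<omega>. (\<Prod>i=1..n. (1 - lmax n \<omega>) * E i \<omega> 0 + lmax n \<omega> * E i \<omega> 1) / max_type_ratio n (lmax n \<omega>))
      \<in> borel_measurable (F n)"
    by (intro borel_measurable_divide borel_measurable_prod borel_measurable_add borel_measurable_times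
        borel_measurable_diff borel_measurable_const E_component_measurable[OF S]
        max_type_ratio_measurable is_maximizerD(1)[OF lmax n]) simp_all
  moreover have "W_OJ23 E lmax n \<in> borel_measurable (F n) \<longleftrightarrow>
      (\<lambda>\<omega>. (\<Prod>i=1..n. (1 - lmax n \<omega>) * E i \<omega> 0 + lmax n \<omega> * E i \<omega> 1) / max_type_ratio n (lmax n \<omega>))
        \<in> borel_measurable (F n)"
    by (rule measurable_cong) (rule eq)
  ultimately show ?thesis by blast
qed

lemma e_process_of_le_W_UP:
  assumes S: "evalue_setting d \<Omega> F E"
    and meas: "\<And>n. 1 \<le> n \<Longrightarrow> W n \<in> borel_measurable (F n)"
    and nonneg: "\<And>n \<omega>. 1 \<le> n \<Longrightarrow> \<omega> \<in> space \<Omega> \<Longrightarrow> 0 \<le> W n \<omega>"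
    and le: "\<And>n \<omega>. 1 \<le> n \<Longrightarrow> \<omega> \<in> space \<Omega> \<Longrightarrow> W n \<omega> \<le> W_UP d E n \<omega>"
  shows "e_process \<Omega> F (null_hypothesis d \<Omega> F E) W"
  unfolding e_process_def
proof (intro conjI ballI)
  show "nonneg_adapted \<Omega> F W" unfolding nonneg_adapted_def by (intro allI impI conjI ballI meas nonneg)
  fix P assume P: "P \<in> null_hypothesis d \<Omega> F E"
  have "P \<in> iid_distributions d \<Omega> F E" using P[unfolded null_hypothesis_def mem_Collect_eq] by (rule conjunct1)
  then have space: "space P = space \<Omega>" by (rule iid_distributionsD(3))
  have "AE \<omega> in P. \<forall>n\<ge>1. W n \<omega> \<le> W_UP d E n \<omega>"
    using space by (intro AE_I2 allI impI le) blast+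
  with test_supermartingale_W_UP[OF S P]
  show "\<exists>M. test_supermartingale \<Omega> F P M \<and> (AE \<omega> in P. \<forall>n\<ge>1. W n \<omega> \<le> M n \<omega>)" by blast
qed

lemma logarithmic_regret_intro:
  assumes "\<And>n \<omega>. 1 \<le> n \<Longrightarrow> \<omega> \<in> space \<Omega> \<Longrightarrow> portfolio_regret d E W n \<omega> \<le> ereal (ln (regret_factor d n))"
  shows "logarithmic_regret d \<Omega> E W"
  unfolding logarithmic_regret_def
proof (intro exI conjI allI impI ballI)
  have "(\<lambda>n::nat. ln 2 + real d / 2 * ln (real n + 1)) \<in> O(\<lambda>n. ln (real n))"
  proof (intro sum_in_bigo)
    show "(\<lambda>n::nat. ln 2 :: real) \<in> O(\<lambda>n. ln (real n))"
    proof (rule bigoI[where c = 1])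
      show "eventually (\<lambda>n. norm (ln 2 :: real) \<le> 1 * norm (ln (real n))) sequentially"
        using eventually_ge_at_top[of "2::nat"] by eventually_elim simp
    qed
    have c: "(\<lambda>n::nat. real d / 2) \<in> O(\<lambda>n. 1)" by simp
    have "(\<lambda>n::nat. ln (real n + 1)) \<in> O(\<lambda>n. ln (real n))"
    proof (rule bigoI[where c = 2])
      show "eventually (\<lambda>n. norm (ln (real n + 1)) \<le> 2 * norm (ln (real n))) sequentially"
        using eventually_ge_at_top[of "2::nat"]
      proof eventually_elim
        case (elim n)
        have "2 * real n \<le> real n * real n" using elim by (intro mult_right_mono) simp_all
        moreover have "2 \<le> real n" using elim by simp
        ultimately have "real n + 1 \<le> real n * real n" by linarith
        then have "real n + 1 \<le> (real n)\<^sup>2" by (simp only: power2_eq_square)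
        then have "ln (real n + 1) \<le> ln ((real n)\<^sup>2)" using elim by (subst ln_le_cancel_iff) auto
        also have "\<dots> = 2 * ln (real n)" using elim by (simp add: ln_realpow)
        finally show ?case using elim by simp
      qed
    qed
    from landau_o.big.mult[OF c this]
    show "(\<lambda>n::nat. real d / 2 * ln (real n + 1)) \<in> O(\<lambda>n. ln (real n))" by (simp only: mult_1)
  qed
  then show "(\<lambda>n. ln (regret_factor d n)) \<in> O(\<lambda>n. ln (real n))" by (simp add: ln_regret_factor)
qed (use assms in auto)

lemma logarithmic_imp_sublinear:
  assumes "logarithmic_regret d \<Omega> E W"
  shows "sublinear_regret d \<Omega> E W"
proof -
  obtain r where r: "r \<in> O(\<lambda>n. ln (real n))" "\<forall>n\<ge>1. \<forall>\<omega>\<in>space \<Omega>. portfolio_regret d E W n \<omega> \<le> ereal (r n)"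
    using assms unfolding logarithmic_regret_def by blast
  have "(\<lambda>n::nat. ln (real n)) \<in> o(\<lambda>n. real n)"
    using lim_ln_over_n by (intro smalloI_tendsto) (auto intro: eventually_mono[OF eventually_gt_at_top[of 0]])
  with r(1) have "r \<in> o(\<lambda>n. real n)" by (rule landau_o.big_small_trans)
  with r(2) show ?thesis unfolding sublinear_regret_def by blast
qed

section \<open>The numeraire portfolio\<close>

lemma bounded_coordinates_subsequence:
  fixes f :: "nat \<Rightarrow> nat \<Rightarrow> real"
  assumes "\<And>k j. j < m \<Longrightarrow> f k j \<in> {0..1}"
  shows "\<exists>l r. strict_mono r \<and> (\<forall>j<m. (\<lambda>k. f (r k) j) \<longlonglongrightarrow> l j)"
  using assms
proof (induction m)
  case 0
  show ?case by (intro exI[of _ id] exI[of _ "\<lambda>_. 0"]) (simp add: strict_mono_def)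
next
  case (Suc m)
  have "\<exists>l r. strict_mono r \<and> (\<forall>j<m. (\<lambda>k. f (r k) j) \<longlonglongrightarrow> l j)"
    by (rule Suc.IH) (use Suc.prems less_SucI in blast)
  then obtain l r where r: "strict_mono r" "\<And>j. j < m \<Longrightarrow> (\<lambda>k. f (r k) j) \<longlonglongrightarrow> l j"
    by blast
  have "\<forall>k. f (r k) m \<in> {0..1}" using Suc.prems by simp
  then obtain a s where s: "strict_mono s" "((\<lambda>k. f (r k) m) \<circ> s) \<longlonglongrightarrow> a"
    using seq_compactE[OF compact_imp_seq_compact[OF compact_Icc[of 0 "1::real"]], of "\<lambda>k. f (r k) m"] by blast
  have "(\<lambda>k. f ((r \<circ> s) k) j) \<longlonglongrightarrow> (l(m := a)) j" if "j < Suc m" for j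
  proof (cases "j = m")
    case True
    then show ?thesis using s(2) by (simp add: o_def)
  next
    case False
    then have "j < m" using that by simp
    then show ?thesis using LIMSEQ_subseq_LIMSEQ[OF r(2) s(1)] False by (simp add: o_def)
  qed
  moreover have "strict_mono (r \<circ> s)" by (rule strict_mono_o[OF r(1) s(1)])
  ultimately show ?case by blast
qed

lemma prob_simplex_subsequence:
  fixes f :: "nat \<Rightarrow> nat \<Rightarrow> real"
  assumes f: "\<And>k. f k \<in> prob_simplex d"
  obtains l r where "strict_mono r" "l \<in> prob_simplex d" "\<And>j. j \<le> d \<Longrightarrow> (\<lambda>k. f (r k) j) \<longlonglongrightarrow> l j"
proof -
  have "f k j \<in> {0..1}" if "j < Suc d" for k j using f[of k] that by (auto simp: prob_simplex_def)
  then obtain l r where r: "strict_mono r" "\<And>j. j < Suc d \<Longrightarrow> (\<lambda>k. f (r k) j) \<longlonglongrightarrow> l j"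
    using bounded_coordinates_subsequence[of "Suc d" f] by blast
  define l' where "l' = (\<lambda>j\<in>{..d}. l j)"
  have lim: "(\<lambda>k. f (r k) j) \<longlonglongrightarrow> l' j" if "j \<le> d" for j
    using r(2)[of j] that by (simp add: l'_def)
  have "0 \<le> l' j" if "j \<le> d" for j
    using f that by (intro LIMSEQ_le_const[OF lim[OF that]]) (auto simp: prob_simplex_iff)
  moreover have "(\<Sum>j\<le>d. l' j) = 1"
  proof (rule LIMSEQ_unique)
    show "(\<lambda>k. \<Sum>j\<le>d. f (r k) j) \<longlonglongrightarrow> (\<Sum>j\<le>d. l' j)" by (intro tendsto_sum lim) simp
    have "(\<lambda>k. \<Sum>j\<le>d. f (r k) j) = (\<lambda>_. 1)" using f by (simp add: prob_simplex_iff)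
    then show "(\<lambda>k. \<Sum>j\<le>d. f (r k) j) \<longlonglongrightarrow> 1" by simp
  qed
  ultimately have "l' \<in> prob_simplex d" by (simp add: prob_simplex_iff l'_def)
  then show ?thesis using that[OF r(1) _ lim] by blast
qed

text \<open>The loss \<open>- log t\<close> with its value \<open>\<infinity>\<close> at 0; continuity
  including 0 is what makes the expected loss lower semicontinuous.\<close>

definition neg_log :: "real \<Rightarrow> ennreal" where
  "neg_log t = (if t \<le> 0 then top else ennreal (- ln t))"

lemma neg_log_measurable [measurable]: "neg_log \<in> borel_measurable borel"
  unfolding neg_log_def by measurable

lemma tendsto_neg_log:
  assumes "f \<longlonglongrightarrow> t" "0 \<le> t"
  shows "(\<lambda>k. neg_log (f k)) \<longlonglongrightarrow> neg_log t"
proof (cases "0 < t")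
  case True
  then have ev: "eventually (\<lambda>k. 0 < f k) sequentially" by (rule order_tendstoD(1)[OF assms(1)])
  have "(\<lambda>k. ennreal (- ln (f k))) \<longlonglongrightarrow> ennreal (- ln t)"
    using True assms(1) by (intro tendsto_intros) auto
  moreover have "eventually (\<lambda>k. ennreal (- ln (f k)) = neg_log (f k)) sequentially"
    using ev by eventually_elim (simp add: neg_log_def)
  ultimately have "(\<lambda>k. neg_log (f k)) \<longlonglongrightarrow> ennreal (- ln t)" by (rule Lim_transform_eventually)
  then show ?thesis using True by (simp add: neg_log_def)
next
  case False
  then have t: "t = 0" using assms(2) by simp
  have "(\<lambda>k. neg_log (f k)) \<longlonglongrightarrow> top"
    unfolding tendsto_top_iff_ennreal
  proof (intro allI impI)
    fix c :: real assume "0 \<le> c"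
    have "eventually (\<lambda>k. f k < exp (- c)) sequentially"
      using assms(1) t by (intro order_tendstoD(2)[of f 0]) simp_all
    then show "eventually (\<lambda>k. ennreal c < neg_log (f k)) sequentially"
    proof eventually_elim
      case (elim k)
      show ?case
      proof (cases "f k \<le> 0")
        case False
        then have "ln (f k) < - c" using elim by (simp add: ln_less_cancel_iff[symmetric, of "f k" "exp (- c)"])
        then show ?thesis using False \<open>0 \<le> c\<close> by (simp add: neg_log_def ennreal_less_iff)
      qed (simp add: neg_log_def)
    qed
  qed
  then show ?thesis by (simp add: neg_log_def t)
qed

lemma payoff_measurable [measurable]: "payoff d l \<in> borel_measurable (vec_algebra d)"
  unfolding payoff_def
  by (intro borel_measurable_sum borel_measurable_times borel_measurable_const vec_component_measurable) simp

text \<open>A lower bound uniform in \<open>k\<close> and \<open>y\<close>, needed to apply the Fatou lemma.\<close>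

lemma scaled_ln_ge:
  fixes y :: real
  assumes "0 \<le> y"
  shows "- 2 \<le> (real k + 2) * ln (1 + (y - 1) / (real k + 2))"
proof -
  define n where "n = real k + 2"
  have n: "2 \<le> n" by (simp add: n_def)
  have pos: "0 < 1 - 1 / n" using n by simp
  have "1 - 1 / n \<le> 1 + (y - 1) / n" using n assms by (simp add: diff_divide_distrib)
  then have "ln (1 - 1 / n) \<le> ln (1 + (y - 1) / n)" using pos by simp
  moreover have "- (2 / n) \<le> ln (1 - 1 / n)"
  proof -
    have "- ln (1 - 1 / n) = ln (1 / (1 - 1 / n))" using pos by (subst ln_div) auto
    also have "\<dots> \<le> 1 / (1 - 1 / n) - 1" using pos by (intro ln_le_minus_one) simp
    also have "\<dots> = 1 / (n - 1)" using n by (simp add: divide_simps)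
    also have "\<dots> \<le> 2 / n" using n by (simp add: divide_simps)
    finally show ?thesis by simp
  qed
  ultimately have "n * (- (2 / n)) \<le> n * ln (1 + (y - 1) / n)" using n by (intro mult_left_mono) auto
  moreover have "n * (- (2 / n)) = - 2" using n by simp
  ultimately show ?thesis by (simp only: n_def)
qed

lemma tendsto_scaled_ln:
  fixes c :: real
  shows "(\<lambda>k. (real k + 2) * ln (1 + c / (real k + 2))) \<longlonglongrightarrow> c"
proof -
  have "filterlim (\<lambda>k. real k + 2) at_top sequentially"
    by (rule filterlim_at_top_mono[OF filterlim_real_sequentially]) simp
  then have "(\<lambda>k. (1 + c / (real k + 2)) powr (real k + 2)) \<longlonglongrightarrow> exp c"
    by (rule filterlim_compose[OF tendsto_exp_limit_at_top])
  then have "(\<lambda>k. ln ((1 + c / (real k + 2)) powr (real k + 2))) \<longlonglongrightarrow> ln (exp c)"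
    by (rule tendsto_ln) simp
  then show ?thesis by (simp add: ln_powr)
qed


definition valid_vector :: "nat \<Rightarrow> (nat \<Rightarrow> real) \<Rightarrow> bool" where
  "valid_vector d x \<longleftrightarrow> x 0 = 1 \<and> (\<forall>j\<le>d. 0 \<le> x j)"

text \<open>Dividing by the sum of all components makes the log-loss nonnegative, so that its expectation
  makes sense without any integrability assumption on the law. The division does not change which
  portfolio is optimal.\<close>

definition relative_payoff :: "nat \<Rightarrow> (nat \<Rightarrow> real) \<Rightarrow> (nat \<Rightarrow> real) \<Rightarrow> real" where
  "relative_payoff d l x = payoff d l x / (\<Sum>j\<le>d. x j)"

lemma relative_payoff_measurable [measurable]: "relative_payoff d l \<in> borel_measurable (vec_algebra d)"
  unfolding relative_payoff_def by (intro borel_measurable_divide payoff_measurable vec_sum_measurable)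

lemma total_ge_1: "valid_vector d x \<Longrightarrow> 1 \<le> (\<Sum>j\<le>d. x j)"
  unfolding valid_vector_def sum_atMost_split_0 by (auto intro!: sum_nonneg)

lemma relative_payoff_bounds:
  assumes "valid_vector d x" "l \<in> prob_simplex d"
  shows "0 \<le> relative_payoff d l x" "relative_payoff d l x \<le> 1"
proof -
  have "0 \<le> payoff d l x"
    unfolding payoff_def using assms unfolding prob_simplex_iff valid_vector_def
    by (intro sum_nonneg mult_nonneg_nonneg) simp_all
  then show "0 \<le> relative_payoff d l x" using total_ge_1[OF assms(1)] by (simp add: relative_payoff_def)
  have "payoff d l x \<le> (\<Sum>j\<le>d. x j)"
    unfolding payoff_def
  proof (rule sum_mono)
    fix j assume "j \<in> {..d}"
    then have "l j \<le> 1" "0 \<le> x j" using assms by (auto simp: prob_simplex_def valid_vector_def)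
    then show "l j * x j \<le> x j" using mult_right_mono[of "l j" 1 "x j"] by simp
  qed
  then show "relative_payoff d l x \<le> 1" using total_ge_1[OF assms(1)] by (simp add: relative_payoff_def)
qed

text \<open>A minimizing sequence has a convergent subsequence, and by the Fatou lemma the expected loss is
  lower semicontinuous. The minimum is finite since the uniform portfolio has constant loss
  \<open>ln (d + 1)\<close>.\<close>

lemma log_optimal_exists:
  assumes nu: "prob_space \<nu>" and sets: "sets \<nu> = sets (vec_algebra d)" and valid: "AE x in \<nu>. valid_vector d x"
  obtains l where "l \<in> prob_simplex d"
    "(\<integral>\<^sup>+x. neg_log (relative_payoff d l x) \<partial>\<nu>) < top"
    "\<And>l'. l' \<in> prob_simplex d \<Longrightarrow>
      (\<integral>\<^sup>+x. neg_log (relative_payoff d l x) \<partial>\<nu>) \<le> (\<integral>\<^sup>+x. neg_log (relative_payoff d l' x) \<partial>\<nu>)"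
proof -
  interpret nu: prob_space \<nu> by fact
  have meas: "(\<lambda>x. neg_log (relative_payoff d l x)) \<in> borel_measurable \<nu>" for l
    by (rule measurable_compose[OF _ neg_log_measurable])
       (simp only: measurable_cong_sets[OF sets refl] relative_payoff_measurable)
  define \<psi> where "\<psi> l = (\<integral>\<^sup>+x. neg_log (relative_payoff d l x) \<partial>\<nu>)" for l
  define m where "m = (INF l\<in>prob_simplex d. \<psi> l)"
  \<comment> \<open>The uniform portfolio has finite expected loss.\<close>
  define u where "u = (\<lambda>j\<in>{..d}. 1 / (real d + 1))"
  have u: "u \<in> prob_simplex d" by (simp add: prob_simplex_iff u_def)
  have "\<psi> u \<le> (\<integral>\<^sup>+x. ennreal (ln (real d + 1)) \<partial>\<nu>)"
    unfolding \<psi>_def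
  proof (rule nn_integral_mono_AE)
    show "AE x in \<nu>. neg_log (relative_payoff d u x) \<le> ennreal (ln (real d + 1))"
      using valid
    proof eventually_elim
      case (elim x)
      have "payoff d u x = (\<Sum>j\<le>d. x j) / (real d + 1)"
        unfolding payoff_def sum_divide_distrib by (intro sum.cong refl) (simp add: u_def)
      then have "relative_payoff d u x = 1 / (real d + 1)"
        using total_ge_1[OF elim] by (simp add: relative_payoff_def)
      then show ?case by (simp add: neg_log_def ln_div)
    qed
  qed
  also have "\<dots> < top" by (simp add: nu.emeasure_space_1)
  finally have "\<psi> u < top" .
  moreover have "m \<le> \<psi> u" unfolding m_def by (rule INF_lower[OF u])
  ultimately have m: "m < top" by simp
  have ex: "\<exists>l. l \<in> prob_simplex d \<and> \<psi> l < m + ennreal (1 / (real k + 1))" for k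
  proof -
    have "m < m + ennreal (1 / (real k + 1))"
      using m by (cases m) (auto simp: ennreal_plus[symmetric] ennreal_less_iff simp del: ennreal_plus)
    then show ?thesis unfolding m_def INF_less_iff by blast
  qed
  obtain f where "\<forall>k. f k \<in> prob_simplex d \<and> \<psi> (f k) < m + ennreal (1 / (real k + 1))"
    using choice[OF allI[OF ex]] by (rule exE)
  then have f: "f k \<in> prob_simplex d" "\<psi> (f k) < m + ennreal (1 / (real k + 1))" for k by simp_all
  obtain l r where r: "strict_mono r" and l: "l \<in> prob_simplex d"
    and lim: "\<And>j. j \<le> d \<Longrightarrow> (\<lambda>k. f (r k) j) \<longlonglongrightarrow> l j"
    by (rule prob_simplex_subsequence[where f = f, OF f(1)]) (rule that)
  have "\<psi> l \<le> (\<integral>\<^sup>+x. liminf (\<lambda>k. neg_log (relative_payoff d (f (r k)) x)) \<partial>\<nu>)"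
    unfolding \<psi>_def
  proof (rule nn_integral_mono_AE)
    show "AE x in \<nu>. neg_log (relative_payoff d l x) \<le> liminf (\<lambda>k. neg_log (relative_payoff d (f (r k)) x))"
      using valid
    proof eventually_elim
      case (elim x)
      have "(\<lambda>k. relative_payoff d (f (r k)) x) \<longlonglongrightarrow> relative_payoff d l x"
        unfolding relative_payoff_def payoff_def
      proof (intro tendsto_divide tendsto_sum tendsto_mult tendsto_const)
        show "(\<lambda>k. f (r k) j) \<longlonglongrightarrow> l j" if "j \<in> {..d}" for j using that by (intro lim) simp
        show "(\<Sum>j\<le>d. x j) \<noteq> 0" using total_ge_1[OF elim] by linarith
      qed
      then have "(\<lambda>k. neg_log (relative_payoff d (f (r k)) x)) \<longlonglongrightarrow> neg_log (relative_payoff d l x)"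
        by (rule tendsto_neg_log) (rule relative_payoff_bounds(1)[OF elim l])
      then show ?case by (simp add: lim_imp_Liminf)
    qed
  qed
  also have "\<dots> \<le> liminf (\<lambda>k. \<psi> (f (r k)))"
    unfolding \<psi>_def by (rule nn_integral_liminf) (rule meas)
  also have "\<dots> \<le> liminf (\<lambda>k. m + ennreal (1 / (real (r k) + 1)))"
    by (intro Liminf_mono always_eventually allI less_imp_le f)
  also have "\<dots> = m"
  proof -
    have "(\<lambda>k. 1 / (real k + 1)) \<longlonglongrightarrow> 0"
      using LIMSEQ_inverse_real_of_nat by (simp add: inverse_eq_divide add.commute)
    then have "(\<lambda>k. ennreal (1 / (real (r k) + 1))) \<longlonglongrightarrow> ennreal 0"
      using LIMSEQ_subseq_LIMSEQ[OF _ r, of "\<lambda>k. 1 / (real k + 1)" 0]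
      by (intro tendsto_ennrealI) (simp add: o_def)
    then have "(\<lambda>k. m + ennreal (1 / (real (r k) + 1))) \<longlonglongrightarrow> m + ennreal 0"
      by (intro tendsto_add tendsto_const)
    then show ?thesis by (simp add: lim_imp_Liminf)
  qed
  finally have \<psi>l: "\<psi> l \<le> m" .
  show ?thesis
  proof (rule that[OF l])
    show "(\<integral>\<^sup>+x. neg_log (relative_payoff d l x) \<partial>\<nu>) < top"
      using \<psi>l m unfolding \<psi>_def by (rule le_less_trans)
    fix l' assume l': "l' \<in> prob_simplex d"
    have "m \<le> \<psi> l'" unfolding m_def by (rule INF_lower[OF l'])
    with \<psi>l show "(\<integral>\<^sup>+x. neg_log (relative_payoff d l x) \<partial>\<nu>) \<le> (\<integral>\<^sup>+x. neg_log (relative_payoff d l' x) \<partial>\<nu>)"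
      unfolding \<psi>_def by (rule order_trans)
  qed
qed

text \<open>First-order condition. With \<open>n = k + 2\<close>, moving the fraction \<open>1 / n\<close>
  of the capital from the optimal portfolio to asset \<open>j\<close> does not decrease the
  expected loss, which says that \<open>n ln (1 + (R - 1) / n)\<close> has mean at most 0 for
  \<open>R = x j / payoff d l x\<close>. These functions converge to \<open>R - 1\<close>. Adding
  2 makes them nonnegative, so the Fatou lemma gives \<open>E[R + 1] \<le> 2\<close>.\<close>

lemma numeraire_exists:
  assumes nu: "prob_space \<nu>" and sets: "sets \<nu> = sets (vec_algebra d)" and valid: "AE x in \<nu>. valid_vector d x"
  obtains l where "l \<in> prob_simplex d" "AE x in \<nu>. 0 < payoff d l x"
    "\<And>j. j \<le> d \<Longrightarrow> (\<integral>\<^sup>+x. ennreal (x j / payoff d l x) \<partial>\<nu>) \<le> 1"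
proof -
  interpret nu: prob_space \<nu> by fact
  have meas: "(\<lambda>x. neg_log (relative_payoff d l x)) \<in> borel_measurable \<nu>" for l
    by (rule measurable_compose[OF _ neg_log_measurable])
       (simp only: measurable_cong_sets[OF sets refl] relative_payoff_measurable)
  obtain l where l: "l \<in> prob_simplex d"
    and fin: "(\<integral>\<^sup>+x. neg_log (relative_payoff d l x) \<partial>\<nu>) < top"
    and opt: "\<And>l'. l' \<in> prob_simplex d \<Longrightarrow>
      (\<integral>\<^sup>+x. neg_log (relative_payoff d l x) \<partial>\<nu>) \<le> (\<integral>\<^sup>+x. neg_log (relative_payoff d l' x) \<partial>\<nu>)"
    by (rule log_optimal_exists[OF nu sets valid]) (rule that)
  have "AE x in \<nu>. neg_log (relative_payoff d l x) \<noteq> \<infinity>"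
    using fin by (intro nn_integral_PInf_AE[OF meas]) auto
  then have pos: "AE x in \<nu>. 0 < payoff d l x"
    using valid
  proof eventually_elim
    case (elim x)
    then have "0 < relative_payoff d l x" by (simp add: neg_log_def split: if_splits)
    then show ?case using total_ge_1[OF elim(2)] by (simp add: relative_payoff_def zero_less_divide_iff)
  qed
  have "(\<integral>\<^sup>+x. ennreal (x j / payoff d l x) \<partial>\<nu>) \<le> 1" if j: "j \<le> d" for j
  proof -
    note jm = vec_component_measurable[OF j]
    define R where "R x = x j / payoff d l x" for x
    have R: "R \<in> borel_measurable \<nu>"
      unfolding R_def measurable_cong_sets[OF sets refl]
      by (intro borel_measurable_divide jm payoff_measurable)
    define g where "g k x = (real k + 2) * ln (1 + (R x - 1) / (real k + 2)) + 2" for k x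
    have g: "(\<lambda>x. ennreal (g k x)) \<in> borel_measurable \<nu>" for k unfolding g_def using R by measurable
    have step: "(\<integral>\<^sup>+x. ennreal (g k x) \<partial>\<nu>) \<le> 2" for k
    proof -
      define n where "n = real k + 2"
      have n: "2 \<le> n" by (simp add: n_def)
      define l' where "l' = (\<lambda>i\<in>{..d}. (1 - 1 / n) * l i + (1 / n) * vertex d j i)"
      have "(\<Sum>i\<le>d. l' i) = (1 - 1 / n) * (\<Sum>i\<le>d. l i) + (1 / n) * (\<Sum>i\<le>d. vertex d j i)"
        by (simp only: l'_def sum.distrib sum_distrib_left restrict_apply' cong: sum.cong)
      also have "\<dots> = 1"
        using l vertex_in_simplex[OF j] by (simp add: prob_simplex_iff)
      finally have sum1: "(\<Sum>i\<le>d. l' i) = 1" .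
      have "0 \<le> l' i" if "i \<le> d" for i
      proof -
        have "0 \<le> l i" "0 \<le> vertex d j i" using l vertex_in_simplex[OF j] that by (simp_all add: prob_simplex_iff)
        then show ?thesis using n that by (simp add: l'_def)
      qed
      then have l': "l' \<in> prob_simplex d"
        using sum1 by (simp add: prob_simplex_iff l'_def)
      have pay: "payoff d l' x = (1 - 1 / n) * payoff d l x + (1 / n) * x j" for x
      proof -
        have "payoff d l' x = (\<Sum>i\<le>d. (1 - 1 / n) * (l i * x i) + (1 / n) * (vertex d j i * x i))"
          unfolding payoff_def by (intro sum.cong refl) (simp add: l'_def algebra_simps)
        also have "\<dots> = (1 - 1 / n) * payoff d l x + (1 / n) * payoff d (vertex d j) x"
          by (simp only: sum.distrib sum_distrib_left payoff_def)
        finally show ?thesis by (simp only: payoff_vertex[OF j])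
      qed
      define A where "A = (\<integral>\<^sup>+x. neg_log (relative_payoff d l x) \<partial>\<nu>)"
      define B where "B = (\<integral>\<^sup>+x. neg_log (relative_payoff d l' x) \<partial>\<nu>)"
      \<comment> \<open>The logarithm of the payoff of \<open>l'\<close> is that of \<open>l\<close> plus \<open>ln (1 + (R - 1) / n)\<close>.
         Written additively, the identity is meaningful for nonnegative integrals.\<close>
      have gkey: "(\<integral>\<^sup>+x. ennreal (g k x) \<partial>\<nu>) + ennreal n * B = 2 + ennreal n * A"
      proof -
        have "(\<integral>\<^sup>+x. ennreal (g k x) \<partial>\<nu>) + ennreal n * B =
            (\<integral>\<^sup>+x. ennreal (g k x) + ennreal n * neg_log (relative_payoff d l' x) \<partial>\<nu>)"
          unfolding B_def
          by (subst nn_integral_add[OF g borel_measurable_times_ennreal[OF borel_measurable_const meas]])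
             (simp only: nn_integral_cmult[OF meas])
        also have "\<dots> = (\<integral>\<^sup>+x. 2 + ennreal n * neg_log (relative_payoff d l x) \<partial>\<nu>)"
        proof (rule nn_integral_cong_AE)
          show "AE x in \<nu>. ennreal (g k x) + ennreal n * neg_log (relative_payoff d l' x) =
              2 + ennreal n * neg_log (relative_payoff d l x)"
            using valid pos
          proof eventually_elim
            case (elim x)
            note S = total_ge_1[OF elim(1)]
            have xj: "0 \<le> x j" using elim(1) j by (simp add: valid_vector_def)
            define a where "a = relative_payoff d l x"
            define b where "b = relative_payoff d l' x"
            define q where "q = 1 + (R x - 1) / n"
            have a: "0 < a" "a \<le> 1"
              using elim S relative_payoff_bounds[OF elim(1) l] by (auto simp: a_def relative_payoff_def)
            have "payoff d l' x = payoff d l x * q"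
              using elim(2) n by (simp add: pay R_def q_def field_simps)
            then have b: "b = a * q" by (simp add: a_def b_def relative_payoff_def)
            have "0 < 1 - 1 / n" using n by simp
            also have "\<dots> \<le> q"
              using n xj elim(2) by (simp add: q_def R_def diff_divide_distrib)
            finally have q: "0 < q" .
            have b1: "0 < b" "b \<le> 1"
              using a q relative_payoff_bounds[OF elim(1) l'] unfolding b_def[symmetric] by (simp_all add: b)
            have "ln b = ln a + ln q" unfolding b using a q by (simp add: ln_mult)
            then have "g k x + n * - ln b = 2 + n * - ln a"
              by (simp add: g_def n_def[symmetric] q_def[symmetric] algebra_simps)
            moreover have "0 \<le> g k x" using scaled_ln_ge[of "R x" k] xj elim(2) by (simp add: g_def R_def)
            moreover have "0 \<le> n * - ln b" "0 \<le> n * - ln a" using n a b1 by (simp_all add: mult_nonneg_nonpos)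
            ultimately have "ennreal (g k x) + ennreal (n * - ln b) = ennreal 2 + ennreal (n * - ln a)"
              using ennreal_plus[of "g k x" "n * - ln b"] ennreal_plus[of 2 "n * - ln a"] by simp
            then show ?case
              using a(1) b1(1) n unfolding a_def[symmetric] b_def[symmetric]
              by (simp add: neg_log_def ennreal_mult'[symmetric])
          qed
        qed
        also have "\<dots> = 2 + ennreal n * A"
          unfolding A_def
          by (subst nn_integral_add[OF borel_measurable_const borel_measurable_times_ennreal[OF borel_measurable_const meas]])
             (simp add: nn_integral_cmult[OF meas] nu.emeasure_space_1)
        finally show ?thesis .
      qed
      have "A \<le> B" unfolding A_def B_def by (rule opt[OF l'])
      then have "(\<integral>\<^sup>+x. ennreal (g k x) \<partial>\<nu>) + ennreal n * B \<le> 2 + ennreal n * B"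
        unfolding gkey by (intro add_left_mono mult_left_mono) auto
      moreover have "ennreal n * B \<noteq> top"
      proof
        assume "ennreal n * B = top"
        then have "2 + ennreal n * A = top" using gkey by simp
        then show False using fin unfolding A_def[symmetric] by (simp add: ennreal_mult_eq_top_iff)
      qed
      ultimately show ?thesis
        unfolding add.commute[of _ "ennreal n * B"] ennreal_add_left_cancel_le infinity_ennreal_def by blast
    qed
    have "(\<integral>\<^sup>+x. ennreal (R x) \<partial>\<nu>) + 1 = (\<integral>\<^sup>+x. ennreal (R x) + 1 \<partial>\<nu>)"
      by (subst nn_integral_add[OF measurable_compose[OF R measurable_ennreal] borel_measurable_const])
         (simp add: nu.emeasure_space_1)
    also have "\<dots> \<le> (\<integral>\<^sup>+x. liminf (\<lambda>k. ennreal (g k x)) \<partial>\<nu>)"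
    proof (rule nn_integral_mono_AE)
      show "AE x in \<nu>. ennreal (R x) + 1 \<le> liminf (\<lambda>k. ennreal (g k x))"
        using valid pos
      proof eventually_elim
        case (elim x)
        have "0 \<le> R x" using elim j by (simp add: R_def valid_vector_def)
        have "(\<lambda>k. g k x) \<longlonglongrightarrow> (R x - 1) + 2"
          unfolding g_def by (intro tendsto_add tendsto_scaled_ln tendsto_const)
        then have "(\<lambda>k. ennreal (g k x)) \<longlonglongrightarrow> ennreal ((R x - 1) + 2)" by (rule tendsto_ennrealI)
        then have "liminf (\<lambda>k. ennreal (g k x)) = ennreal ((R x - 1) + 2)" by (simp add: lim_imp_Liminf)
        also have "\<dots> = ennreal (R x) + 1" using ennreal_plus[OF \<open>0 \<le> R x\<close>, of 1] by (simp add: add.commute)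
        finally show ?case by simp
      qed
    qed
    also have "\<dots> \<le> liminf (\<lambda>k. \<integral>\<^sup>+x. ennreal (g k x) \<partial>\<nu>)" by (rule nn_integral_liminf) (rule g)
    also have "\<dots> \<le> liminf (\<lambda>k::nat. 2)" by (intro Liminf_mono always_eventually allI step)
    also have "\<dots> = 1 + 1" by (simp add: Liminf_const)
    finally have "1 + (\<integral>\<^sup>+x. ennreal (R x) \<partial>\<nu>) \<le> 1 + 1" by (subst add.commute)
    then have "(\<integral>\<^sup>+x. ennreal (R x) \<partial>\<nu>) \<le> 1"
      unfolding ennreal_add_left_cancel_le by (elim disjE) simp_all
    then show ?thesis unfolding R_def .
  qed
  then show ?thesis by (rule that[OF l pos])
qed

section \<open>Domination of an alternative by a null distribution\<close>

lemma nn_integral_mono_subalgebra: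
  assumes M: "subalgebra M G" and N: "subalgebra N G"
    and le: "\<And>A. A \<in> sets G \<Longrightarrow> emeasure M A \<le> emeasure N A"
    and f: "f \<in> borel_measurable G"
  shows "(\<integral>\<^sup>+x. f x \<partial>M) \<le> (\<integral>\<^sup>+x. f x \<partial>N)"
proof -
  have sets: "sets (restr_to_subalg M G) = sets (restr_to_subalg N G)"
    by (simp add: sets_restr_to_subalg[OF M] sets_restr_to_subalg[OF N])
  have "restr_to_subalg M G \<le> restr_to_subalg N G"
    unfolding le_measure[OF sets]
    using le by (simp add: emeasure_restr_to_subalg[OF M] emeasure_restr_to_subalg[OF N] sets_restr_to_subalg[OF M])
  then have "(\<integral>\<^sup>+x. f x \<partial>restr_to_subalg M G) \<le> (\<integral>\<^sup>+x. f x \<partial>restr_to_subalg N G)"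
    by (rule nn_integral_mono_measure[OF sets])
  then show ?thesis
    unfolding nn_integral_subalgebra2[OF M f] nn_integral_subalgebra2[OF N f] .
qed

text \<open>The one-coordinate inequality is applied to the innermost integral; the remaining coordinates
  follow by induction.\<close>

lemma nn_integral_PiM_mono:
  fixes w :: "'b \<Rightarrow> ennreal"
  assumes \<nu>: "sigma_finite_measure \<nu>" and p: "sigma_finite_measure p" and sets: "sets \<nu> = sets p"
    and w: "w \<in> borel_measurable p"
    and le: "\<And>h. h \<in> borel_measurable p \<Longrightarrow> (\<integral>\<^sup>+y. w y * h y \<partial>\<nu>) \<le> (\<integral>\<^sup>+y. h y \<partial>p)"
    and I: "finite I" and f: "f \<in> borel_measurable (Pi\<^sub>M I (\<lambda>_. p))"
  shows "(\<integral>\<^sup>+x. (\<Prod>i\<in>I. w (x i)) * f x \<partial>Pi\<^sub>M I (\<lambda>_. \<nu>)) \<le> (\<integral>\<^sup>+x. f x \<partial>Pi\<^sub>M I (\<lambda>_. p))"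
  using I f
proof (induction I arbitrary: f)
  case empty
  then show ?case by (simp add: PiM_empty nn_integral_count_space_finite)
next
  case (insert i I)
  interpret \<nu>: product_sigma_finite "\<lambda>_. \<nu>" by (simp add: product_sigma_finite_def \<nu>)
  interpret p: product_sigma_finite "\<lambda>_. p" by (simp add: product_sigma_finite_def p)
  have setsP: "sets (Pi\<^sub>M J (\<lambda>_. \<nu>)) = sets (Pi\<^sub>M J (\<lambda>_. p))" for J :: "'a set"
    by (intro sets_PiM_cong refl sets)
  have W: "(\<lambda>x. \<Prod>j\<in>J. w (x j)) \<in> borel_measurable (Pi\<^sub>M J (\<lambda>_. p))" for J :: "'a set"
  proof (rule borel_measurable_prod_ennreal)
    fix j assume "j \<in> J"
    then have "(\<lambda>x. x j) \<in> measurable (Pi\<^sub>M J (\<lambda>_. p)) p" by (rule measurable_component_singleton)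
    from this w show "(\<lambda>x. w (x j)) \<in> borel_measurable (Pi\<^sub>M J (\<lambda>_. p))" by (rule measurable_compose)
  qed
  have upd: "(\<lambda>x. \<integral>\<^sup>+y. f (x(i := y)) \<partial>p) \<in> borel_measurable (Pi\<^sub>M I (\<lambda>_. p))"
  proof (rule sigma_finite_measure.borel_measurable_nn_integral[OF p])
    have "(\<lambda>z. f ((fst z)(i := snd z))) \<in> borel_measurable (Pi\<^sub>M I (\<lambda>_. p) \<Otimes>\<^sub>M p)"
      using measurable_compose[OF measurable_add_dim[of i I "\<lambda>_. p"] insert.prems] by (simp only: split_beta')
    then show "(\<lambda>(x, y). f (x(i := y))) \<in> borel_measurable (Pi\<^sub>M I (\<lambda>_. p) \<Otimes>\<^sub>M p)"
      by (simp only: split_beta')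
  qed
  have "(\<integral>\<^sup>+x. (\<Prod>j\<in>insert i I. w (x j)) * f x \<partial>Pi\<^sub>M (insert i I) (\<lambda>_. \<nu>)) =
      (\<integral>\<^sup>+x. (\<integral>\<^sup>+y. (\<Prod>j\<in>insert i I. w ((x(i := y)) j)) * f (x(i := y)) \<partial>\<nu>) \<partial>Pi\<^sub>M I (\<lambda>_. \<nu>))"
  proof (rule \<nu>.product_nn_integral_insert[OF insert.hyps])
    show "(\<lambda>x. (\<Prod>j\<in>insert i I. w (x j)) * f x) \<in> borel_measurable (Pi\<^sub>M (insert i I) (\<lambda>_. \<nu>))"
      unfolding measurable_cong_sets[OF setsP refl] by (rule borel_measurable_times_ennreal[OF W insert.prems])
  qed
  also have "\<dots> \<le> (\<integral>\<^sup>+x. (\<Prod>j\<in>I. w (x j)) * (\<integral>\<^sup>+y. f (x(i := y)) \<partial>p) \<partial>Pi\<^sub>M I (\<lambda>_. \<nu>))"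
  proof (rule nn_integral_mono)
    fix x assume x: "x \<in> space (Pi\<^sub>M I (\<lambda>_. \<nu>))"
    then have xp: "x \<in> space (Pi\<^sub>M I (\<lambda>_. p))" using sets_eq_imp_space_eq[OF setsP] by blast
    have fx: "(\<lambda>y. f (x(i := y))) \<in> borel_measurable p"
      by (rule measurable_compose[OF measurable_component_update[OF xp insert.hyps(2)] insert.prems])
    have "(\<integral>\<^sup>+y. (\<Prod>j\<in>insert i I. w ((x(i := y)) j)) * f (x(i := y)) \<partial>\<nu>) =
        (\<integral>\<^sup>+y. (\<Prod>j\<in>I. w (x j)) * (w y * f (x(i := y))) \<partial>\<nu>)"
    proof (intro nn_integral_cong)
      fix y
      have "(\<Prod>j\<in>I. w ((x(i := y)) j)) = (\<Prod>j\<in>I. w (x j))"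
        using insert.hyps(2) by (intro prod.cong refl) auto
      then show "(\<Prod>j\<in>insert i I. w ((x(i := y)) j)) * f (x(i := y)) = (\<Prod>j\<in>I. w (x j)) * (w y * f (x(i := y)))"
        unfolding prod.insert[OF insert.hyps] by (simp only: fun_upd_same mult_ac)
    qed
    also have "\<dots> = (\<Prod>j\<in>I. w (x j)) * (\<integral>\<^sup>+y. w y * f (x(i := y)) \<partial>\<nu>)"
      by (rule nn_integral_cmult)
         (simp only: measurable_cong_sets[OF sets refl], rule borel_measurable_times_ennreal[OF w fx])
    also have "\<dots> \<le> (\<Prod>j\<in>I. w (x j)) * (\<integral>\<^sup>+y. f (x(i := y)) \<partial>p)"
      by (intro mult_left_mono le fx) simp
    finally show "(\<integral>\<^sup>+y. (\<Prod>j\<in>insert i I. w ((x(i := y)) j)) * f (x(i := y)) \<partial>\<nu>) \<le>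
        (\<Prod>j\<in>I. w (x j)) * (\<integral>\<^sup>+y. f (x(i := y)) \<partial>p)" .
  qed
  also have "\<dots> \<le> (\<integral>\<^sup>+x. (\<integral>\<^sup>+y. f (x(i := y)) \<partial>p) \<partial>Pi\<^sub>M I (\<lambda>_. p))"
    by (rule insert.IH[OF upd])
  also have "\<dots> = (\<integral>\<^sup>+x. f x \<partial>Pi\<^sub>M (insert i I) (\<lambda>_. p))"
    by (rule p.product_nn_integral_insert[OF insert.hyps insert.prems, symmetric])
  finally show ?case .
qed

text \<open>The law is realized as the image of a measure on \<open>\<nu> \<otimes> bool\<close>: on the
  \<open>True\<close> copy it has density \<open>w\<close>, and the \<open>False\<close> copy,
  weighted by the missing mass, is collapsed to the point \<open>e\<close>.\<close>

lemma completed_law_exists: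
  fixes w :: "'b \<Rightarrow> ennreal"
  assumes \<nu>: "prob_space \<nu>" and w: "w \<in> borel_measurable \<nu>" and mass: "(\<integral>\<^sup>+x. w x \<partial>\<nu>) \<le> 1" and e: "e \<in> space \<nu>"
  obtains p where "prob_space p" "sets p = sets \<nu>"
    "\<And>h. h \<in> borel_measurable \<nu> \<Longrightarrow>
      (\<integral>\<^sup>+x. h x \<partial>p) = (\<integral>\<^sup>+x. w x * h x \<partial>\<nu>) + (1 - (\<integral>\<^sup>+x. w x \<partial>\<nu>)) * h e"
proof -
  interpret \<nu>: prob_space \<nu> by fact
  define B :: "bool measure" where "B = count_space UNIV"
  interpret B: finite_measure B unfolding B_def by (rule finite_measure_count_space) simp
  define m where "m = 1 - (\<integral>\<^sup>+x. w x \<partial>\<nu>)"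
  \<comment> \<open>The second coordinate selects the copy; \<open>m\<close> is the missing mass.\<close>
  define v where "v z = (if snd z then w (fst z) else m)" for z :: "'b \<times> bool"
  define T where "T z = (if snd z then fst z else e)" for z :: "'b \<times> bool"
  have [measurable]: "w \<in> borel_measurable \<nu>" by (rule w)
  have v: "v \<in> borel_measurable (\<nu> \<Otimes>\<^sub>M B)" unfolding v_def B_def by measurable
  have T: "T \<in> measurable (\<nu> \<Otimes>\<^sub>M B) \<nu>" unfolding T_def B_def using e by measurable
  define p where "p = distr (density (\<nu> \<Otimes>\<^sub>M B) v) \<nu> T"
  have int: "(\<integral>\<^sup>+x. h x \<partial>p) = (\<integral>\<^sup>+x. w x * h x \<partial>\<nu>) + m * h e" if h: "h \<in> borel_measurable \<nu>" for h
  proof -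
    have hT: "(\<lambda>z. h (T z)) \<in> borel_measurable (\<nu> \<Otimes>\<^sub>M B)" by (rule measurable_compose[OF T h])
    have "(\<integral>\<^sup>+x. h x \<partial>p) = (\<integral>\<^sup>+z. h (T z) \<partial>density (\<nu> \<Otimes>\<^sub>M B) v)"
      unfolding p_def using T h by (subst nn_integral_distr) simp_all
    also have "\<dots> = (\<integral>\<^sup>+z. v z * h (T z) \<partial>(\<nu> \<Otimes>\<^sub>M B))" by (rule nn_integral_density[OF v hT])
    also have "\<dots> = (\<integral>\<^sup>+x. \<integral>\<^sup>+b. v (x, b) * h (T (x, b)) \<partial>B \<partial>\<nu>)"
      by (rule B.nn_integral_fst[symmetric]) (rule borel_measurable_times_ennreal[OF v hT])
    also have "\<dots> = (\<integral>\<^sup>+x. w x * h x + m * h e \<partial>\<nu>)"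
      unfolding B_def by (intro nn_integral_cong) (simp add: nn_integral_count_space_finite UNIV_bool v_def T_def add.commute)
    also have "\<dots> = (\<integral>\<^sup>+x. w x * h x \<partial>\<nu>) + m * h e"
      by (subst nn_integral_add[OF borel_measurable_times_ennreal[OF w h] borel_measurable_const])
         (simp add: \<nu>.emeasure_space_1)
    finally show ?thesis .
  qed
  have sets: "sets p = sets \<nu>" by (simp add: p_def)
  have "emeasure p (space p) = (\<integral>\<^sup>+x. 1 \<partial>p)" by simp
  also have "\<dots> = (\<integral>\<^sup>+x. w x \<partial>\<nu>) + m" using int[of "\<lambda>_. 1"] by simp
  also have "\<dots> = 1" unfolding m_def using mass by (simp add: add.commute diff_add_cancel_ennreal)
  finally have "prob_space p" by (rule prob_spaceI)
  then show ?thesis using sets int unfolding m_def by (rule that)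
qed


definition observations :: "(nat \<Rightarrow> 'a \<Rightarrow> nat \<Rightarrow> real) \<Rightarrow> nat \<Rightarrow> 'a \<Rightarrow> nat \<Rightarrow> nat \<Rightarrow> real" where
  "observations E n \<omega> = (\<lambda>i\<in>{1..n}. E i \<omega>)"

lemma observations_measurable:
  assumes "\<And>i. 1 \<le> i \<Longrightarrow> i \<le> n \<Longrightarrow> E i \<in> measurable M (vec_algebra d)"
  shows "observations E n \<in> measurable M (Pi\<^sub>M {1..n} (\<lambda>_. vec_algebra d))"
  unfolding observations_def by (intro measurable_restrict assms) auto

lemma space_observed_algebra: "space (observed_algebra d \<Omega> E n) = space \<Omega>"
  unfolding observed_algebra_def by (rule space_measure_of) auto

lemma E_measurable_observed:
  assumes S: "evalue_setting d \<Omega> F E" and i: "1 \<le> i" "i \<le> n"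
  shows "E i \<in> measurable (observed_algebra d \<Omega> E n) (vec_algebra d)"
proof (rule measurableI)
  fix \<omega> assume "\<omega> \<in> space (observed_algebra d \<Omega> E n)"
  then have "\<omega> \<in> space (F n)" by (simp only: space_observed_algebra space_F[OF S])
  then show "E i \<omega> \<in> space (vec_algebra d)" by (rule measurable_space[OF E_measurable[OF S i]])
next
  fix B assume "B \<in> sets (vec_algebra d)"
  then have "E i -` B \<inter> space \<Omega> \<in> (\<Union>i\<in>{1..n}. {E i -` B \<inter> space \<Omega> |B. B \<in> sets (vec_algebra d)})"
    using i by (intro UN_I[of i]) auto
  then show "E i -` B \<inter> space (observed_algebra d \<Omega> E n) \<in> sets (observed_algebra d \<Omega> E n)"
    unfolding space_observed_algebra unfolding observed_algebra_def by (intro in_measure_of) auto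
qed

lemma subalgebra_observed:
  assumes S: "evalue_setting d \<Omega> F E"
  shows "subalgebra (F n) (observed_algebra d \<Omega> E n)"
  unfolding subalgebra_def
proof (intro conjI)
  show "space (observed_algebra d \<Omega> E n) = space (F n)" by (simp only: space_observed_algebra space_F[OF S])
  have gen: "(\<Union>i\<in>{1..n}. {E i -` B \<inter> space \<Omega> |B. B \<in> sets (vec_algebra d)}) \<subseteq> sets (F n)"
  proof (intro UN_least subsetI)
    fix i A assume i: "i \<in> {1..n}" and A: "A \<in> {E i -` B \<inter> space \<Omega> |B. B \<in> sets (vec_algebra d)}"
    then obtain B where "A = E i -` B \<inter> space \<Omega>" "B \<in> sets (vec_algebra d)" by blast
    then show "A \<in> sets (F n)"
      using measurable_sets[OF E_measurable[OF S, of i n], of B] i unfolding space_F[OF S] by simp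
  qed
  have "sets (observed_algebra d \<Omega> E n) = sigma_sets (space \<Omega>)
      (\<Union>i\<in>{1..n}. {E i -` B \<inter> space \<Omega> |B. B \<in> sets (vec_algebra d)})"
    unfolding observed_algebra_def by (rule sets_measure_of) auto
  also have "\<dots> \<subseteq> sets (F n)"
    using sets.sigma_sets_subset[OF gen] unfolding space_F[OF S] .
  finally show "sets (observed_algebra d \<Omega> E n) \<subseteq> sets (F n)" .
qed

text \<open>The events of this form are a sigma-algebra containing the generators.\<close>

lemma observed_algebra_vimage:
  assumes S: "evalue_setting d \<Omega> F E" and A: "A \<in> sets (observed_algebra d \<Omega> E n)"
  obtains B where "B \<in> sets (Pi\<^sub>M {1..n} (\<lambda>_. vec_algebra d))" "A = observations E n -` B \<inter> space \<Omega>"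
proof -
  let ?Pi = "Pi\<^sub>M {1..n} (\<lambda>_. vec_algebra d)"
  let ?V = "vimage_algebra (space \<Omega>) (observations E n) ?Pi"
  have meas: "observations E n \<in> measurable (F n) ?Pi"
    by (rule observations_measurable) (rule E_measurable[OF S])
  have "observations E n \<in> space \<Omega> \<rightarrow> space ?Pi"
    using measurable_space[OF meas] unfolding space_F[OF S] by blast
  note V = sets_vimage_algebra2[OF this]
  have gen: "(\<Union>i\<in>{1..n}. {E i -` B \<inter> space \<Omega> |B. B \<in> sets (vec_algebra d)}) \<subseteq> sets ?V"
  proof (intro UN_least subsetI)
    fix i A assume i: "i \<in> {1..n}" and A: "A \<in> {E i -` B \<inter> space \<Omega> |B. B \<in> sets (vec_algebra d)}"
    then obtain B where B: "A = E i -` B \<inter> space \<Omega>" "B \<in> sets (vec_algebra d)" by blast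
    have "(\<lambda>x. x i) -` B \<inter> space ?Pi \<in> sets ?Pi"
      by (rule measurable_sets[OF measurable_component_singleton[OF i] B(2)])
    moreover have "A = observations E n -` ((\<lambda>x. x i) -` B \<inter> space ?Pi) \<inter> space \<Omega>"
      using measurable_space[OF meas] i unfolding B(1) space_F[OF S] by (auto simp: observations_def)
    ultimately show "A \<in> sets ?V" unfolding V by blast
  qed
  have "sets (observed_algebra d \<Omega> E n) = sigma_sets (space \<Omega>)
      (\<Union>i\<in>{1..n}. {E i -` B \<inter> space \<Omega> |B. B \<in> sets (vec_algebra d)})"
    unfolding observed_algebra_def by (rule sets_measure_of) auto
  also have "\<dots> \<subseteq> sets ?V"
    using sets.sigma_sets_subset[OF gen] by (simp only: space_vimage_algebra)
  finally have "A \<in> sets ?V" using A by blast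
  then show ?thesis unfolding V using that by blast
qed

lemma distr_observations:
  assumes S: "evalue_setting d \<Omega> F E" and P: "P \<in> iid_distributions d \<Omega> F E" and n: "1 \<le> n"
  shows "distr P (Pi\<^sub>M {1..n} (\<lambda>_. vec_algebra d)) (observations E n) =
    Pi\<^sub>M {1..n} (\<lambda>_. distr P (vec_algebra d) (E 1))"
proof -
  interpret P: prob_space P by (rule iid_distributionsD(1)[OF P])
  have "P.indep_vars (\<lambda>_. vec_algebra d) E {1..n}"
    by (rule P.indep_vars_subset[OF iid_distributionsD(4)[OF P]]) auto
  moreover have "P.indep_vars (\<lambda>_. vec_algebra d) E {1..n} \<longleftrightarrow>
      distr P (Pi\<^sub>M {1..n} (\<lambda>_. vec_algebra d)) (\<lambda>\<omega>. \<lambda>i\<in>{1..n}. E i \<omega>) =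
      Pi\<^sub>M {1..n} (\<lambda>i. distr P (vec_algebra d) (E i))"
  proof (rule P.indep_vars_iff_distr_eq_PiM')
    show "{1..n} \<noteq> {}" using n by simp
    show "E i \<in> measurable P (vec_algebra d)" if "i \<in> {1..n}" for i
      using that by (intro iid_measurable[OF S P]) simp
  qed
  ultimately have "distr P (Pi\<^sub>M {1..n} (\<lambda>_. vec_algebra d)) (\<lambda>\<omega>. \<lambda>i\<in>{1..n}. E i \<omega>) =
      Pi\<^sub>M {1..n} (\<lambda>i. distr P (vec_algebra d) (E i))"
    by (rule iffD1[rotated])
  also have "\<dots> = Pi\<^sub>M {1..n} (\<lambda>_. distr P (vec_algebra d) (E 1))"
    by (intro PiM_cong refl) (rule iid_distributionsD(5)[OF P], simp)
  finally show ?thesis unfolding observations_def .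
qed

lemma supermartingale_expectation_le_1:
  assumes S: "evalue_setting d \<Omega> F E" and P: "P \<in> iid_distributions d \<Omega> F E"
    and M: "test_supermartingale \<Omega> F P M" and n: "1 \<le> n"
  shows "(\<integral>\<^sup>+\<omega>. ennreal (M n \<omega>) \<partial>P) \<le> 1"
  using n
proof (induction n rule: dec_induct)
  case base
  show ?case using M unfolding test_supermartingale_def by (elim conjE)
next
  case (step n)
  interpret P: prob_space P by (rule iid_distributionsD(1)[OF P])
  have sub: "subalgebra P (F k)" for k by (rule subalgebra_iid[OF S iid_distributionsD(2)[OF P]])
  interpret N: finite_measure_subalgebra P "F n" by unfold_locales (rule sub)
  have M_meas: "M (Suc n) \<in> borel_measurable (F (Suc n))"
  proof -
    have *: "\<forall>n\<ge>1. M n \<in> borel_measurable (F n) \<and> (\<forall>\<omega>\<in>space \<Omega>. 0 \<le> M n \<omega>)"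
      using M unfolding test_supermartingale_def nonneg_adapted_def by (elim conjE)
    show ?thesis by (rule *[THEN spec, THEN mp, THEN conjunct1]) simp
  qed
  have meas: "(\<lambda>\<omega>. ennreal (M (Suc n) \<omega>)) \<in> borel_measurable P"
    by (rule measurable_compose[OF measurable_from_subalg[OF sub M_meas] measurable_ennreal])
  have "(\<integral>\<^sup>+\<omega>. ennreal (M (Suc n) \<omega>) \<partial>P) = (\<integral>\<^sup>+\<omega>. 1 * ennreal (M (Suc n) \<omega>) \<partial>P)" by simp
  also have "\<dots> = (\<integral>\<^sup>+\<omega>. 1 * nn_cond_exp P (F n) (\<lambda>\<omega>. ennreal (M (Suc n) \<omega>)) \<omega> \<partial>P)"
    by (rule N.nn_cond_exp_intg[symmetric, OF _ meas]) simp
  also have "\<dots> \<le> (\<integral>\<^sup>+\<omega>. ennreal (M n \<omega>) \<partial>P)"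
  proof (rule nn_integral_mono_AE)
    have *: "\<forall>n\<ge>2. AE \<omega> in P. nn_cond_exp P (F (n - 1)) (\<lambda>\<omega>. ennreal (M n \<omega>)) \<omega> \<le> ennreal (M (n - 1) \<omega>)"
      using M unfolding test_supermartingale_def by (elim conjE)
    have "2 \<le> Suc n" using step(1) by simp
    from *[THEN spec, THEN mp, OF this] show "AE \<omega> in P. 1 * nn_cond_exp P (F n) (\<lambda>\<omega>. ennreal (M (Suc n) \<omega>)) \<omega> \<le> ennreal (M n \<omega>)" by (simp only: mult_1 diff_Suc_1)
  qed
  also have "\<dots> \<le> 1" by (rule step.IH)
  finally show ?case .
qed

definition inverse_wealth :: "nat \<Rightarrow> (nat \<Rightarrow> real) \<Rightarrow> (nat \<Rightarrow> 'a \<Rightarrow> nat \<Rightarrow> real) \<Rightarrow> nat \<Rightarrow> 'a \<Rightarrow> real" where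
  "inverse_wealth d l E n \<omega> = (\<Prod>i=1..n. 1 / payoff d l (E i \<omega>))"

lemma inverse_wealth_eq: "inverse_wealth d l E n \<omega> = 1 / wealth d E l n \<omega>"
  by (simp add: inverse_wealth_def wealth_def prod_dividef)

lemma inverse_wealth_nonneg:
  assumes "valid_outcome d E \<omega>" "l \<in> prob_simplex d"
  shows "0 \<le> inverse_wealth d l E n \<omega>"
  unfolding inverse_wealth_eq using wealth_nonneg[OF assms] by simp

text \<open>The null law completes the measure with density \<open>1 / payoff d l\<close> by mass on
  \<open>(1, 0, \<dots>, 0)\<close>, which adds nothing to the means of the components \<open>1,
  \<dots>, d\<close>; these means are at most 1 by the numeraire property. The last two
  conclusions are what remains of the relation between \<open>P\<close> and \<open>Q\<close>:
  one-step domination and sufficiency of the observations.\<close>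

lemma numeraire_null:
  assumes S: "evalue_setting d \<Omega> F E" and Q: "Q \<in> iid_distributions d \<Omega> F E"
    and rich: "rich_sample_space d \<Omega> F E"
  obtains l P where "l \<in> prob_simplex d" "AE \<omega> in Q. \<forall>i\<ge>1. 0 < payoff d l (E i \<omega>)"
    "P \<in> null_hypothesis d \<Omega> F E"
    "\<And>h. h \<in> borel_measurable (vec_algebra d) \<Longrightarrow>
      (\<integral>\<^sup>+x. ennreal (1 / payoff d l x) * h x \<partial>distr Q (vec_algebra d) (E 1)) \<le>
      (\<integral>\<^sup>+x. h x \<partial>distr P (vec_algebra d) (E 1))"
    "\<And>n A. A \<in> sets (F n) \<Longrightarrow> \<exists>K\<in>borel_measurable (observed_algebra d \<Omega> E n). \<forall>D\<in>{P, Q}.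
      AE \<omega> in D. real_cond_exp D (observed_algebra d \<Omega> E n) (indicator A) \<omega> = K \<omega>"
proof -
  define \<nu> where "\<nu> = distr Q (vec_algebra d) (E 1)"
  interpret Q: prob_space Q by (rule iid_distributionsD(1)[OF Q])
  note E1 = iid_measurable[OF S Q order_refl]
  interpret \<nu>: prob_space \<nu> unfolding \<nu>_def by (rule Q.prob_space_distr[OF E1])
  have sets: "sets \<nu> = sets (vec_algebra d)" by (simp add: \<nu>_def)
  have valid_set: "{x \<in> space (vec_algebra d). valid_vector d x} \<in> sets (vec_algebra d)"
  proof -
    have m: "(\<lambda>x. x 0) \<in> borel_measurable (vec_algebra d)" "\<And>j. j \<in> {..d} \<Longrightarrow> (\<lambda>x. x j) \<in> borel_measurable (vec_algebra d)"
      by (rule vec_component_measurable, simp)+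
    have "{x \<in> space (vec_algebra d). x 0 = 1 \<and> (\<forall>j\<in>{..d}. 0 \<le> x j)} \<in> sets (vec_algebra d)"
      by (intro sets.sets_Collect_conj sets.sets_Collect_finite_All' borel_measurable_le borel_measurable_eq
          m borel_measurable_const) auto
    then show ?thesis by (simp add: valid_vector_def)
  qed
  have valid: "AE x in \<nu>. valid_vector d x"
    unfolding \<nu>_def AE_distr_iff[OF E1 valid_set]
  proof (rule AE_I2)
    fix \<omega> assume "\<omega> \<in> space Q"
    then have "valid_outcome d E \<omega>" using evalue_setting_valid[OF S] iid_distributionsD(3)[OF Q] by blast
    then show "valid_vector d (E 1 \<omega>)" unfolding valid_outcome_def valid_vector_def by blast
  qed
  obtain l where l: "l \<in> prob_simplex d" and pos: "AE x in \<nu>. 0 < payoff d l x"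
    and numeraire: "\<And>j. j \<le> d \<Longrightarrow> (\<integral>\<^sup>+x. ennreal (x j / payoff d l x) \<partial>\<nu>) \<le> 1"
    by (rule numeraire_exists[OF \<nu>.prob_space_axioms sets valid]) (rule that)
  define w where "w x = ennreal (1 / payoff d l x)" for x
  have w: "w \<in> borel_measurable \<nu>"
    unfolding w_def measurable_cong_sets[OF sets refl]
    by (intro measurable_compose[OF _ measurable_ennreal] borel_measurable_divide borel_measurable_const payoff_measurable)
  have w_mult: "(\<integral>\<^sup>+x. w x * ennreal (x j) \<partial>\<nu>) \<le> 1" if j: "j \<le> d" for j
  proof -
    have "(\<integral>\<^sup>+x. w x * ennreal (x j) \<partial>\<nu>) = (\<integral>\<^sup>+x. ennreal (x j / payoff d l x) \<partial>\<nu>)"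
    proof (rule nn_integral_cong_AE)
      show "AE x in \<nu>. w x * ennreal (x j) = ennreal (x j / payoff d l x)"
        using valid pos
      proof eventually_elim
        case (elim x)
        then have "0 \<le> x j" "0 \<le> 1 / payoff d l x" using j by (simp_all add: valid_vector_def)
        then show ?case unfolding w_def by (subst ennreal_mult[symmetric]) simp_all
      qed
    qed
    then show ?thesis using numeraire[OF j] by simp
  qed
  have "(\<integral>\<^sup>+x. w x \<partial>\<nu>) = (\<integral>\<^sup>+x. w x * ennreal (x 0) \<partial>\<nu>)"
  proof (rule nn_integral_cong_AE)
    show "AE x in \<nu>. w x = w x * ennreal (x 0)"
      using valid by eventually_elim (simp add: valid_vector_def)
  qed
  then have mass: "(\<integral>\<^sup>+x. w x \<partial>\<nu>) \<le> 1" using w_mult[of 0] by simp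
  have e: "vertex d 0 \<in> space \<nu>"
    unfolding sets_eq_imp_space_eq[OF sets] space_vec_algebra by (simp add: vertex_def)
  obtain p where p: "prob_space p" and sets_p: "sets p = sets \<nu>"
    and int: "\<And>h. h \<in> borel_measurable \<nu> \<Longrightarrow>
      (\<integral>\<^sup>+x. h x \<partial>p) = (\<integral>\<^sup>+x. w x * h x \<partial>\<nu>) + (1 - (\<integral>\<^sup>+x. w x \<partial>\<nu>)) * h (vertex d 0)"
    by (rule completed_law_exists[OF \<nu>.prob_space_axioms w mass e]) (rule that)
  have vertex_valid: "valid_vector d (vertex d 0)" by (simp add: valid_vector_def vertex_def)
  have p_valid: "AE x in p. x 0 = 1 \<and> (\<forall>j\<le>d. 0 \<le> x j)"
  proof -
    define N where "N = {x \<in> space (vec_algebra d). \<not> valid_vector d x}"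
    have N: "N \<in> sets (vec_algebra d)"
    proof -
      have "N = space (vec_algebra d) - {x \<in> space (vec_algebra d). valid_vector d x}" by (auto simp: N_def)
      then show ?thesis using valid_set by auto
    qed
    have "emeasure p N = (\<integral>\<^sup>+x. indicator N x \<partial>p)"
      using N sets_p sets by (intro nn_integral_indicator[symmetric]) simp
    also have "\<dots> = (\<integral>\<^sup>+x. w x * indicator N x \<partial>\<nu>) + (1 - (\<integral>\<^sup>+x. w x \<partial>\<nu>)) * indicator N (vertex d 0)"
      using N sets by (intro int borel_measurable_indicator) simp
    also have "(\<integral>\<^sup>+x. w x * indicator N x \<partial>\<nu>) = (\<integral>\<^sup>+x. 0 \<partial>\<nu>)"
    proof (rule nn_integral_cong_AE)
      show "AE x in \<nu>. w x * indicator N x = 0"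
        using valid by eventually_elim (simp add: N_def)
    qed
    also have "indicator N (vertex d 0) = (0 :: ennreal)" using vertex_valid by (simp add: N_def)
    finally have "emeasure p N = 0" by simp
    then have "N \<in> null_sets p" using N sets_p sets by (intro null_setsI) simp_all
    then have "AE x in p. x \<notin> N" by (rule AE_not_in)
    moreover have "AE x in p. x \<in> space p" by simp
    ultimately show ?thesis
    proof eventually_elim
      case (elim x)
      have "space p = space (vec_algebra d)" using sets_p sets by (intro sets_eq_imp_space_eq) simp
      then have "valid_vector d x" using elim by (simp add: N_def)
      then show ?case by (simp add: valid_vector_def)
    qed
  qed
  have "\<exists>P\<in>iid_distributions d \<Omega> F E. distr P (vec_algebra d) (E 1) = p \<and>
     (\<forall>n. \<forall>A\<in>sets (F n). \<exists>K\<in>borel_measurable (observed_algebra d \<Omega> E n). \<forall>D\<in>{P, Q}.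
        AE \<omega> in D. real_cond_exp D (observed_algebra d \<Omega> E n) (indicator A) \<omega> = K \<omega>)"
  proof -
    have "prob_space p \<and> sets p = sets (vec_algebra d) \<and> (AE x in p. x 0 = 1 \<and> (\<forall>j\<le>d. 0 \<le> x j))"
      using p sets_p sets p_valid by (intro conjI) simp_all
    then show ?thesis
      by (rule rich[unfolded rich_sample_space_def, THEN bspec, OF Q, THEN spec, THEN mp])
  qed
  then obtain P where P: "P \<in> iid_distributions d \<Omega> F E" and law: "distr P (vec_algebra d) (E 1) = p"
    and suff: "\<forall>n. \<forall>A\<in>sets (F n). \<exists>K\<in>borel_measurable (observed_algebra d \<Omega> E n). \<forall>D\<in>{P, Q}.
        AE \<omega> in D. real_cond_exp D (observed_algebra d \<Omega> E n) (indicator A) \<omega> = K \<omega>"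
    by (elim bexE conjE) (rule that)
  note PE1 = iid_measurable[OF S P order_refl]
  have "(\<integral>\<^sup>+\<omega>. ennreal (E 1 \<omega> j) \<partial>P) \<le> 1" if j: "j \<in> {1..d}" for j
  proof -
    have jd: "j \<le> d" using j by simp
    have hm: "(\<lambda>x. ennreal (x j)) \<in> borel_measurable (vec_algebra d)"
      by (rule measurable_compose[OF vec_component_measurable[OF jd] measurable_ennreal])
    have "(\<integral>\<^sup>+\<omega>. ennreal (E 1 \<omega> j) \<partial>P) = (\<integral>\<^sup>+x. ennreal (x j) \<partial>p)"
      unfolding law[symmetric] by (rule nn_integral_distr[symmetric, OF PE1]) (simp add: hm)
    also have "\<dots> = (\<integral>\<^sup>+x. w x * ennreal (x j) \<partial>\<nu>) + (1 - (\<integral>\<^sup>+x. w x \<partial>\<nu>)) * ennreal (vertex d 0 j)"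
      by (rule int) (simp only: measurable_cong_sets[OF sets refl] hm)
    also have "\<dots> = (\<integral>\<^sup>+x. w x * ennreal (x j) \<partial>\<nu>)" using j by (simp add: vertex_def)
    also have "\<dots> \<le> 1" by (rule w_mult[OF jd])
    finally show ?thesis .
  qed
  then have null: "P \<in> null_hypothesis d \<Omega> F E"
    unfolding null_hypothesis_def using P by blast
  have dom: "(\<integral>\<^sup>+x. ennreal (1 / payoff d l x) * h x \<partial>distr Q (vec_algebra d) (E 1)) \<le>
      (\<integral>\<^sup>+x. h x \<partial>distr P (vec_algebra d) (E 1))" if h: "h \<in> borel_measurable (vec_algebra d)" for h
  proof -
    have "h \<in> borel_measurable \<nu>" using h by (simp only: measurable_cong_sets[OF sets refl])
    from int[OF this] show ?thesis unfolding law \<nu>_def[symmetric] w_def by simp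
  qed
  have pos_all: "AE \<omega> in Q. \<forall>i\<ge>1. 0 < payoff d l (E i \<omega>)"
  proof -
    have "AE \<omega> in Q. i \<ge> 1 \<longrightarrow> 0 < payoff d l (E i \<omega>)" for i
    proof (cases "1 \<le> i")
      case True
      have set: "{x \<in> space (vec_algebra d). 0 < payoff d l x} \<in> sets (vec_algebra d)"
        by (rule borel_measurable_less[OF borel_measurable_const payoff_measurable])
      have "AE x in distr Q (vec_algebra d) (E i). 0 < payoff d l x"
        unfolding iid_distributionsD(5)[OF Q True] using pos unfolding \<nu>_def .
      then show ?thesis unfolding AE_distr_iff[OF iid_measurable[OF S Q True] set] by simp
    qed simp
    then show ?thesis unfolding AE_all_countable by (rule allI)
  qed
  show ?thesis
    by (rule that[OF l pos_all null dom]) (assumption | rule suff[THEN spec, THEN bspec])+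
qed


lemma inverse_wealth_measurable:
  assumes "\<And>i. 1 \<le> i \<Longrightarrow> i \<le> n \<Longrightarrow> E i \<in> measurable M (vec_algebra d)"
  shows "inverse_wealth d l E n \<in> borel_measurable M"
  unfolding inverse_wealth_def
  by (intro borel_measurable_prod borel_measurable_divide borel_measurable_const
      measurable_compose[OF _ payoff_measurable] assms) auto

text \<open>The observations have product laws under both distributions, so the one-step domination
  multiplies up.\<close>

lemma inverse_wealth_observed:
  assumes S: "evalue_setting d \<Omega> F E" and Q: "Q \<in> iid_distributions d \<Omega> F E" and P: "P \<in> iid_distributions d \<Omega> F E"
    and l: "l \<in> prob_simplex d" and n: "1 \<le> n"
    and dom: "\<And>h. h \<in> borel_measurable (vec_algebra d) \<Longrightarrow>
      (\<integral>\<^sup>+x. ennreal (1 / payoff d l x) * h x \<partial>distr Q (vec_algebra d) (E 1)) \<le>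
      (\<integral>\<^sup>+x. h x \<partial>distr P (vec_algebra d) (E 1))"
    and A: "A \<in> sets (observed_algebra d \<Omega> E n)"
  shows "(\<integral>\<^sup>+\<omega>. ennreal (inverse_wealth d l E n \<omega>) * indicator A \<omega> \<partial>Q) \<le> emeasure P A"
proof -
  let ?V = "vec_algebra d"
  let ?Pi = "Pi\<^sub>M {1..n} (\<lambda>_. ?V)"
  let ?\<nu> = "distr Q ?V (E 1)" and ?p = "distr P ?V (E 1)"
  let ?w = "\<lambda>x. ennreal (1 / payoff d l x)"
  interpret Q: prob_space Q by (rule iid_distributionsD(1)[OF Q])
  interpret P: prob_space P by (rule iid_distributionsD(1)[OF P])
  interpret \<nu>: prob_space ?\<nu> by (rule Q.prob_space_distr[OF iid_measurable[OF S Q order_refl]])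
  interpret p: prob_space ?p by (rule P.prob_space_distr[OF iid_measurable[OF S P order_refl]])
  obtain B where B: "B \<in> sets ?Pi" and AB: "A = observations E n -` B \<inter> space \<Omega>"
    by (rule observed_algebra_vimage[OF S A]) (rule that)
  have obsQ: "observations E n \<in> measurable Q ?Pi" by (rule observations_measurable) (rule iid_measurable[OF S Q])
  have obsP: "observations E n \<in> measurable P ?Pi" by (rule observations_measurable) (rule iid_measurable[OF S P])
  have w: "?w \<in> borel_measurable ?V"
    by (intro measurable_compose[OF _ measurable_ennreal] borel_measurable_divide borel_measurable_const payoff_measurable)
  have W: "(\<lambda>x. (\<Prod>i\<in>{1..n}. ?w (x i)) * indicator B x) \<in> borel_measurable ?Pi"
  proof (rule borel_measurable_times_ennreal[OF borel_measurable_prod_ennreal borel_measurable_indicator[OF B]])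
    fix i assume "i \<in> {1..n}"
    then have "(\<lambda>x. x i) \<in> measurable ?Pi ?V" by (rule measurable_component_singleton)
    from this w show "(\<lambda>x. ?w (x i)) \<in> borel_measurable ?Pi" by (rule measurable_compose)
  qed
  have "(\<integral>\<^sup>+\<omega>. ennreal (inverse_wealth d l E n \<omega>) * indicator A \<omega> \<partial>Q) =
      (\<integral>\<^sup>+\<omega>. (\<Prod>i\<in>{1..n}. ?w (observations E n \<omega> i)) * indicator B (observations E n \<omega>) \<partial>Q)"
  proof (rule nn_integral_cong)
    fix \<omega> assume "\<omega> \<in> space Q"
    then have \<omega>: "\<omega> \<in> space \<Omega>" using iid_distributionsD(3)[OF Q] by blast
    note valid = evalue_setting_valid[OF S \<omega>]
    have "(\<Prod>i\<in>{1..n}. ?w (observations E n \<omega> i)) = (\<Prod>i\<in>{1..n}. ?w (E i \<omega>))"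
      by (intro prod.cong refl) (simp only: observations_def restrict_apply')
    also have "\<dots> = ennreal (inverse_wealth d l E n \<omega>)"
      unfolding inverse_wealth_def
    proof (rule prod_ennreal)
      fix i assume "i \<in> {1..n}"
      then have "1 \<le> i" by simp
      from payoff_nonneg[OF valid l this] show "0 \<le> 1 / payoff d l (E i \<omega>)" by simp
    qed
    finally show "ennreal (inverse_wealth d l E n \<omega>) * indicator A \<omega> =
        (\<Prod>i\<in>{1..n}. ?w (observations E n \<omega> i)) * indicator B (observations E n \<omega>)"
      using \<omega> by (simp add: AB indicator_def)
  qed
  also have "\<dots> = (\<integral>\<^sup>+x. (\<Prod>i\<in>{1..n}. ?w (x i)) * indicator B x \<partial>distr Q ?Pi (observations E n))"
    by (rule nn_integral_distr[symmetric, OF obsQ]) (simp only: measurable_distr_eq1 W)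
  also have "\<dots> = (\<integral>\<^sup>+x. (\<Prod>i\<in>{1..n}. ?w (x i)) * indicator B x \<partial>Pi\<^sub>M {1..n} (\<lambda>_. ?\<nu>))"
    by (simp only: distr_observations[OF S Q n])
  also have "\<dots> \<le> (\<integral>\<^sup>+x. indicator B x \<partial>Pi\<^sub>M {1..n} (\<lambda>_. ?p))"
  proof (rule nn_integral_PiM_mono)
    show "sigma_finite_measure ?\<nu>" "sigma_finite_measure ?p" by unfold_locales
    show "sets ?\<nu> = sets ?p" by (simp only: sets_distr)
    show "?w \<in> borel_measurable ?p" using w by (simp only: measurable_distr_eq1)
    show "(\<integral>\<^sup>+y. ?w y * h y \<partial>?\<nu>) \<le> (\<integral>\<^sup>+y. h y \<partial>?p)" if "h \<in> borel_measurable ?p" for h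
      using that by (intro dom) (simp only: measurable_distr_eq1)
    have "B \<in> sets (Pi\<^sub>M {1..n} (\<lambda>_. ?p))"
      using B sets_PiM_cong[OF refl, of "{1..n}" "\<lambda>_. ?p" "\<lambda>_. ?V"] by (simp only: sets_distr)
    then show "indicator B \<in> borel_measurable (Pi\<^sub>M {1..n} (\<lambda>_. ?p))" by (rule borel_measurable_indicator)
  qed simp
  also have "\<dots> = (\<integral>\<^sup>+x. indicator B x \<partial>distr P ?Pi (observations E n))"
    by (simp only: distr_observations[OF S P n])
  also have "\<dots> = emeasure P A"
    unfolding AB using B obsP iid_distributionsD(3)[OF P] by (simp add: emeasure_distr)
  finally show ?thesis .
qed

text \<open>By sufficiency, an event of \<open>F n\<close> may be replaced by its conditional probability
  \<open>K\<close> given the observations, the same one under \<open>P\<close> and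
  \<open>Q\<close>. Since \<open>K\<close> and the density are functions of the observations, the
  domination on the observed sigma-algebra applies.\<close>

lemma inverse_wealth_filtration:
  assumes S: "evalue_setting d \<Omega> F E" and Q: "Q \<in> iid_distributions d \<Omega> F E" and P: "P \<in> iid_distributions d \<Omega> F E"
    and l: "l \<in> prob_simplex d" and n: "1 \<le> n"
    and dom: "\<And>h. h \<in> borel_measurable (vec_algebra d) \<Longrightarrow>
      (\<integral>\<^sup>+x. ennreal (1 / payoff d l x) * h x \<partial>distr Q (vec_algebra d) (E 1)) \<le>
      (\<integral>\<^sup>+x. h x \<partial>distr P (vec_algebra d) (E 1))"
    and suff: "\<exists>K\<in>borel_measurable (observed_algebra d \<Omega> E n). \<forall>D\<in>{P, Q}.
      AE \<omega> in D. real_cond_exp D (observed_algebra d \<Omega> E n) (indicator A) \<omega> = K \<omega>"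
    and A: "A \<in> sets (F n)"
  shows "(\<integral>\<^sup>+\<omega>. ennreal (inverse_wealth d l E n \<omega>) * indicator A \<omega> \<partial>Q) \<le> emeasure P A"
proof -
  let ?G = "observed_algebra d \<Omega> E n"
  interpret Q: prob_space Q by (rule iid_distributionsD(1)[OF Q])
  interpret P: prob_space P by (rule iid_distributionsD(1)[OF P])
  have subQF: "subalgebra Q (F n)" by (rule subalgebra_iid[OF S iid_distributionsD(2)[OF Q]])
  have subPF: "subalgebra P (F n)" by (rule subalgebra_iid[OF S iid_distributionsD(2)[OF P]])
  note obs = subalgebra_observed[OF S, of n]
  have subQ: "subalgebra Q ?G" using subQF obs unfolding subalgebra_def by blast
  have subP: "subalgebra P ?G" using subPF obs unfolding subalgebra_def by blast
  interpret QG: finite_measure_subalgebra Q ?G by unfold_locales (rule subQ)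
  interpret PG: finite_measure_subalgebra P ?G by unfold_locales (rule subP)
  have AQ: "A \<in> sets Q" using A subQF unfolding subalgebra_def by blast
  have AP: "A \<in> sets P" using A subPF unfolding subalgebra_def by blast
  obtain K where K: "K \<in> borel_measurable ?G"
    and KP: "AE \<omega> in P. real_cond_exp P ?G (indicator A) \<omega> = K \<omega>"
    and KQ: "AE \<omega> in Q. real_cond_exp Q ?G (indicator A) \<omega> = K \<omega>"
    using suff by blast
  let ?Z = "inverse_wealth d l E n"
  have Z: "?Z \<in> borel_measurable ?G" by (rule inverse_wealth_measurable) (rule E_measurable_observed[OF S])
  note ZQ = measurable_from_subalg[OF subQ Z]
  have Z_nonneg: "0 \<le> ?Z \<omega>" if "\<omega> \<in> space Q" for \<omega>
    using that iid_distributionsD(3)[OF Q] evalue_setting_valid[OF S] by (intro inverse_wealth_nonneg[OF _ l]) blast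
  have le: "(\<integral>\<^sup>+\<omega>. ennreal (?Z \<omega>) * indicator B \<omega> \<partial>Q) \<le> emeasure P B" if "B \<in> sets ?G" for B
    by (rule inverse_wealth_observed[OF S Q P l n dom that])
  have "(\<integral>\<^sup>+\<omega>. ennreal (?Z \<omega>) \<partial>Q) \<le> emeasure P (space P)"
  proof -
    have top: "space P \<in> sets ?G" using subP sets.top[of ?G] unfolding subalgebra_def by simp
    have "(\<integral>\<^sup>+\<omega>. ennreal (?Z \<omega>) \<partial>Q) = (\<integral>\<^sup>+\<omega>. ennreal (?Z \<omega>) * indicator (space P) \<omega> \<partial>Q)"
      using iid_distributionsD(3)[OF P] iid_distributionsD(3)[OF Q] by (intro nn_integral_cong) simp
    then show ?thesis using le[OF top] by simp
  qed
  then have Z_int: "integrable Q ?Z"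
    using Z_nonneg by (intro integrableI_nonneg ZQ AE_I2) (auto simp: P.emeasure_space_1 elim: le_less_trans)
  have ZA_int: "integrable Q (\<lambda>\<omega>. ?Z \<omega> * indicator A \<omega>)"
    using integrable_mult_indicator[OF AQ Z_int] by (simp add: mult.commute)
  note exch = QG.real_cond_exp_intg[OF ZA_int Z borel_measurable_indicator[OF AQ]]
  have Kpos: "AE \<omega> in Q. 0 \<le> K \<omega>"
    using QG.real_cond_exp_pos[of "indicator A"] KQ AQ by (auto elim!: AE_mp)
  have "(\<integral>\<^sup>+\<omega>. ennreal (?Z \<omega>) * indicator A \<omega> \<partial>Q) = (\<integral>\<^sup>+\<omega>. ennreal (?Z \<omega> * indicator A \<omega>) \<partial>Q)"
    by (intro nn_integral_cong) (simp add: indicator_def)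
  also have "\<dots> = ennreal (\<integral>\<omega>. ?Z \<omega> * indicator A \<omega> \<partial>Q)"
    using Z_nonneg by (intro nn_integral_eq_integral ZA_int AE_I2) simp
  also have "\<dots> = ennreal (\<integral>\<omega>. ?Z \<omega> * real_cond_exp Q ?G (indicator A) \<omega> \<partial>Q)"
    by (simp only: exch(2))
  also have "\<dots> = (\<integral>\<^sup>+\<omega>. ennreal (?Z \<omega> * real_cond_exp Q ?G (indicator A) \<omega>) \<partial>Q)"
  proof (rule nn_integral_eq_integral[symmetric, OF exch(1)])
    have "AE \<omega> in Q. \<omega> \<in> space Q" by simp
    then show "AE \<omega> in Q. 0 \<le> ?Z \<omega> * real_cond_exp Q ?G (indicator A) \<omega>"
      using Kpos KQ by eventually_elim (simp add: Z_nonneg)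
  qed
  also have "\<dots> = (\<integral>\<^sup>+\<omega>. ennreal (?Z \<omega>) * ennreal (K \<omega>) \<partial>Q)"
  proof (rule nn_integral_cong_AE)
    have "AE \<omega> in Q. \<omega> \<in> space Q" by simp
    then show "AE \<omega> in Q. ennreal (?Z \<omega> * real_cond_exp Q ?G (indicator A) \<omega>) = ennreal (?Z \<omega>) * ennreal (K \<omega>)"
      using Kpos KQ by eventually_elim (simp add: Z_nonneg ennreal_mult)
  qed
  also have "\<dots> = (\<integral>\<^sup>+\<omega>. ennreal (K \<omega>) \<partial>density Q (\<lambda>\<omega>. ennreal (?Z \<omega>)))"
    by (rule nn_integral_density[symmetric, OF measurable_compose[OF ZQ measurable_ennreal]
        measurable_compose[OF measurable_from_subalg[OF subQ K] measurable_ennreal]])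
  also have "\<dots> \<le> (\<integral>\<^sup>+\<omega>. ennreal (K \<omega>) \<partial>P)"
  proof (rule nn_integral_mono_subalgebra[OF _ subP])
    show "subalgebra (density Q (\<lambda>\<omega>. ennreal (?Z \<omega>))) ?G" using subQ by (simp add: subalgebra_def)
    fix B assume B: "B \<in> sets ?G"
    then have BQ: "B \<in> sets Q" using subQ unfolding subalgebra_def by blast
    show "emeasure (density Q (\<lambda>\<omega>. ennreal (?Z \<omega>))) B \<le> emeasure P B"
      unfolding emeasure_density[OF measurable_compose[OF ZQ measurable_ennreal] BQ] by (rule le[OF B])
  qed (rule measurable_compose[OF K measurable_ennreal])
  also have "\<dots> = (\<integral>\<^sup>+\<omega>. ennreal (real_cond_exp P ?G (indicator A) \<omega>) \<partial>P)"
    using KP by (intro nn_integral_cong_AE) auto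
  also have "\<dots> = ennreal (\<integral>\<omega>. real_cond_exp P ?G (indicator A) \<omega> \<partial>P)"
    using AP by (intro nn_integral_eq_integral PG.real_cond_exp_int PG.real_cond_exp_pos)
      (simp_all add: P.emeasure_finite less_top[symmetric])
  also have "\<dots> = ennreal (\<integral>\<omega>. indicator A \<omega> \<partial>P)"
    using AP by (subst PG.real_cond_exp_int) (simp_all add: P.emeasure_finite less_top[symmetric])
  also have "\<dots> = emeasure P A" using AP by (simp add: P.emeasure_eq_measure)
  finally show ?thesis .
qed

section \<open>Instance optimality\<close>

lemma e_process_inverse_wealth:
  assumes S: "evalue_setting d \<Omega> F E" and Q: "Q \<in> iid_distributions d \<Omega> F E" and P: "P \<in> null_hypothesis d \<Omega> F E"
    and l: "l \<in> prob_simplex d" and n: "1 \<le> n"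
    and dom: "\<And>h. h \<in> borel_measurable (vec_algebra d) \<Longrightarrow>
      (\<integral>\<^sup>+x. ennreal (1 / payoff d l x) * h x \<partial>distr Q (vec_algebra d) (E 1)) \<le>
      (\<integral>\<^sup>+x. h x \<partial>distr P (vec_algebra d) (E 1))"
    and suff: "\<And>n A. A \<in> sets (F n) \<Longrightarrow> \<exists>K\<in>borel_measurable (observed_algebra d \<Omega> E n). \<forall>D\<in>{P, Q}.
      AE \<omega> in D. real_cond_exp D (observed_algebra d \<Omega> E n) (indicator A) \<omega> = K \<omega>"
    and W': "e_process \<Omega> F (null_hypothesis d \<Omega> F E) W'"
  shows "(\<integral>\<^sup>+\<omega>. ennreal (inverse_wealth d l E n \<omega>) * ennreal (W' n \<omega>) \<partial>Q) \<le> 1"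
proof -
  let ?Z = "inverse_wealth d l E n"
  have Pi: "P \<in> iid_distributions d \<Omega> F E" using P unfolding null_hypothesis_def by blast
  have subQ: "subalgebra Q (F n)" by (rule subalgebra_iid[OF S iid_distributionsD(2)[OF Q]])
  have subP: "subalgebra P (F n)" by (rule subalgebra_iid[OF S iid_distributionsD(2)[OF Pi]])
  have adapted: "\<forall>n\<ge>1. W' n \<in> borel_measurable (F n) \<and> (\<forall>\<omega>\<in>space \<Omega>. 0 \<le> W' n \<omega>)"
    using W' unfolding e_process_def nonneg_adapted_def by (elim conjE)
  have W'm: "(\<lambda>\<omega>. ennreal (W' n \<omega>)) \<in> borel_measurable (F n)"
    by (rule measurable_compose[OF adapted[THEN spec, THEN mp, OF n, THEN conjunct1] measurable_ennreal])
  have Z: "(\<lambda>\<omega>. ennreal (?Z \<omega>)) \<in> borel_measurable Q"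
    by (rule measurable_compose[OF inverse_wealth_measurable measurable_ennreal]) (rule iid_measurable[OF S Q])
  have "\<forall>P\<in>null_hypothesis d \<Omega> F E. \<exists>M. test_supermartingale \<Omega> F P M \<and> (AE \<omega> in P. \<forall>n\<ge>1. W' n \<omega> \<le> M n \<omega>)"
    using W' unfolding e_process_def by (elim conjE)
  from bspec[OF this P] obtain M where M: "test_supermartingale \<Omega> F P M"
    and le: "AE \<omega> in P. \<forall>n\<ge>1. W' n \<omega> \<le> M n \<omega>" by blast
  have "(\<integral>\<^sup>+\<omega>. ennreal (?Z \<omega>) * ennreal (W' n \<omega>) \<partial>Q) = (\<integral>\<^sup>+\<omega>. ennreal (W' n \<omega>) \<partial>density Q (\<lambda>\<omega>. ennreal (?Z \<omega>)))"
    by (rule nn_integral_density[symmetric, OF Z measurable_from_subalg[OF subQ W'm]])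
  also have "\<dots> \<le> (\<integral>\<^sup>+\<omega>. ennreal (W' n \<omega>) \<partial>P)"
  proof (rule nn_integral_mono_subalgebra[OF _ subP _ W'm])
    show "subalgebra (density Q (\<lambda>\<omega>. ennreal (?Z \<omega>))) (F n)" using subQ by (simp add: subalgebra_def)
    fix A assume A: "A \<in> sets (F n)"
    then have AQ: "A \<in> sets Q" using subQ unfolding subalgebra_def by blast
    show "emeasure (density Q (\<lambda>\<omega>. ennreal (?Z \<omega>))) A \<le> emeasure P A"
      unfolding emeasure_density[OF Z AQ] by (rule inverse_wealth_filtration[OF S Q Pi l n dom suff[OF A] A])
  qed
  also have "\<dots> \<le> (\<integral>\<^sup>+\<omega>. ennreal (M n \<omega>) \<partial>P)"
  proof (rule nn_integral_mono_AE)
    show "AE \<omega> in P. ennreal (W' n \<omega>) \<le> ennreal (M n \<omega>)"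
      using le
    proof eventually_elim
      case (elim \<omega>)
      then have "W' n \<omega> \<le> M n \<omega>" using n by blast
      then show ?case by (rule ennreal_leI)
    qed
  qed
  also have "\<dots> \<le> 1" by (rule supermartingale_expectation_le_1[OF S Pi M n])
  finally show ?thesis .
qed

text \<open>The Markov inequality gives probabilities of at most \<open>1 / n\<^sup>2\<close> for the
  complementary events, and these are summable.\<close>

lemma eventually_less_square:
  fixes X :: "nat \<Rightarrow> 'a \<Rightarrow> ennreal"
  assumes Q: "prob_space Q" and X: "\<And>n. 1 \<le> n \<Longrightarrow> X n \<in> borel_measurable Q"
    and mean: "\<And>n. 1 \<le> n \<Longrightarrow> (\<integral>\<^sup>+\<omega>. X n \<omega> \<partial>Q) \<le> 1"
  shows "AE \<omega> in Q. eventually (\<lambda>n. X n \<omega> < ennreal ((real n)\<^sup>2)) sequentially"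
proof -
  interpret Q: prob_space Q by fact
  define c where "c n = inverse ((real n)\<^sup>2)" for n
  \<comment> \<open>Shifting the index by one avoids the value \<open>c 0 = 0\<close>.\<close>
  define A where "A n = {\<omega> \<in> space Q. 1 \<le> ennreal (c (Suc n)) * X (Suc n) \<omega>}" for n
  have XS: "X (Suc n) \<in> borel_measurable Q" for n by (rule X) simp
  have A: "A n \<in> sets Q" for n
    unfolding A_def
    by (rule borel_measurable_le[OF borel_measurable_const borel_measurable_times_ennreal[OF borel_measurable_const XS]])
  have cpos: "0 < c (Suc n)" for n by (simp add: c_def)
  have A_le: "emeasure Q (A n) \<le> ennreal (c (Suc n))" for n
  proof -
    have "emeasure Q (A n) \<le> ennreal (c (Suc n)) * (\<integral>\<^sup>+\<omega>. X (Suc n) \<omega> * indicator (space Q) \<omega> \<partial>Q)"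
      unfolding A_def
      by (rule nn_integral_Markov_inequality[OF borel_measurable_times_ennreal[OF XS borel_measurable_indicator]]) simp_all
    also have "(\<integral>\<^sup>+\<omega>. X (Suc n) \<omega> * indicator (space Q) \<omega> \<partial>Q) = (\<integral>\<^sup>+\<omega>. X (Suc n) \<omega> \<partial>Q)"
      by (intro nn_integral_cong) simp
    also have "ennreal (c (Suc n)) * \<dots> \<le> ennreal (c (Suc n)) * 1"
      by (intro mult_left_mono mean) simp_all
    finally show ?thesis by simp
  qed
  have "AE \<omega> in Q. eventually (\<lambda>n. \<omega> \<in> space Q - A n) sequentially"
  proof (rule borel_cantelli_AE1[OF A])
    show "emeasure Q (A n) < \<infinity>" for n by (simp add: Q.emeasure_eq_measure)
    have "summable c" unfolding c_def by (rule inverse_power_summable) simp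
    then have "summable (\<lambda>n. c (Suc n))" by (simp only: summable_Suc_iff)
    moreover have "norm (measure Q (A n)) \<le> c (Suc n)" for n
      using A_le[of n] cpos[of n] by (simp add: Q.emeasure_eq_measure)
    ultimately show "summable (\<lambda>n. measure Q (A n))" by (rule summable_comparison_test'[where N = 0])
  qed
  then show ?thesis
  proof eventually_elim
    case (elim \<omega>)
    then have "eventually (\<lambda>n. X (Suc n) \<omega> < ennreal ((real (Suc n))\<^sup>2)) sequentially"
    proof eventually_elim
      case (elim n)
      then have less: "ennreal (c (Suc n)) * X (Suc n) \<omega> < 1" by (auto simp: A_def)
      then have fin: "X (Suc n) \<omega> \<noteq> top" using cpos[of n] by (auto simp: ennreal_mult_top)
      then obtain x where x: "X (Suc n) \<omega> = ennreal x" "0 \<le> x" by (cases "X (Suc n) \<omega>") auto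
      have "c (Suc n) * x < 1"
        using less x cpos[of n] by (simp add: ennreal_mult[symmetric] ennreal_less_iff less_imp_le flip: ennreal_1)
      then have "x < (real (Suc n))\<^sup>2" by (simp add: c_def field_simps)
      then show ?case using x by (simp add: ennreal_lessI ennreal_less_iff)
    qed
    then show ?case by (rule eventually_sequentially_Suc[THEN iffD1])
  qed
qed

text \<open>The best log-wealth in hindsight is inserted between both processes: it exceeds \<open>ln (W
  n)\<close> by at most \<open>r\<close>, and is at least the log-wealth of \<open>l\<close>.\<close>

lemma log_gap:
  assumes v: "valid_outcome d E \<omega>" and l: "l \<in> prob_simplex d" and n: "1 \<le> n"
    and regret: "portfolio_regret d E W n \<omega> \<le> ereal r"
    and W'0: "0 \<le> W' n \<omega>" and less: "W' n \<omega> < (real n)\<^sup>2 * wealth d E l n \<omega>"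
  shows "ereal (- (r / real n + 2 * (ln (real n) / real n))) \<le> ereal (1 / real n) * (elog (W n \<omega>) - elog (W' n \<omega>))"
proof -
  obtain s where s: "best_log_wealth d E n \<omega> = ereal s"
    using best_log_wealth_real[OF v] by blast
  have n0: "0 < real n" using n by simp
  have w: "0 < wealth d E l n \<omega>"
    using less W'0 wealth_nonneg[OF v l, of n] by (cases "wealth d E l n \<omega> = 0") auto
  have "ereal s - elog (W n \<omega>) \<le> ereal r"
    using regret unfolding portfolio_regret_def max_log_wealth_eq[OF v] s .
  then obtain a where a: "elog (W n \<omega>) = ereal a" "s - a \<le> r"
    by (cases "W n \<omega> = 0") (auto simp: elog_def)
  have lw: "ln (wealth d E l n \<omega>) \<le> s"
    using best_log_wealth_upper[OF l, of E n \<omega>] unfolding s elog_pos[OF w] by simp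
  have "elog (W' n \<omega>) \<le> elog ((real n)\<^sup>2 * wealth d E l n \<omega>)"
    by (rule elog_mono[OF W'0 less_imp_le[OF less]])
  also have "\<dots> = ereal (2 * ln (real n) + ln (wealth d E l n \<omega>))"
    using n0 w by (simp add: elog_pos ln_mult ln_realpow)
  also have "\<dots> \<le> ereal (2 * ln (real n) + s)" using lw by simp
  finally have "ereal a - ereal (2 * ln (real n) + s) \<le> elog (W n \<omega>) - elog (W' n \<omega>)"
    unfolding a(1) by (rule ereal_minus_mono[OF order_refl])
  moreover have "ereal (- (r + 2 * ln (real n))) \<le> ereal a - ereal (2 * ln (real n) + s)"
    using a(2) by simp
  ultimately have "ereal (- (r + 2 * ln (real n))) \<le> elog (W n \<omega>) - elog (W' n \<omega>)" by (rule order_trans[rotated])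
  then have "ereal (1 / real n) * ereal (- (r + 2 * ln (real n))) \<le> ereal (1 / real n) * (elog (W n \<omega>) - elog (W' n \<omega>))"
    by (rule ereal_mult_left_mono) simp
  moreover have "ereal (1 / real n) * ereal (- (r + 2 * ln (real n))) = ereal (- (r / real n + 2 * (ln (real n) / real n)))"
    using n0 by (simp add: field_simps)
  ultimately show ?thesis by (simp only:)
qed

text \<open>Both error terms, \<open>r n / n\<close> and \<open>2 ln n / n\<close>, vanish in the limit.\<close>

lemma sublinear_regret_imp_instance_log_optimal:
  assumes S: "evalue_setting d \<Omega> F E" and rich: "rich_sample_space d \<Omega> F E"
    and W: "e_process \<Omega> F (null_hypothesis d \<Omega> F E) W" and regret: "sublinear_regret d \<Omega> E W"
    and \<Q>: "\<Q> \<subseteq> iid_distributions d \<Omega> F E"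
  shows "instance_log_optimal \<Omega> F (null_hypothesis d \<Omega> F E) \<Q> W"
  unfolding instance_log_optimal_def
proof (intro conjI W ballI allI impI)
  fix Q W'
  assume "Q \<in> \<Q>" and W': "e_process \<Omega> F (null_hypothesis d \<Omega> F E) W'"
  then have Q: "Q \<in> iid_distributions d \<Omega> F E" using \<Q> by blast
  interpret Q: prob_space Q by (rule iid_distributionsD(1)[OF Q])
  obtain r :: "nat \<Rightarrow> real" where r: "r \<in> o(\<lambda>n. real n)"
    and r_le: "\<forall>n\<ge>1. \<forall>\<omega>\<in>space \<Omega>. portfolio_regret d E W n \<omega> \<le> ereal (r n)"
    using regret unfolding sublinear_regret_def by blast
  obtain l P where l: "l \<in> prob_simplex d" and pos: "AE \<omega> in Q. \<forall>i\<ge>1. 0 < payoff d l (E i \<omega>)"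
    and P: "P \<in> null_hypothesis d \<Omega> F E"
    and dom: "\<And>h. h \<in> borel_measurable (vec_algebra d) \<Longrightarrow>
      (\<integral>\<^sup>+x. ennreal (1 / payoff d l x) * h x \<partial>distr Q (vec_algebra d) (E 1)) \<le>
      (\<integral>\<^sup>+x. h x \<partial>distr P (vec_algebra d) (E 1))"
    and suff: "\<And>n A. A \<in> sets (F n) \<Longrightarrow> \<exists>K\<in>borel_measurable (observed_algebra d \<Omega> E n). \<forall>D\<in>{P, Q}.
      AE \<omega> in D. real_cond_exp D (observed_algebra d \<Omega> E n) (indicator A) \<omega> = K \<omega>"
    by (rule numeraire_null[OF S Q rich]) (rule that)
  have subQ: "subalgebra Q (F n)" for n by (rule subalgebra_iid[OF S iid_distributionsD(2)[OF Q]])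
  have adapted: "\<forall>n\<ge>1. W' n \<in> borel_measurable (F n) \<and> (\<forall>\<omega>\<in>space \<Omega>. 0 \<le> W' n \<omega>)"
    using W' unfolding e_process_def nonneg_adapted_def by (elim conjE)
  have "AE \<omega> in Q. eventually (\<lambda>n. ennreal (inverse_wealth d l E n \<omega>) * ennreal (W' n \<omega>) < ennreal ((real n)\<^sup>2)) sequentially"
  proof (rule eventually_less_square[OF Q.prob_space_axioms])
    fix n :: nat assume n: "1 \<le> n"
    show "(\<lambda>\<omega>. ennreal (inverse_wealth d l E n \<omega>) * ennreal (W' n \<omega>)) \<in> borel_measurable Q"
    proof (rule borel_measurable_times_ennreal)
      show "(\<lambda>\<omega>. ennreal (inverse_wealth d l E n \<omega>)) \<in> borel_measurable Q"
        by (rule measurable_compose[OF inverse_wealth_measurable measurable_ennreal]) (rule iid_measurable[OF S Q])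
      show "(\<lambda>\<omega>. ennreal (W' n \<omega>)) \<in> borel_measurable Q"
        by (rule measurable_compose[OF measurable_from_subalg[OF subQ adapted[THEN spec, THEN mp, OF n, THEN conjunct1]] measurable_ennreal])
    qed
    show "(\<integral>\<^sup>+\<omega>. ennreal (inverse_wealth d l E n \<omega>) * ennreal (W' n \<omega>) \<partial>Q) \<le> 1"
      by (rule e_process_inverse_wealth[OF S Q P l n dom suff W'])
  qed
  moreover have "AE \<omega> in Q. \<omega> \<in> space Q" by simp
  ultimately show "AE \<omega> in Q. 0 \<le> liminf (\<lambda>n. ereal (1 / real n) * (elog (W n \<omega>) - elog (W' n \<omega>)))"
    using pos
  proof eventually_elim
    case (elim \<omega>)
    have \<omega>: "\<omega> \<in> space \<Omega>" using elim(2) iid_distributionsD(3)[OF Q] by blast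
    note v = evalue_setting_valid[OF S \<omega>]
    have "eventually (\<lambda>n. ereal (- (r n / real n + 2 * (ln (real n) / real n))) \<le>
        ereal (1 / real n) * (elog (W n \<omega>) - elog (W' n \<omega>))) sequentially"
      using elim(1) eventually_ge_at_top[of "1::nat"]
    proof eventually_elim
      case (elim n)
      have w: "0 < wealth d E l n \<omega>"
        unfolding wealth_def using \<open>\<forall>i\<ge>1. 0 < payoff d l (E i \<omega>)\<close> by (intro prod_pos) simp
      have W'0: "0 \<le> W' n \<omega>" using adapted elim(2) \<omega> by blast
      have "ennreal (W' n \<omega> / wealth d E l n \<omega>) < ennreal ((real n)\<^sup>2)"
        using elim(1) w W'0 by (simp add: inverse_wealth_eq ennreal_mult[symmetric])
      then have "W' n \<omega> / wealth d E l n \<omega> < (real n)\<^sup>2" using w W'0 by (simp add: ennreal_less_iff)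
      then have "W' n \<omega> < (real n)\<^sup>2 * wealth d E l n \<omega>" using w by (simp add: divide_less_eq)
      then show ?case using r_le elim(2) \<omega> by (intro log_gap[where W = W and W' = W', OF v l elim(2) _ W'0]) blast+
    qed
    then have "liminf (\<lambda>n. ereal (- (r n / real n + 2 * (ln (real n) / real n)))) \<le>
        liminf (\<lambda>n. ereal (1 / real n) * (elog (W n \<omega>) - elog (W' n \<omega>)))"
      by (rule Liminf_mono)
    moreover have "liminf (\<lambda>n. ereal (- (r n / real n + 2 * (ln (real n) / real n)))) = 0"
    proof -
      have "(\<lambda>n. r n / real n) \<longlonglongrightarrow> 0" by (rule smalloD_tendsto[OF r])
      moreover have "(\<lambda>n. ln (real n) / real n) \<longlonglongrightarrow> 0" by (rule lim_ln_over_n)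
      ultimately have "(\<lambda>n. - (r n / real n + 2 * (ln (real n) / real n))) \<longlonglongrightarrow> - (0 + 2 * 0)"
        by (intro tendsto_intros)
      then have "(\<lambda>n. ereal (- (r n / real n + 2 * (ln (real n) / real n)))) \<longlonglongrightarrow> ereal (- (0 + 2 * 0))"
        by (rule tendsto_ereal)
      then show ?thesis by (simp add: lim_imp_Liminf zero_ereal_def)
    qed
    ultimately show ?case by simp
  qed
qed

theorem corollary2p4:
  fixes d :: nat
    and \<Omega> :: "'a measure"
    and F :: "nat \<Rightarrow> 'a measure"
    and E :: "nat \<Rightarrow> 'a \<Rightarrow> nat \<Rightarrow> real"
  assumes "evalue_setting d \<Omega> F E"
  shows
    "(test_supermartingale_for \<Omega> F (null_hypothesis d \<Omega> F E) (W_UP d E) \<and>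
      logarithmic_regret d \<Omega> E (W_UP d E)) \<and>
     (e_process \<Omega> F (null_hypothesis d \<Omega> F E) (W_CO96 d E) \<and>
      logarithmic_regret d \<Omega> E (W_CO96 d E)) \<and>
     (d = 1 \<longrightarrow> (\<forall>lmax. is_maximizer \<Omega> F E lmax \<longrightarrow>
        e_process \<Omega> F (null_hypothesis d \<Omega> F E) (W_OJ23 E lmax) \<and>
        logarithmic_regret d \<Omega> E (W_OJ23 E lmax))) \<and>
     (\<forall>W. W = W_UP d E \<or> W = W_CO96 d E \<or>
           (d = 1 \<and> (\<exists>lmax. is_maximizer \<Omega> F E lmax \<and> W = W_OJ23 E lmax)) \<longrightarrow>
        e_process \<Omega> F (null_hypothesis d \<Omega> F E) W \<and>
        sublinear_regret d \<Omega> E W \<and>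
        (rich_sample_space d \<Omega> F E \<longrightarrow>
          (\<forall>\<Q> \<subseteq> iid_distributions d \<Omega> F E.
             instance_log_optimal \<Omega> F (null_hypothesis d \<Omega> F E) \<Q> W)))"
proof -
  note S = assms
  let ?N = "null_hypothesis d \<Omega> F E"
  note valid = evalue_setting_valid[OF S]
  have UP: "e_process \<Omega> F ?N (W_UP d E)"
    by (rule e_process_of_le_W_UP[OF S W_UP_measurable[OF S]])
       (simp_all only: order_refl less_imp_le[OF W_UP_pos[OF valid]])
  have UP_test: "test_supermartingale_for \<Omega> F ?N (W_UP d E)"
    using UP test_supermartingale_W_UP[OF S] unfolding test_supermartingale_for_def e_process_def by blast
  have UP_regret: "logarithmic_regret d \<Omega> E (W_UP d E)"
    by (rule logarithmic_regret_intro[OF regret_W_UP[OF valid]])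
  have CO: "e_process \<Omega> F ?N (W_CO96 d E)"
  proof (rule e_process_of_le_W_UP[OF S W_CO96_measurable[OF S]])
    show "0 \<le> W_CO96 d E n \<omega>" for n \<omega> unfolding W_CO96_def by (rule exp_ge_zero)
  qed (rule W_CO96_le_W_UP[OF valid])
  have CO_regret: "logarithmic_regret d \<Omega> E (W_CO96 d E)"
    by (rule logarithmic_regret_intro[OF regret_W_CO96[OF valid]])
  have OJ: "e_process \<Omega> F ?N (W_OJ23 E lmax) \<and> logarithmic_regret d \<Omega> E (W_OJ23 E lmax)"
    if d: "d = 1" and lmax: "is_maximizer \<Omega> F E lmax" for lmax
  proof
    note S1 = S[unfolded d]
    note valid1 = evalue_setting_valid[OF S1]
    note maxD = is_maximizerD[OF lmax]
    show "e_process \<Omega> F ?N (W_OJ23 E lmax)"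
      unfolding d
    proof (rule e_process_of_le_W_UP[OF S1 W_OJ23_measurable[OF S1 lmax]])
      show "0 \<le> W_OJ23 E lmax n \<omega>" for n \<omega> unfolding W_OJ23_def by (rule exp_ge_zero)
      show "W_OJ23 E lmax n \<omega> \<le> W_UP 1 E n \<omega>" if "1 \<le> n" "\<omega> \<in> space \<Omega>" for n \<omega>
        by (rule W_OJ23_le_W_UP[where lmax = lmax, OF valid1[OF that(2)] maxD(2)[OF that] maxD(3)[OF that]])
    qed
    show "logarithmic_regret d \<Omega> E (W_OJ23 E lmax)"
      unfolding d
    proof (rule logarithmic_regret_intro)
      show "portfolio_regret 1 E (W_OJ23 E lmax) n \<omega> \<le> ereal (ln (regret_factor 1 n))"
        if "1 \<le> n" "\<omega> \<in> space \<Omega>" for n \<omega>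
        by (rule regret_W_OJ23[where lmax = lmax, OF valid1[OF that(2)] maxD(2)[OF that] maxD(3)[OF that]])
    qed
  qed
  have optimal: "e_process \<Omega> F ?N W \<and> sublinear_regret d \<Omega> E W \<and>
        (rich_sample_space d \<Omega> F E \<longrightarrow>
          (\<forall>\<Q> \<subseteq> iid_distributions d \<Omega> F E. instance_log_optimal \<Omega> F ?N \<Q> W))"
    if W: "e_process \<Omega> F ?N W" "logarithmic_regret d \<Omega> E W" for W
    using sublinear_regret_imp_instance_log_optimal[OF S _ W(1)] W(1) logarithmic_imp_sublinear[OF W(2)] by blast
  show ?thesis
    using UP_test UP_regret CO CO_regret OJ optimal[OF UP UP_regret] optimal[OF CO CO_regret] optimal by blast
qed

end
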